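(* Let $n=2m$, let $D$ be the open $SL(m,\mathbb{H})$-orbit in the manifold $Z$ of complete flags in $\mathbb{C}^{n}$, and $C_0\subset D$ its base cycle. Let $S_w$ be an Iwasawa–Schubert variety with $\dim S_w+\dim C_0=\dim Z$ and $S_w\cap C_0\ne\emptyset$. Then $S_w$ intersects $C_0$ in precisely one point. If $s=s_1\dots s_m\in\Sigma_m$ is the permutation corresponding to $w$, then the intersection point is the complete flag associated with the ordered basis $$(e_{s_1},e_{s_2},\dots,e_{s_m},\mathbf{j}(e_{s_m}),\dots,\mathbf{j}(e_{s_1}))$$ of $\mathbb{C}^n$.
   Context: Let $\mathbf{j}(v)=J\bar v$ on $\mathbb{C}^{2m}$ with $J=\begin{pmatrix}0&I_m\\-I_m&0\end{pmatrix}$, so $\mathbf{j}(e_i)=-e_{m+i}$ for $1\le i\le m$. $G=SL(2m,\mathbb{C})$, $G_0=SL(m,\mathbb{H})=\{X\in G:\mathbf{j}X=X\mathbf{j}\}$, $K_0=SU(2m)\cap G_0=Sp(m)$. $G_0$ has exactly one open orbit $D$ in $Z$. The base cycle $C_0$ is the unique $K_0$-orbit in $D$ that is a complex submanifold; equivalently the set of flags in $D$ with $\dim(V_i\cap V_j^\perp)$ maximal for all $i,j$, with $\perp$ taken for $\omega(v,w)=v^tJw$. Let $(u_1,\dots,u_n)=(e_1,\mathbf{j}(e_1),e_2,\mathbf{j}(e_2),\dots,e_m,\mathbf{j}(e_m))$ and let $B_I\subset G$ be the (Iwasawa–)Borel subgroup stabilizing the complete flag of this ordered basis. For $w\in\Sigma_n$,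 $V_w$ is the complete flag with $k$-th subspace $\langle u_{w(1)},\dots,u_{w(k)}\rangle$, and the Iwasawa–Schubert variety $S_w$ is the closure of $B_I.V_w$. Correspondence: the permutations $w=k_1\dots k_ml_m\dots l_1$ (one-line notation) parametrizing the Iwasawa–Schubert varieties of complementary dimension meeting $C_0$ have every $k_i$ odd and $l_i=k_i+1$; the corresponding $s\in\Sigma_m$ is given by $s_i=(k_i+1)/2$. The flag associated with an ordered basis $(v_1,\dots,v_n)$ is $\langle v_1\rangle\subset\langle v_1,v_2\rangle\subset\dots$. *)

theory Defs
  imports "HOL-Analysis.Analysis" "HOL-Combinatorics.Permutations"
begin

section \<open>The manifold of complete flags\<close>

text \<open>
  A complete flag \<open>V\<^sub>0 \<subset> V\<^sub>1 \<subset> \<dots> \<subset> V\<^sub>n\<close> in \<open>\<complex>\<^sup>n\<close> (\<open>n = CARD('n)\<close>) is encoded as a sequence of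
  subspaces, continued by the whole space beyond index \<open>n\<close> so that equality of flags is
  equality of functions. \<open>vec.subspace\<close>, \<open>vec.dim\<close>, \<open>vec.span\<close> are taken over \<open>\<complex>\<close>.
\<close>

type_synonym 'n flag = "nat \<Rightarrow> (complex^'n) set"

definition flag_manifold :: "('n::finite) flag set" where
  "flag_manifold = {V. (\<forall>k\<le>CARD('n). vec.subspace (V k) \<and> vec.dim (V k) = k)
                     \<and> (\<forall>k. V k \<subseteq> V (Suc k)) \<and> (\<forall>k\<ge>CARD('n). V k = UNIV)}"

text \<open>Ordered bases are indexed from 1: \<open>v 1, \<dots>, v n\<close>.\<close>

definition flag_of_basis :: "(nat \<Rightarrow> complex^'n) \<Rightarrow> ('n::finite) flag" where
  "flag_of_basis v = (\<lambda>k. vec.span (v ` {1..min k (CARD('n))}))"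

definition flag_act :: "complex^'n^'n \<Rightarrow> ('n::finite) flag \<Rightarrow> 'n flag" where
  "flag_act X V = (\<lambda>k. (\<lambda>x. X *v x) ` V k)"

definition flag_orbit :: "(complex^'n^'n) set \<Rightarrow> ('n::finite) flag \<Rightarrow> 'n flag set" where
  "flag_orbit H V = (\<lambda>X. flag_act X V) ` H"

text \<open>
  The flag manifold carries the structure of the complex homogeneous space \<open>GL(n,\<complex>)/B\<close>: its
  topology is the quotient topology for the orbit maps \<open>X \<mapsto> X.V\<close> from \<open>GL(n,\<complex>)\<close>
  (by transitivity all base points \<open>V\<close> give the same topology).
\<close>

definition flag_topology :: "('n::finite) flag topology" where
  "flag_topology = topology (\<lambda>U. U \<subseteq> flag_manifold \<and>
     (\<forall>V\<in>flag_manifold. open {X :: complex^'n^'n. invertible X \<and> flag_act X V \<in> U}))"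

lemma openin_flag_topology:
  fixes U :: "('n::finite) flag set"
  shows "openin flag_topology U \<longleftrightarrow> U \<subseteq> flag_manifold \<and>
     (\<forall>V\<in>flag_manifold. open {X :: complex^'n^'n. invertible X \<and> flag_act X V \<in> U})"
proof -
  let ?P = "\<lambda>U :: 'n flag set. U \<subseteq> flag_manifold \<and>
     (\<forall>V\<in>flag_manifold. open {X :: complex^'n^'n. invertible X \<and> flag_act X V \<in> U})"
  have int: "{X. invertible X \<and> flag_act X V \<in> S \<inter> T} =
      {X. invertible X \<and> flag_act X V \<in> S} \<inter> {X. invertible X \<and> flag_act X V \<in> T}"
    for V :: "'n flag" and S T
    by auto
  have un: "{X. invertible X \<and> flag_act X V \<in> \<Union>\<K>} =
      (\<Union>S\<in>\<K>. {X. invertible X \<and> flag_act X V \<in> S})" for V :: "'n flag" and \<K>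
    by auto
  have "istopology ?P"
    unfolding istopology_def
  proof (intro conjI allI impI)
    fix S T :: "'n flag set"
    assume "?P S" "?P T"
    then show "S \<inter> T \<subseteq> flag_manifold" by auto
    from \<open>?P S\<close> \<open>?P T\<close>
    show "\<forall>V\<in>flag_manifold. open {X. invertible X \<and> flag_act X V \<in> S \<inter> T}"
      unfolding int by (auto intro: open_Int)
  next
    fix \<K> :: "'n flag set set"
    assume "\<forall>S\<in>\<K>. ?P S"
    then show "\<Union>\<K> \<subseteq> flag_manifold"
      and "\<forall>V\<in>flag_manifold. open {X. invertible X \<and> flag_act X V \<in> \<Union>\<K>}"
      unfolding un by blast+
  qed
  then show ?thesis
    by (simp add: flag_topology_def topology_inverse')
qed

subsection \<open>Complex submanifolds and dimension\<close>

text \<open>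
  Since the orbit map \<open>X \<mapsto> X.p\<close> is a holomorphic submersion with \<open>1 \<mapsto> p\<close>, a set \<open>S\<close> of flags is a
  complex submanifold of codimension \<open>c\<close> near \<open>p \<in> S\<close> iff its preimage in \<open>GL(n,\<complex>)\<close> is one near the
  identity, i.e. is locally the common zero set of \<open>c\<close> holomorphic functions \<open>f 0, \<dots>, f (c-1)\<close>
  with linearly independent differentials \<open>f' A 0, \<dots>, f' A (c-1)\<close> (jointly onto \<open>\<complex>\<^sup>c\<close>).
  Holomorphy is real differentiability with complex linear differential;
  \<open>mat z ** H\<close> is the scalar multiple \<open>zH\<close>.
\<close>

definition has_codim_at :: "('n::finite) flag set \<Rightarrow> 'n flag \<Rightarrow> nat \<Rightarrow> bool" where
  "has_codim_at S p c \<longleftrightarrow> p \<in> S \<and>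
     (\<exists>U (f :: nat \<Rightarrow> complex^'n^'n \<Rightarrow> complex) f'.
        open U \<and> mat 1 \<in> U \<and> (\<forall>A\<in>U. invertible A) \<and>
        (\<forall>A\<in>U. \<forall>i<c. (f i has_derivative f' A i) (at A) \<and>
                     (\<forall>z H. f' A i (mat z ** H) = z * f' A i H)) \<and>
        (\<forall>A\<in>U. \<forall>y :: nat \<Rightarrow> complex. \<exists>H. \<forall>i<c. f' A i H = y i) \<and>
        (\<forall>A\<in>U. flag_act A p \<in> S \<longleftrightarrow> (\<forall>i<c. f i A = 0)))"

text \<open>The codimension of a point is the dimension of the ambient manifold.\<close>

definition has_cdim_at :: "('n::finite) flag set \<Rightarrow> 'n flag \<Rightarrow> nat \<Rightarrow> bool" where
  "has_cdim_at S p d \<longleftrightarrow> (\<exists>c. has_codim_at S p c \<and> has_codim_at {p} p (d + c))"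

definition complex_submanifold :: "('n::finite) flag set \<Rightarrow> bool" where
  "complex_submanifold S \<longleftrightarrow> S \<subseteq> flag_manifold \<and> (\<forall>p\<in>S. \<exists>d. has_cdim_at S p d)"

text \<open>
  The dimension of a (possibly singular) analytic set: the maximum of its
  dimensions at regular points.
\<close>

definition cdim :: "('n::finite) flag set \<Rightarrow> nat" where
  "cdim S = Sup {d. \<exists>p\<in>S. has_cdim_at S p d}"

section \<open>The groups\<close>

text \<open>
  \<open>\<complex>\<^sup>2\<^sup>m\<close> is \<open>complex^('m + 'm)\<close> with \<open>m = CARD('m)\<close>: \<open>Inl\<close> indexes the first block of \<open>m\<close>
  coordinates and \<open>Inr\<close> the second one.
\<close>

definition J_mat :: "complex^('m::finite + 'm)^('m + 'm)" where
  "J_mat = (\<chi> a b. case (a, b) of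
      (Inl i, Inr k) \<Rightarrow> (if i = k then 1 else 0)
    | (Inr i, Inl k) \<Rightarrow> (if i = k then - 1 else 0)
    | _ \<Rightarrow> 0)"

definition jmap :: "complex^('m::finite + 'm) \<Rightarrow> complex^('m + 'm)" where
  "jmap v = J_mat *v (\<chi> a. cnj (v $ a))"

definition SL_C :: "(complex^'n^('n::finite)) set" where
  "SL_C = {X. det X = 1}"

definition SL_H :: "(complex^('m::finite + 'm)^('m + 'm)) set" where
  "SL_H = {X \<in> SL_C. \<forall>v. jmap (X *v v) = X *v jmap v}"

definition SU :: "(complex^'n^('n::finite)) set" where
  "SU = {X \<in> SL_C. (\<chi> a b. cnj (X $ b $ a)) ** X = mat 1}"

definition K\<^sub>0 :: "(complex^('m::finite + 'm)^('m + 'm)) set" where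
  "K\<^sub>0 = SU \<inter> SL_H"

definition is_open_orbit :: "('m::finite + 'm) flag set \<Rightarrow> bool" where
  "is_open_orbit D \<longleftrightarrow> (\<exists>V\<in>flag_manifold. D = flag_orbit SL_H V) \<and> openin flag_topology D"

definition is_base_cycle :: "('m::finite + 'm) flag set \<Rightarrow> ('m + 'm) flag set \<Rightarrow> bool" where
  "is_base_cycle D C \<longleftrightarrow> (\<exists>V\<in>D. C = flag_orbit K\<^sub>0 V) \<and> complex_submanifold C"

section \<open>Iwasawa--Schubert varieties\<close>

text \<open>
  Below, \<open>\<iota>\<close> is a bijection from \<open>{1..m}\<close> onto the index type \<open>'m\<close>, giving the order
  of the standard basis vectors \<open>e\<^sub>1, \<dots>, e\<^sub>m\<close>; it enters nowhere above.
\<close>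

definition e_vec :: "(nat \<Rightarrow> 'm) \<Rightarrow> nat \<Rightarrow> complex^('m::finite + 'm)" where
  "e_vec \<iota> i = axis (Inl (\<iota> i)) 1"

lemma jmap_e_vec: "jmap (e_vec \<iota> i) = - axis (Inr (\<iota> i)) 1"
proof -
  have cnj_e: "cnj (e_vec \<iota> i $ b) = (if b = Inl (\<iota> i) then 1 else 0)" for b
    by (simp add: e_vec_def axis_def)
  have "jmap (e_vec \<iota> i) $ a = J_mat $ a $ Inl (\<iota> i)" for a
    by (simp add: jmap_def matrix_vector_mult_def cnj_e if_distrib cong: if_cong)
  then show ?thesis
    by (auto simp: vec_eq_iff J_mat_def axis_def split: sum.split)
qed

definition iwasawa_basis :: "(nat \<Rightarrow> 'm) \<Rightarrow> nat \<Rightarrow> complex^('m::finite + 'm)" where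
  "iwasawa_basis \<iota> k =
     (if odd k then e_vec \<iota> ((k + 1) div 2) else jmap (e_vec \<iota> (k div 2)))"

definition iwasawa_borel :: "(nat \<Rightarrow> 'm) \<Rightarrow> (complex^('m::finite + 'm)^('m + 'm)) set" where
  "iwasawa_borel \<iota> = {X \<in> SL_C. flag_act X (flag_of_basis (iwasawa_basis \<iota>))
                                 = flag_of_basis (iwasawa_basis \<iota>)}"

definition coordinate_flag :: "(nat \<Rightarrow> 'm) \<Rightarrow> (nat \<Rightarrow> nat) \<Rightarrow> ('m::finite + 'm) flag" where
  "coordinate_flag \<iota> w = flag_of_basis (\<lambda>k. iwasawa_basis \<iota> (w k))"

definition schubert :: "(nat \<Rightarrow> 'm) \<Rightarrow> (nat \<Rightarrow> nat) \<Rightarrow> ('m::finite + 'm) flag set" where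
  "schubert \<iota> w =
     flag_topology closure_of (flag_orbit (iwasawa_borel \<iota>) (coordinate_flag \<iota> w))"

text \<open>
  With \<open>w = k\<^sub>1 \<dots> k\<^sub>m l\<^sub>m \<dots> l\<^sub>1\<close> in one-line notation, \<open>k\<^sub>i = w i\<close> and \<open>l\<^sub>i = w (2m + 1 - i)\<close>.
\<close>

definition corresponding_perm :: "nat \<Rightarrow> (nat \<Rightarrow> nat) \<Rightarrow> (nat \<Rightarrow> nat) \<Rightarrow> bool" where
  "corresponding_perm m w s \<longleftrightarrow> s permutes {1..m} \<and>
     (\<forall>i\<in>{1..m}. odd (w i) \<and> w (2 * m + 1 - i) = w i + 1 \<and> s i = (w i + 1) div 2)"

definition intersection_basis ::
    "(nat \<Rightarrow> 'm) \<Rightarrow> nat \<Rightarrow> (nat \<Rightarrow> nat) \<Rightarrow> nat \<Rightarrow> complex^('m::finite + 'm)" where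
  "intersection_basis \<iota> m s k =
     (if k \<le> m then e_vec \<iota> (s k) else jmap (e_vec \<iota> (s (2 * m + 1 - k))))"

end

theory Submission
  imports Defs
begin

text \<open>
  The tangent cone of a complex submanifold of the flag manifold, pulled back to matrices, is a complex subspace
  of the right codimension. That of \<open>C\<^sub>0\<close> contains the Lie algebra of \<open>K\<^sub>0\<close>, hence also \<open>\<i>\<close> times the Lie algebra. By
  this, a point of \<open>C\<^sub>0\<close> at which a generic height function is maximal is a coordinate flag, and its ordering of
  the coordinates is reversed by \<open>j\<close>. So every flag \<open>V\<close> of \<open>C\<^sub>0\<close> is isotropic, \<open>V\<^sub>n\<^sub>-\<^sub>k\<close> being the orthogonal of \<open>V\<^sub>k\<close>
  for \<open>\<omega>\<close>, and \<open>C\<^sub>0\<close> has codimension at most \<open>m(m - 1)\<close>.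

  Locally at its coordinate flag, \<open>S\<^sub>w\<close> is cut out by as many independent minors as \<open>w\<close> has non-inversions, hence
  \<open>w\<close> has at most \<open>m(m - 1)\<close> inversions. An isotropic flag in \<open>S\<^sub>w\<close> has intersections with the \<open>j\<close>-invariant coordinate
  subspaces which are large because the flag lies in \<open>S\<^sub>w\<close> and small because it is isotropic. These dimension
  inequalities force \<open>w\<close> to have at least \<open>m(m - 1)\<close> inversions; in the case of equality \<open>w\<close> has the stated form,
  and all the dimensions are attained, which pins down the flag.
\<close>

subsection \<open>Complex linear functionals on matrices\<close>

text \<open>\<open>has_codim_at\<close> only asserts that some defining functions exist. The tangent
  cone depends on the set and the point alone, so it turns counts of equations into comparisons of
  subspaces.

  The height function does the work of a fixed point theorem. Its gradient on the orbit is the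
  tangent direction \<open>H\<close>, available only because the cone is closed under multiplication
  by i; at a maximum \<open>H\<close> therefore stabilizes the flag, and distinct eigenvalues leave
  only coordinate flags.

  \<open>cdim\<close> is a supremum over regular points, so the dimensions enter through one-sided
  bounds: with N = n(n-1)/2, at most N for all flags, at least N - m(m-1) for
  \<open>C\<^sub>0\<close>, and at least the number of inversions for the Schubert variety. The
  constant m(m-1) = m(2m-1) - m^2 is the codimension of the symplectic flag manifold in the full
  one.

  Among the members of the reference flag only those of even index are j-invariant. Hence the
  combinatorics sees the letters 2i-1 and 2i only as a block, and the order within a block has to be
  recovered separately.\<close>

lemma mat_mult_nth [simp]: "(mat z ** H) $ i $ j = z * H $ i $ j"
  for H :: "complex^'n^('n::finite)"
  by (simp add: matrix_matrix_mult_def mat_def if_distrib [where f = "\<lambda>x. x * _"] cong: if_cong)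

lemma mat_mult_eq: "mat z ** H = (\<chi> i j. z * H $ i $ j)"
  for H :: "complex^'n^('n::finite)"
  by (simp add: vec_eq_iff)

lemma norm_mat_mult: "norm (mat z ** H) = norm z * norm H"
  for H :: "complex^'n^('n::finite)"
  by (simp add: norm_vec_def norm_mult L2_set_right_distrib [symmetric] L2_set_nonneg)

text \<open>Scalars act by \<open>mat z ** X\<close>, as in \<open>has_codim_at\<close>;
  \<open>*\<^sub>R\<close> only sees the real structure.\<close>

definition clinear :: "(complex^'n^('n::finite) \<Rightarrow> complex) \<Rightarrow> bool" where
  "clinear \<phi> \<longleftrightarrow> (\<forall>X Y. \<phi> (X + Y) = \<phi> X + \<phi> Y) \<and> (\<forall>z X. \<phi> (mat z ** X) = z * \<phi> X)"

lemma clinear_add: "clinear \<phi> \<Longrightarrow> \<phi> (X + Y) = \<phi> X + \<phi> Y"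
  and clinear_scale: "clinear \<phi> \<Longrightarrow> \<phi> (mat z ** X) = z * \<phi> X"
  by (auto simp: clinear_def)

lemma clinear_zero: "clinear \<phi> \<Longrightarrow> \<phi> 0 = 0"
  using clinear_scale [of \<phi> 0 0] by simp

lemma clinear_sum: "clinear \<phi> \<Longrightarrow> \<phi> (\<Sum>i\<in>I. X i) = (\<Sum>i\<in>I. \<phi> (X i))"
  by (induction I rule: infinite_finite_induct) (auto simp: clinear_add clinear_zero)

text \<open>Gaussian elimination, one row at a time: a nonzero entry of row \<open>i0\<close> serves
  as pivot, and its unknown is recovered from a solution of the smaller system.\<close>

lemma homogeneous_system_nontrivial:
  fixes M :: "'i \<Rightarrow> 'j \<Rightarrow> complex"
  assumes "finite I" "finite J" "card I < card J"
  shows "\<exists>z. (\<exists>j\<in>J. z j \<noteq> 0) \<and> (\<forall>i\<in>I. (\<Sum>j\<in>J. z j * M i j) = 0)"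
  using assms
proof (induction I arbitrary: J M rule: finite_induct)
  case empty
  then obtain j where "j \<in> J" by (metis card.empty less_numeral_extra(3) equals0I)
  then show ?case by (intro exI [of _ "\<lambda>_. 1"]) auto
next
  case (insert i0 I)
  show ?case
  proof (cases "\<exists>j0\<in>J. M i0 j0 \<noteq> 0")
    case False
    obtain z where "\<exists>j\<in>J. z j \<noteq> 0" "\<forall>i\<in>I. (\<Sum>j\<in>J. z j * M i j) = 0"
      using insert.IH [of J M] insert.prems insert.hyps by auto
    with False show ?thesis by (intro exI [of _ z]) auto
  next
    case True
    then obtain j0 where j0: "j0 \<in> J" "M i0 j0 \<noteq> 0" by blast
    let ?J = "J - {j0}"
    \<comment> \<open>Row \<open>i\<close> minus the multiple of row \<open>i0\<close> that clears
      column \<open>j0\<close>.\<close>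
    let ?M = "\<lambda>i j. M i j - M i j0 * M i0 j / M i0 j0"
    have "card I < card ?J"
      using insert.prems insert.hyps j0 by auto
    then obtain z where z: "\<exists>j\<in>?J. z j \<noteq> 0" "\<forall>i\<in>I. (\<Sum>j\<in>?J. z j * ?M i j) = 0"
      using insert.IH [of ?J ?M] insert.prems by auto
    define s where "s = (\<Sum>j\<in>?J. z j * M i0 j) / M i0 j0"
    define y where "y = z(j0 := - s)"
    have y: "(\<Sum>j\<in>J. y j * M i j) = (\<Sum>j\<in>?J. z j * M i j) - s * M i j0" for i
    proof -
      have "(\<Sum>j\<in>J. y j * M i j) = y j0 * M i j0 + (\<Sum>j\<in>?J. y j * M i j)"
        using j0 insert.prems by (intro sum.remove) auto
      also have "(\<Sum>j\<in>?J. y j * M i j) = (\<Sum>j\<in>?J. z j * M i j)"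
        by (intro sum.cong) (auto simp: y_def)
      finally show ?thesis by (simp add: y_def)
    qed
    have "(\<Sum>j\<in>J. y j * M i0 j) = 0"
      unfolding y using j0 by (simp add: s_def)
    moreover have "(\<Sum>j\<in>J. y j * M i j) = 0" if "i \<in> I" for i
    proof -
      have "0 = (\<Sum>j\<in>?J. z j * ?M i j)" using z that by simp
      also have "\<dots> = (\<Sum>j\<in>?J. z j * M i j) - s * M i j0"
        by (simp add: s_def algebra_simps sum_subtractf sum_divide_distrib sum_distrib_left sum_distrib_right)
      finally show ?thesis by (simp add: y)
    qed
    moreover have "\<exists>j\<in>J. y j \<noteq> 0" using z by (auto simp: y_def)
    ultimately show ?thesis by (intro exI [of _ y]) auto
  qed
qed

text \<open>The family \<open>H\<close> certifies that the \<open>\<phi> j\<close> are independent,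
  so their common kernel has codimension \<open>card J\<close>; a kernel contained in it needs at
  least as many equations. All codimensions below are compared in this form.\<close>

lemma card_le_of_kernel_subset:
  fixes \<psi> :: "'i \<Rightarrow> complex^'n^('n::finite) \<Rightarrow> complex" and \<phi> :: "'j \<Rightarrow> complex^'n^('n::finite) \<Rightarrow> complex"
  assumes "finite I" "finite J"
    and \<psi>: "\<And>i. i \<in> I \<Longrightarrow> clinear (\<psi> i)" and \<phi>: "\<And>j. j \<in> J \<Longrightarrow> clinear (\<phi> j)"
    and dual: "\<And>j k. j \<in> J \<Longrightarrow> k \<in> J \<Longrightarrow> \<phi> j (H k) = (if j = k then 1 else 0)"
    and ker: "\<And>X. \<forall>i\<in>I. \<psi> i X = 0 \<Longrightarrow> \<forall>j\<in>J. \<phi> j X = 0"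
  shows "card J \<le> card I"
proof (rule ccontr)
  assume "\<not> card J \<le> card I"
  then obtain z where z: "\<exists>j\<in>J. z j \<noteq> 0" "\<forall>i\<in>I. (\<Sum>j\<in>J. z j * \<psi> i (H j)) = 0"
    using homogeneous_system_nontrivial [of I J "\<lambda>i j. \<psi> i (H j)"] assms by (auto simp: not_le)
  let ?X = "\<Sum>j\<in>J. mat (z j) ** H j"
  have "\<forall>i\<in>I. \<psi> i ?X = 0"
    using z \<psi> by (simp add: clinear_sum clinear_scale)
  then have "\<forall>j\<in>J. \<phi> j ?X = 0" by (rule ker)
  moreover have "\<phi> j ?X = z j" if "j \<in> J" for j
    using that \<phi> \<open>finite J\<close> by (simp add: clinear_sum clinear_scale dual if_distrib cong: if_cong)
  ultimately show False using z by simp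
qed

subsection \<open>Tangent cones\<close>

lemma flag_act_mat_1 [simp]: "flag_act (mat 1) p = p"
  by (simp add: flag_act_def)

lemma flag_act_mult: "flag_act (A ** B) p = flag_act A (flag_act B p)"
  by (auto simp: flag_act_def image_image matrix_vector_mul_assoc)

text \<open>The sequential (Bouligand) tangent cone, pulled back along the orbit map of
  \<open>p\<close>. No equations for \<open>S\<close> enter, so different descriptions of one set
  can be compared through it.\<close>

definition tangent_cone :: "('n::finite) flag set \<Rightarrow> 'n flag \<Rightarrow> (complex^'n^'n) set" where
  "tangent_cone S p = {X. \<exists>t Z. (\<forall>n. t n > 0) \<and> t \<longlonglongrightarrow> (0::real) \<and> Z \<longlonglongrightarrow> X \<and>
     (\<forall>n. flag_act (mat 1 + t n *\<^sub>R Z n) p \<in> S)}"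

lemma tangent_coneI:
  assumes "\<And>n. t n > 0" "t \<longlonglongrightarrow> (0::real)" "Z \<longlonglongrightarrow> X"
    "\<And>n. flag_act (mat 1 + t n *\<^sub>R Z n) p \<in> S"
  shows "X \<in> tangent_cone S p"
  using assms unfolding tangent_cone_def by blast

text \<open>Since \<open>f\<close> vanishes along the sequence, the remainder of its first-order
  expansion is, up to sign, the linear term alone.\<close>

lemma tangent_cone_derivative_zero:
  fixes f :: "complex^'n^('n::finite) \<Rightarrow> complex"
  assumes X: "X \<in> tangent_cone S p" and U: "open U" "mat 1 \<in> U"
    and der: "(f has_derivative \<phi>) (at (mat 1))"
    and zero: "\<And>A. A \<in> U \<Longrightarrow> flag_act A p \<in> S \<Longrightarrow> f A = 0" and one: "f (mat 1) = 0"
  shows "\<phi> X = 0"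
proof -
  obtain t Z where tZ: "\<And>n. t n > 0" "t \<longlonglongrightarrow> (0::real)" "Z \<longlonglongrightarrow> X"
    "\<And>n. flag_act (mat 1 + t n *\<^sub>R Z n) p \<in> S"
    using X by (auto simp: tangent_cone_def)
  have lin: "bounded_linear \<phi>" using der by (rule has_derivative_bounded_linear)
  let ?A = "\<lambda>n. mat 1 + t n *\<^sub>R Z n"
  have A1: "?A \<longlonglongrightarrow> mat 1"
    using tendsto_add [OF tendsto_const tendsto_scaleR [OF tZ(2,3)]] by simp
  then have "\<forall>\<^sub>F n in sequentially. ?A n \<in> U"
    using U by (rule topological_tendstoD)
  then have ev: "\<forall>\<^sub>F n in sequentially. f (?A n) = 0"
    by eventually_elim (use zero tZ(4) in blast)
  have "((\<lambda>n. (norm (f (?A n) - f (mat 1) - \<phi> (?A n - mat 1))) / norm (?A n - mat 1)) \<longlongrightarrow> 0) sequentially"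
  proof -
    have "((\<lambda>y. norm (f y - f (mat 1) - \<phi> (y - mat 1)) / norm (y - mat 1)) \<longlongrightarrow> 0) (at (mat 1))"
      using der by (simp add: has_derivative_iff_norm)
    then have "isCont (\<lambda>y. norm (f y - f (mat 1) - \<phi> (y - mat 1)) / norm (y - mat 1)) (mat 1)"
      by (simp add: isCont_def)
    from isCont_tendsto_compose [OF this A1] show ?thesis by simp
  qed
  then have "((\<lambda>n. norm (\<phi> (Z n)) / norm (Z n)) \<longlongrightarrow> 0) sequentially"
  proof (rule Lim_transform_eventually)
    show "\<forall>\<^sub>F n in sequentially. norm (f (?A n) - f (mat 1) - \<phi> (?A n - mat 1)) / norm (?A n - mat 1)
        = norm (\<phi> (Z n)) / norm (Z n)"
      using ev
    proof eventually_elim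
      case (elim n)
      have "t n \<noteq> 0" using tZ(1) [of n] by simp
      then show ?case using elim one linear_cmul [OF bounded_linear.linear [OF lin]] by simp
    qed
  qed
  \<comment> \<open>Multiplying by the convergent \<open>norm (Z n)\<close>, instead of dividing by
    \<open>norm X\<close>, also covers \<open>X = 0\<close>.\<close>
  then have "((\<lambda>n. norm (\<phi> (Z n)) / norm (Z n) * norm (Z n)) \<longlongrightarrow> 0 * norm X) sequentially"
    by (intro tendsto_mult tendsto_norm tZ)
  moreover have "norm (\<phi> (Z n)) / norm (Z n) * norm (Z n) = norm (\<phi> (Z n))" for n
    using linear_0 [OF bounded_linear.linear [OF lin]] by (cases "Z n = 0") auto
  ultimately have "(\<lambda>n. norm (\<phi> (Z n))) \<longlonglongrightarrow> 0" by simp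
  moreover have "(\<lambda>n. norm (\<phi> (Z n))) \<longlonglongrightarrow> norm (\<phi> X)"
    by (intro tendsto_norm bounded_linear.tendsto [OF lin] tZ)
  ultimately show ?thesis using LIMSEQ_unique by fastforce
qed

text \<open>Solves \<open>f i (1 + t X + Y) = 0\<close> with \<open>Y = o(t)\<close> by applying Brouwer's theorem to the remainders of
  the \<open>f i\<close>; the inverse function theorem does not apply, as \<open>has_codim_at\<close> does not ask for continuous derivatives.\<close>

lemma zero_set_curve:
  fixes f :: "nat \<Rightarrow> complex^'n^('n::finite) \<Rightarrow> complex"
  assumes U: "open U" "mat 1 \<in> U"
    and cont: "\<And>i. i < c \<Longrightarrow> continuous_on U (f i)"
    and der: "\<And>i. i < c \<Longrightarrow> (f i has_derivative \<phi> i) (at (mat 1))"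
    and lin: "\<And>i. i < c \<Longrightarrow> clinear (\<phi> i)"
    and dual: "\<And>i j. i < c \<Longrightarrow> j < c \<Longrightarrow> \<phi> i (H j) = (if i = j then 1 else 0)"
    and one: "\<And>i. i < c \<Longrightarrow> f i (mat 1) = 0"
    and X: "\<And>i. i < c \<Longrightarrow> \<phi> i X = 0" and "\<eta> > 0"
  shows "\<exists>t Y. 0 < t \<and> t < \<eta> \<and> norm Y \<le> \<eta> \<and> mat 1 + t *\<^sub>R (X + Y) \<in> U \<and>
    (\<forall>i<c. f i (mat 1 + t *\<^sub>R (X + Y)) = 0)"
proof -
  define h where "h = (\<Sum>i<c. norm (H i))"
  have h: "h \<ge> 0" by (simp add: h_def sum_nonneg)
  \<comment> \<open>\<open>h\<close> bounds the cost of correcting the remainders by the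
    \<open>H i\<close>; with this \<open>\<epsilon>\<close> the map \<open>\<Phi>\<close> below
    sends the ball of radius \<open>t * \<eta>\<close> into itself, with a factor
    \<open>h / (h + 1)\<close> to spare.\<close>
  define \<epsilon> where "\<epsilon> = \<eta> / ((h + 1) * (norm X + \<eta>))"
  have XE: "norm X + \<eta> > 0" using \<open>\<eta> > 0\<close> norm_ge_zero [of X] by linarith
  have \<epsilon>: "\<epsilon> > 0" using \<open>\<eta> > 0\<close> h XE by (simp add: \<epsilon>_def)
  define \<rho> where "\<rho> i K = f i (mat 1 + K) - \<phi> i K" for i K
  have "\<exists>\<delta>>0. \<forall>i<c. \<forall>K. norm K < \<delta> \<longrightarrow> norm (\<rho> i K) \<le> \<epsilon> * norm K"
  proof -
    have "\<forall>i<c. \<exists>\<delta>>0. \<forall>K. norm K < \<delta> \<longrightarrow> norm (\<rho> i K) \<le> \<epsilon> * norm K"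
    proof (intro allI impI)
      fix i assume i: "i < c"
      obtain \<delta> where "\<delta> > 0" and d: "\<And>y. norm (y - mat 1) < \<delta> \<Longrightarrow>
          norm (f i y - f i (mat 1) - \<phi> i (y - mat 1)) \<le> \<epsilon> * norm (y - mat 1)"
        using der [OF i] \<epsilon> unfolding has_derivative_at_alt by meson
      then show "\<exists>\<delta>>0. \<forall>K. norm K < \<delta> \<longrightarrow> norm (\<rho> i K) \<le> \<epsilon> * norm K"
        using d [of "mat 1 + _"] one [OF i] by (intro exI [of _ \<delta>]) (auto simp: \<rho>_def)
    qed
    then obtain \<delta> where \<delta>: "\<And>i. i < c \<Longrightarrow> \<delta> i > 0 \<and> (\<forall>K. norm K < \<delta> i \<longrightarrow> norm (\<rho> i K) \<le> \<epsilon> * norm K)"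
      by metis
    show ?thesis
      by (intro exI [of _ "Min (insert 1 (\<delta> ` {..<c}))"]) (use \<delta> in auto)
  qed
  then obtain \<delta> where \<delta>: "\<delta> > 0" "\<And>i K. i < c \<Longrightarrow> norm K < \<delta> \<Longrightarrow> norm (\<rho> i K) \<le> \<epsilon> * norm K"
    by blast
  obtain r where r: "r > 0" "ball (mat 1) r \<subseteq> U"
    using U open_contains_ball by blast
  define t where "t = min (\<eta> / 2) (min \<delta> r / (2 * (norm X + \<eta>)))"
  have "t \<le> \<eta> / 2" unfolding t_def by (rule min.cobounded1)
  then have t: "0 < t" "t < \<eta>" using \<open>\<eta> > 0\<close> \<delta> r XE by (auto simp: t_def)
  have "t \<le> min \<delta> r / (2 * (norm X + \<eta>))" by (simp add: t_def)
  then have "t * (norm X + \<eta>) * 2 \<le> min \<delta> r"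
    using XE by (simp add: pos_le_divide_eq algebra_simps)
  moreover have "min \<delta> r > 0" using \<delta> r by simp
  ultimately have tX: "t * (norm X + \<eta>) < min \<delta> r" by linarith
  have small: "norm (t *\<^sub>R X + Y) \<le> t * (norm X + \<eta>)" if "norm Y \<le> t * \<eta>" for Y :: "complex^'n^'n"
  proof -
    have "norm (t *\<^sub>R X + Y) \<le> t * norm X + norm Y"
      using norm_triangle_ineq [of "t *\<^sub>R X" Y] t by simp
    also have "\<dots> \<le> t * norm X + t * \<eta>" using that by simp
    finally show ?thesis by (simp add: algebra_simps)
  qed
  \<comment> \<open>As \<open>H\<close> is dual to the \<open>\<phi> k\<close>, a fixed point
    \<open>Y\<close> satisfies \<open>\<phi> k Y = - \<rho> k (t *\<^sub>R X + Y)\<close>, and this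
    says that \<open>f k\<close> vanishes at the displaced point.\<close>
  define \<Phi> where "\<Phi> Y = - (\<Sum>i<c. mat (\<rho> i (t *\<^sub>R X + Y)) ** H i)" for Y
  have inU: "mat 1 + (t *\<^sub>R X + Y) \<in> U" if "Y \<in> cball 0 (t * \<eta>)" for Y
  proof -
    have "norm (t *\<^sub>R X + Y) < r" using small [of Y] that tX by auto
    then have "mat 1 + (t *\<^sub>R X + Y) \<in> ball (mat 1) r"
      by (metis add_diff_cancel_left' dist_commute dist_norm mem_ball)
    with r(2) show ?thesis by blast
  qed
  have "continuous_on (cball 0 (t * \<eta>)) \<Phi>"
  proof -
    have "continuous_on (cball 0 (t * \<eta>)) (\<lambda>Y. \<rho> i (t *\<^sub>R X + Y))" if "i < c" for i
      unfolding \<rho>_def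
    proof (intro continuous_on_diff)
      show "continuous_on (cball 0 (t * \<eta>)) (\<lambda>Y. f i (mat 1 + (t *\<^sub>R X + Y)))"
        by (rule continuous_on_compose2 [OF cont [OF that]])
           (use inU in \<open>auto intro!: continuous_intros\<close>)
      show "continuous_on (cball 0 (t * \<eta>)) (\<lambda>Y. \<phi> i (t *\<^sub>R X + Y))"
        by (intro bounded_linear.continuous_on [OF has_derivative_bounded_linear [OF der [OF that]]]
            continuous_on_add continuous_on_const continuous_on_id)
    qed
    then show ?thesis
      unfolding \<Phi>_def
      by (intro continuous_on_minus continuous_on_sum)
         (auto simp: mat_mult_eq intro!: continuous_on_vec_lambda continuous_on_mult_right)
  qed
  moreover have "\<Phi> \<in> cball 0 (t * \<eta>) \<rightarrow> cball 0 (t * \<eta>)"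
  proof
    fix Y :: "complex^'n^'n" assume Y: "Y \<in> cball 0 (t * \<eta>)"
    have "norm (\<Phi> Y) \<le> (\<Sum>i<c. norm (\<rho> i (t *\<^sub>R X + Y)) * norm (H i))"
      unfolding \<Phi>_def norm_minus_cancel by (rule order_trans [OF norm_sum]) (simp add: norm_mat_mult)
    also have "\<dots> \<le> (\<Sum>i<c. (\<epsilon> * (t * (norm X + \<eta>))) * norm (H i))"
    proof (intro sum_mono mult_right_mono)
      fix i assume "i \<in> {..<c}"
      then have "norm (\<rho> i (t *\<^sub>R X + Y)) \<le> \<epsilon> * norm (t *\<^sub>R X + Y)"
        using \<delta>(2) small [of Y] tX Y by auto
      also have "\<dots> \<le> \<epsilon> * (t * (norm X + \<eta>))" using small [of Y] Y \<epsilon> by auto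
      finally show "norm (\<rho> i (t *\<^sub>R X + Y)) \<le> \<epsilon> * (t * (norm X + \<eta>))" .
    qed auto
    also have "\<dots> = \<epsilon> * (t * (norm X + \<eta>)) * h" by (simp add: h_def sum_distrib_left)
    also have "\<dots> = t * \<eta> * (h / (h + 1))" using XE h by (simp add: \<epsilon>_def)
    also have "\<dots> \<le> t * \<eta> * 1"
      using t \<open>\<eta> > 0\<close> h by (intro mult_left_mono) auto
    finally show "\<Phi> Y \<in> cball 0 (t * \<eta>)" by simp
  qed
  ultimately obtain Y where Y: "Y \<in> cball 0 (t * \<eta>)" "\<Phi> Y = Y"
    using brouwer_ball [of "t * \<eta>" 0 \<Phi>] t \<open>\<eta> > 0\<close> by (auto simp: Pi_iff image_subset_iff)
  have "f k (mat 1 + (t *\<^sub>R X + Y)) = 0" if k: "k < c" for k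
  proof -
    have cl: "clinear (\<phi> k)" using lin k by simp
    have "\<phi> k Y = - (\<Sum>i<c. \<rho> i (t *\<^sub>R X + Y) * (if k = i then 1 else 0))"
    proof -
      have "\<phi> k Y + (\<Sum>i<c. \<phi> k (mat (\<rho> i (t *\<^sub>R X + Y)) ** H i)) = \<phi> k (\<Phi> Y + (\<Sum>i<c. mat (\<rho> i (t *\<^sub>R X + Y)) ** H i))"
        using Y cl by (simp add: clinear_sum clinear_add)
      also have "\<dots> = 0" using cl by (simp add: \<Phi>_def clinear_zero)
      finally have "\<phi> k Y + (\<Sum>i<c. \<rho> i (t *\<^sub>R X + Y) * \<phi> k (H i)) = 0"
        using cl by (simp add: clinear_scale)
      moreover have "(\<Sum>i<c. \<rho> i (t *\<^sub>R X + Y) * \<phi> k (H i)) = (\<Sum>i<c. \<rho> i (t *\<^sub>R X + Y) * (if k = i then 1 else 0))"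
        using dual k by (intro sum.cong) auto
      ultimately show ?thesis by (simp add: eq_neg_iff_add_eq_0)
    qed
    also have "\<dots> = - \<rho> k (t *\<^sub>R X + Y)" using k by (simp add: if_distrib cong: if_cong)
    finally have "\<phi> k Y = - \<rho> k (t *\<^sub>R X + Y)" .
    moreover have "\<phi> k (t *\<^sub>R X + Y) = \<phi> k Y"
      using linear_add [OF has_derivative_linear [OF der [OF k]]] linear_cmul [OF has_derivative_linear [OF der [OF k]]] X [OF k]
      by simp
    ultimately show ?thesis by (simp add: \<rho>_def)
  qed
  moreover have "t *\<^sub>R X + Y = t *\<^sub>R (X + Y /\<^sub>R t)" using t by (simp add: algebra_simps)
  moreover have "norm (Y /\<^sub>R t) \<le> \<eta>" using Y t by (simp add: field_simps)
  ultimately show ?thesis using t inU [OF Y(1)] by (intro exI [of _ t] exI [of _ "Y /\<^sub>R t"]) auto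
qed

text \<open>The cone is exactly the common kernel of the differentials, hence a complex subspace
  whose codimension is the number of equations. Differentiation along sequences gives one inclusion,
  \<open>zero_set_curve\<close> the other.\<close>

lemma tangent_cone_of_codim:
  fixes S :: "('n::finite) flag set"
  assumes "has_codim_at S p c"
  obtains \<phi> H where "\<And>i. i < c \<Longrightarrow> clinear (\<phi> i)"
    and "\<And>i j. i < c \<Longrightarrow> j < c \<Longrightarrow> \<phi> i (H j) = (if i = j then 1 else (0::complex))"
    and "\<And>X. X \<in> tangent_cone S p \<longleftrightarrow> (\<forall>i<c. \<phi> i X = 0)"
proof -
  from assms obtain U f f' where p: "p \<in> S" and U: "open U" "mat 1 \<in> U"
    and 1: "\<forall>A\<in>U. \<forall>i<c. (f i has_derivative f' A i) (at A) \<and>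
                     (\<forall>z H. f' A i (mat z ** H) = z * f' A i H)"
    and surj: "\<forall>A\<in>U. \<forall>y :: nat \<Rightarrow> complex. \<exists>H. \<forall>i<c. f' A i H = y i"
    and 2: "\<forall>A\<in>U. flag_act A p \<in> S \<longleftrightarrow> (\<forall>i<c. f i A = 0)"
    unfolding has_codim_at_def by (elim conjE exE) (rule that; assumption)
  have zero: "flag_act A p \<in> S \<longleftrightarrow> (\<forall>i<c. f i A = 0)" if "A \<in> U" for A
    using 2 that by (rule bspec)
  have der: "(f i has_derivative f' A i) (at A)"
    and scale: "f' A i (mat z ** H) = z * f' A i H" if "A \<in> U" "i < c" for A i z H
    using 1 that by blast+
  let ?\<phi> = "f' (mat 1)"
  have lin: "clinear (?\<phi> i)" if "i < c" for i
    unfolding clinear_def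
    using linear_add [OF has_derivative_linear [OF der [OF U(2) that]]] scale [OF U(2) that] by blast
  have "\<exists>H. \<forall>i<c. ?\<phi> i H = (if i = j then 1 else 0)" for j
    using spec [OF bspec [OF surj U(2)], of "\<lambda>i. if i = j then 1 else 0"] .
  then obtain H where dual: "\<And>i j. i < c \<Longrightarrow> ?\<phi> i (H j) = (if i = j then 1 else 0)" by metis
  have one: "f i (mat 1) = 0" if "i < c" for i
    using zero [OF U(2)] p that by simp
  have cont: "continuous_on U (f i)" if "i < c" for i
    using der that by (meson continuous_at_imp_continuous_on has_derivative_continuous)
  have "X \<in> tangent_cone S p \<longleftrightarrow> (\<forall>i<c. ?\<phi> i X = 0)" for X
  proof
    assume "X \<in> tangent_cone S p"
    then show "\<forall>i<c. ?\<phi> i X = 0"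
      using tangent_cone_derivative_zero [OF _ U der [OF U(2)]] zero one by blast
  next
    assume X: "\<forall>i<c. ?\<phi> i X = 0"
    \<comment> \<open>Tolerances 1/(n+1) produce the null sequence \<open>t\<close> and the
      directions \<open>X + Y n\<close> that the definition of the cone asks for.\<close>
    have "\<forall>n::nat. \<exists>t Y. 0 < t \<and> t < inverse (real (Suc n)) \<and> norm Y \<le> inverse (real (Suc n)) \<and>
        mat 1 + t *\<^sub>R (X + Y) \<in> U \<and> (\<forall>i<c. f i (mat 1 + t *\<^sub>R (X + Y)) = 0)"
      using X by (intro allI zero_set_curve [OF U cont der [OF U(2)] lin dual one]) auto
    then obtain t Y where tY: "\<And>n. 0 < t n" "\<And>n. t n < inverse (real (Suc n))"
      "\<And>n. norm (Y n) \<le> inverse (real (Suc n))" "\<And>n. mat 1 + t n *\<^sub>R (X + Y n) \<in> U"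
      "\<And>n i. i < c \<Longrightarrow> f i (mat 1 + t n *\<^sub>R (X + Y n)) = 0"
      by metis
    have "t \<longlonglongrightarrow> 0"
      by (rule tendsto_sandwich [OF _ _ tendsto_const LIMSEQ_inverse_real_of_nat])
         (use tY in \<open>auto intro!: always_eventually less_imp_le\<close>)
    moreover have "Y \<longlonglongrightarrow> 0"
      by (rule Lim_null_comparison [OF _ LIMSEQ_inverse_real_of_nat]) (use tY in auto)
    then have "(\<lambda>n. X + Y n) \<longlonglongrightarrow> X" using tendsto_add [OF tendsto_const] by fastforce
    ultimately show "X \<in> tangent_cone S p"
      using tY zero by (intro tangent_coneI [of t "\<lambda>n. X + Y n"]) auto
  qed
  with lin dual show thesis by (rule that)
qed

subsection \<open>Hermitian adjoints and convergence of matrices\<close>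

definition adj :: "complex^'n^'m \<Rightarrow> complex^'m^'n" where
  "adj A = (\<chi> a b. cnj (A $ b $ a))"

lemma adj_nth [simp]: "adj A $ a $ b = cnj (A $ b $ a)"
  by (simp add: adj_def)

lemma adj_adj [simp]: "adj (adj A) = A"
  by (simp add: vec_eq_iff)

lemma adj_mult: "adj (A ** B) = adj B ** adj A"
  by (simp add: vec_eq_iff matrix_matrix_mult_def mult.commute)

lemma adj_mat_1 [simp]: "adj (mat 1) = mat 1"
  by (simp add: vec_eq_iff mat_def)

lemma adj_add: "adj (A + B) = adj A + adj B"
  and adj_diff: "adj (A - B) = adj A - adj B"
  and adj_scaleR: "adj (r *\<^sub>R A) = r *\<^sub>R adj A"
  by (simp_all add: vec_eq_iff)

lemma mat_entry_eq: "mat k $ i $ j = (if i = j then k else 0)"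
  by (simp add: mat_def)

lemma tendsto_adj: "X \<longlonglongrightarrow> A \<Longrightarrow> (\<lambda>n. adj (X n)) \<longlonglongrightarrow> adj A"
  by (intro vec_tendstoI) (simp add: tendsto_cnj tendsto_vec_nth)

lemma tendsto_matrix_mult:
  fixes X :: "nat \<Rightarrow> complex^'m^'n" and Y :: "nat \<Rightarrow> complex^'k^'m"
  assumes "X \<longlonglongrightarrow> A" "Y \<longlonglongrightarrow> B"
  shows "(\<lambda>n. X n ** Y n) \<longlonglongrightarrow> A ** B"
  by (intro vec_tendstoI) (simp add: matrix_matrix_mult_def,
      intro tendsto_sum tendsto_mult tendsto_vec_nth assms)

lemma bounded_bilinear_matrix_mult:
  "bounded_bilinear ((**) :: complex^'m^'n \<Rightarrow> complex^'k^'m \<Rightarrow> complex^'k^('n::finite))"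
  by (rule bilinear_conv_bounded_bilinear [THEN iffD1])
     (auto simp: bilinear_def matrix_add_ldistrib intro!: linearI;
      simp add: vec_eq_iff matrix_matrix_mult_def sum.distrib algebra_simps scaleR_sum_right)

lemma matrix_mult_null:
  fixes X :: "nat \<Rightarrow> complex^'n^'n" and Y :: "nat \<Rightarrow> complex^'n^'n"
  assumes "Bseq Y" "t \<longlonglongrightarrow> (0::real)" "X \<longlonglongrightarrow> A"
  shows "(\<lambda>n. t n *\<^sub>R (X n ** Y n)) \<longlonglongrightarrow> 0"
proof -
  obtain K where K: "\<And>(A :: complex^'n^'n) (B :: complex^'n^'n). norm (A ** B) \<le> norm A * norm B * K"
    using bounded_bilinear.bounded [OF bounded_bilinear_matrix_mult] by blast
  obtain M where M: "\<And>n. norm (Y n) \<le> M" "M > 0" using \<open>Bseq Y\<close> by (auto simp: Bseq_def)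
  have "norm (t n *\<^sub>R (X n ** Y n)) \<le> \<bar>t n\<bar> * (norm (X n) * M * \<bar>K\<bar>)" for n
  proof -
    have "norm (X n ** Y n) \<le> norm (X n) * norm (Y n) * \<bar>K\<bar>"
      using K [of "X n" "Y n"] mult_left_mono [OF abs_ge_self [of K], of "norm (X n) * norm (Y n)"]
      by simp
    also have "\<dots> \<le> norm (X n) * M * \<bar>K\<bar>"
      using M by (intro mult_right_mono mult_left_mono) auto
    finally show ?thesis by (simp add: mult_left_mono)
  qed
  then have "\<forall>\<^sub>F n in sequentially. norm (t n *\<^sub>R (X n ** Y n)) \<le> \<bar>t n\<bar> * (norm (X n) * M * \<bar>K\<bar>)"
    by simp
  moreover have "(\<lambda>n. \<bar>t n\<bar> * (norm (X n) * M * \<bar>K\<bar>)) \<longlonglongrightarrow> \<bar>0\<bar> * (norm A * M * \<bar>K\<bar>)"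
    by (intro tendsto_mult tendsto_rabs tendsto_norm tendsto_const assms)
  ultimately show ?thesis by (simp only: abs_zero mult_zero_left Lim_null_comparison)
qed

lemma unitary_right: "adj U ** U = mat 1 \<Longrightarrow> U ** adj U = mat 1"
  for U :: "complex^'n^('n::finite)"
  by (rule matrix_left_right_inverse [THEN iffD1])

lemma unitary_column: "adj U ** U = mat 1 \<Longrightarrow> (\<Sum>b\<in>UNIV. (cmod (U $ b $ a))\<^sup>2) = 1"
  for U :: "complex^'n^('n::finite)"
proof -
  assume "adj U ** U = mat 1"
  then have "(adj U ** U) $ a $ a = 1" by (simp add: mat_def)
  then have "(\<Sum>b\<in>UNIV. cnj (U $ b $ a) * U $ b $ a) = 1" by (simp add: matrix_matrix_mult_def)
  also have "(\<Sum>b\<in>UNIV. cnj (U $ b $ a) * U $ b $ a) = complex_of_real (\<Sum>b\<in>UNIV. (cmod (U $ b $ a))\<^sup>2)"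
    by (simp add: complex_norm_square mult.commute del: of_real_power)
  finally show ?thesis by (metis of_real_eq_1_iff)
qed

lemma unitary_entry_le: "adj U ** U = mat 1 \<Longrightarrow> cmod (U $ b $ a) \<le> 1"
  for U :: "complex^'n^('n::finite)"
proof -
  assume "adj U ** U = mat 1"
  then have "(cmod (U $ b $ a))\<^sup>2 \<le> 1"
    using member_le_sum [of b UNIV "\<lambda>b. (cmod (U $ b $ a))\<^sup>2"] unitary_column [of U a] by simp
  then show ?thesis by (simp add: power2_le_iff_abs_le abs_square_le_1)
qed

lemma unitary_norm_le: "adj U ** U = mat 1 \<Longrightarrow> norm U \<le> real CARD('n) * real CARD('n)"
  for U :: "complex^'n^('n::finite)"
proof -
  assume U: "adj U ** U = mat 1"
  have "norm U \<le> (\<Sum>a\<in>UNIV. norm (U $ a))" by (simp add: norm_vec_def L2_set_le_sum)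
  also have "\<dots> \<le> (\<Sum>a\<in>(UNIV::'n set). \<Sum>b\<in>(UNIV::'n set). 1)"
  proof (rule sum_mono)
    fix a
    have "norm (U $ a) \<le> (\<Sum>b\<in>UNIV. norm (U $ a $ b))" by (simp add: norm_vec_def L2_set_le_sum)
    also have "\<dots> \<le> (\<Sum>b\<in>(UNIV::'n set). 1)" by (intro sum_mono unitary_entry_le U)
    finally show "norm (U $ a) \<le> (\<Sum>b\<in>(UNIV::'n set). 1)" .
  qed
  finally show ?thesis by simp
qed

definition herm :: "complex^'n \<Rightarrow> complex^('n::finite) \<Rightarrow> complex" where
  "herm x y = (\<Sum>i\<in>UNIV. cnj (x $ i) * y $ i)"

lemma herm_adj: "herm (A *v x) y = herm x (adj A *v y)"
proof -
  have "herm (A *v x) y = (\<Sum>i\<in>UNIV. \<Sum>k\<in>UNIV. cnj (A $ i $ k) * cnj (x $ k) * y $ i)"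
    by (simp add: herm_def matrix_vector_mult_def sum_distrib_right)
  also have "\<dots> = (\<Sum>k\<in>UNIV. \<Sum>i\<in>UNIV. cnj (A $ i $ k) * cnj (x $ k) * y $ i)"
    by (rule sum.swap)
  also have "\<dots> = herm x (adj A *v y)"
    by (simp add: herm_def matrix_vector_mult_def sum_distrib_left mult_ac)
  finally show ?thesis .
qed

lemma cnj_herm: "cnj (herm x y) = herm y x"
  by (simp add: herm_def mult.commute)

lemma herm_self: "herm x x = complex_of_real ((norm x)\<^sup>2)"
  by (simp add: herm_def norm_vec_def L2_set_def sum_nonneg complex_norm_square mult.commute del: of_real_power)

subsection \<open>Coordinate flags and unitary frames\<close>

text \<open>\<open>ord a\<close> is the step at which the axis \<open>a\<close> enters the flag.
  Recording positions, the inverse of a one-line word, turns membership into vanishing of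
  coordinates.\<close>

definition coord_flag :: "('n \<Rightarrow> nat) \<Rightarrow> ('n::finite) flag" where
  "coord_flag ord = (\<lambda>k. {x. \<forall>a. ord a > k \<longrightarrow> x $ a = 0})"

lemma coord_flag_iff: "x \<in> coord_flag ord k \<longleftrightarrow> (\<forall>a. ord a > k \<longrightarrow> x $ a = 0)"
  by (simp add: coord_flag_def)

lemma dim_coord_subspace:
  "vec.dim {x :: complex^('n::finite). \<forall>a. a \<notin> A \<longrightarrow> x $ a = 0} = card A"
proof (rule vec.dim_unique [of "(\<lambda>a. axis a 1) ` A"])
  show "(\<lambda>a. axis a 1) ` A \<subseteq> {x :: complex^'n. \<forall>a. a \<notin> A \<longrightarrow> x $ a = 0}"
    by (auto simp: axis_def)
  show "{x :: complex^'n. \<forall>a. a \<notin> A \<longrightarrow> x $ a = 0} \<subseteq> vec.span ((\<lambda>a. axis a 1) ` A)"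
  proof clarify
    fix x :: "complex^'n" assume x: "\<forall>a. a \<notin> A \<longrightarrow> x $ a = 0"
    have "x = (\<Sum>i\<in>UNIV. x $ i *s axis i 1)" by (simp add: basis_expansion)
    also have "\<dots> \<in> vec.span ((\<lambda>a. axis a 1) ` A)"
    proof (rule vec.span_sum)
      fix i show "x $ i *s axis i 1 \<in> vec.span ((\<lambda>a. axis a 1) ` A)"
        using x by (cases "i \<in> A") (auto intro: vec.span_scale vec.span_base vec.span_zero)
    qed
    finally show "x \<in> vec.span ((\<lambda>a. axis a 1) ` A)" .
  qed
  show "vec.independent ((\<lambda>a. axis a (1::complex)) ` A :: (complex^'n) set)"
    by (rule vec.independent_mono [OF independent_cart_basis]) (auto simp: cart_basis_def)
  show "card ((\<lambda>a. axis a (1::complex)) ` A :: (complex^'n) set) = card A"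
    by (rule card_image) (auto simp: inj_on_def axis_eq_axis)
qed

lemma card_ord_le:
  assumes "bij_betw ord (UNIV :: 'n::finite set) {1..CARD('n)}" "k \<le> CARD('n)"
  shows "card {a. ord a \<le> k} = k"
proof -
  have "bij_betw ord {a. ord a \<le> k} {1..k}"
  proof (rule bij_betw_imageI)
    show "inj_on ord {a. ord a \<le> k}" using assms(1) by (auto simp: bij_betw_def inj_on_def)
    have "range ord = {1..CARD('n)}" using assms(1) by (simp add: bij_betw_def)
    then have "ord a \<in> {1..CARD('n)}" "x \<in> {1..CARD('n)} \<Longrightarrow> \<exists>a. ord a = x" for a x
      by (blast, metis imageE)
    then show "ord ` {a. ord a \<le> k} = {1..k}" using assms(2) by (fastforce simp: image_iff)
  qed
  then show ?thesis by (auto dest: bij_betw_same_card)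
qed

lemma coord_flag_in_manifold:
  assumes ord: "bij_betw ord (UNIV :: 'n::finite set) {1..CARD('n)}"
  shows "coord_flag ord \<in> (flag_manifold :: 'n flag set)"
proof -
  have "vec.dim (coord_flag ord k) = k" if "k \<le> CARD('n)" for k
    using dim_coord_subspace [of "{a. ord a \<le> k}"] card_ord_le [OF ord that]
    by (simp add: coord_flag_def not_le)
  moreover have "coord_flag ord k = UNIV" if "k \<ge> CARD('n)" for k
  proof -
    have "ord a \<le> CARD('n)" for a using bij_betwE [OF ord] by auto
    then show ?thesis using that by (auto simp: coord_flag_def) (meson leD le_trans)
  qed
  moreover have "vec.subspace (coord_flag ord k)" for k
    by (auto simp: coord_flag_def vec.subspace_def)
  ultimately show ?thesis by (auto simp: flag_manifold_def coord_flag_iff)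
qed

lemma flag_mono: "V \<in> flag_manifold \<Longrightarrow> j \<le> k \<Longrightarrow> V j \<subseteq> V k"
  by (rule lift_Suc_mono_le [of V]) (auto simp: flag_manifold_def)

lemma flag_subspace: "V \<in> flag_manifold \<Longrightarrow> vec.subspace (V k)"
  for V :: "('n::finite) flag"
  by (cases "k \<le> CARD('n)") (auto simp: flag_manifold_def)

lemma flag_dim: "V \<in> flag_manifold \<Longrightarrow> vec.dim (V k) = min k CARD('n)"
  for V :: "('n::finite) flag"
  by (cases "k \<le> CARD('n)") (auto simp: flag_manifold_def min_def vec.dim_UNIV card_cart_basis)

lemma subspace_of_vec_subspace: "vec.subspace W \<Longrightarrow> subspace W"
  for W :: "(complex^'n) set"
proof -
  have "r *\<^sub>R x = complex_of_real r *s x" for r and x :: "complex^'n"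
    by (simp add: vec_eq_iff, simp add: scaleR_conv_of_real)
  then show "vec.subspace W \<Longrightarrow> subspace W"
    by (simp add: vec.subspace_def real_vector.subspace_def)
qed

lemma herm_scale: "herm x (z *s y) = z * herm x y" "herm (z *s x) y = cnj z * herm x y"
  by (simp_all add: herm_def sum_distrib_left mult_ac)

text \<open>The projection used is real-orthogonal. As \<open>W'\<close> is stable under
  multiplication by i, real orthogonality to \<open>W'\<close> already gives Hermitian
  orthogonality.\<close>

lemma unit_orthogonal_vector:
  fixes W W' :: "(complex^'n) set"
  assumes W: "vec.subspace W" and W': "vec.subspace W'" "W' \<subseteq> W" "W' \<noteq> W"
  obtains q where "q \<in> W" "herm q q = 1" "\<And>y. y \<in> W' \<Longrightarrow> herm y q = 0"
proof -
  obtain x where x: "x \<in> W" "x \<notin> W'" using W' by auto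
  have span: "span W' = W'" using subspace_of_vec_subspace [OF W'(1)] by (simp add: span_eq_iff)
  obtain y z where yz: "y \<in> W'" "\<And>w. w \<in> W' \<Longrightarrow> orthogonal z w" "x = y + z"
    using orthogonal_subspace_decomp_exists [of W' x] unfolding span by blast
  have "z = x - y" using yz by simp
  then have z: "z \<in> W" "z \<noteq> 0"
    using vec.subspace_diff [OF W x(1), of y] x(2) yz(1) W'(2) by auto
  have "Re (herm w z) = inner z w" for w
    by (simp add: herm_def inner_vec_def inner_complex_def mult.commute)
  then have re: "Re (herm w z) = 0" if "w \<in> W'" for w
    using yz(2) [OF that] by (simp add: orthogonal_def)
  have orth: "herm w z = 0" if w: "w \<in> W'" for w
    using re [OF w] re [of "\<i> *s w"] vec.subspace_scale [OF W'(1) w]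
    by (simp add: herm_scale complex_eq_iff)
  let ?q = "complex_of_real (inverse (norm z)) *s z"
  show thesis
  proof (rule that [of ?q])
    show "?q \<in> W" using z W by (simp add: vec.subspace_scale)
    have "herm ?q ?q = complex_of_real (inverse (norm z)) * (cnj (complex_of_real (inverse (norm z))) * herm z z)"
      by (simp only: herm_scale)
    also have "\<dots> = 1" unfolding herm_self using z(2) by (simp add: power2_eq_square field_simps)
    finally show "herm ?q ?q = 1" .
  qed (simp add: herm_scale orth)
qed

lemma inj_unitary: "adj Q ** Q = mat 1 \<Longrightarrow> inj ((*v) Q)"
  for Q :: "complex^'n^('n::finite)"
  by (rule inj_on_inverseI [where g = "(*v) (adj Q)"]) (simp add: matrix_vector_mul_assoc)

lemma image_UNIV_of_inj: "inj ((*v) Q) \<Longrightarrow> range ((*v) Q) = UNIV"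
  for Q :: "complex^'n^('n::finite)"
  by (simp add: vec.linear_inj_imp_surj)

lemma dim_image_inj: "inj ((*v) Q) \<Longrightarrow> vec.dim ((*v) Q ` W) = vec.dim W"
  for Q :: "complex^'n^('n::finite)"
  by (rule vec.dim_image_eq) (auto intro: inj_on_subset)

lemma matrix_vector_in_subspace:
  assumes "vec.subspace W" "\<And>a. x $ a \<noteq> 0 \<Longrightarrow> column a Q \<in> W"
  shows "Q *v x \<in> W"
proof -
  have "Q *v x = (\<Sum>a\<in>UNIV. x $ a *s column a Q)"
    by (simp add: matrix_mult_sum)
  also have "\<dots> \<in> W"
  proof (rule vec.subspace_sum [OF assms(1)])
    fix a show "x $ a *s column a Q \<in> W"
      using assms by (cases "x $ a = 0") (auto intro: vec.subspace_scale vec.subspace_0)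
  qed
  finally show ?thesis .
qed

text \<open>Gram-Schmidt along the flag: the column at \<open>a\<close> is a unit vector of
  \<open>V (ord a)\<close> orthogonal to the preceding member.\<close>

lemma unitary_frame:
  fixes V :: "('n::finite) flag"
  assumes V: "V \<in> flag_manifold" and ord: "bij_betw ord (UNIV :: 'n set) {1..CARD('n)}"
  obtains Q where "adj Q ** Q = mat 1" "V = flag_act Q (coord_flag ord)"
proof -
  have "\<exists>q. q \<in> V (ord a) \<and> herm q q = 1 \<and>
      (\<forall>y\<in>V (ord a - 1). herm y q = 0)" for a
  proof -
    have oa: "1 \<le> ord a" "ord a \<le> CARD('n)" using bij_betwE [OF ord] by auto
    have "vec.dim (V (ord a - 1)) \<noteq> vec.dim (V (ord a))"
      using oa by (simp add: flag_dim [OF V])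
    then have "V (ord a - 1) \<noteq> V (ord a)" by metis
    then show ?thesis
      using unit_orthogonal_vector [OF flag_subspace [OF V] flag_subspace [OF V] flag_mono [OF V diff_le_self]]
      by metis
  qed
  then obtain q where q: "\<And>a. q a \<in> V (ord a)" "\<And>a. herm (q a) (q a) = 1"
    "\<And>a y. y \<in> V (ord a - 1) \<Longrightarrow> herm y (q a) = 0"
    by metis
  define Q where "Q = (\<chi> b a. q a $ b)"
  have less: "herm (q a) (q b) = 0" if "ord a < ord b" for a b
  proof (rule q(3))
    show "q a \<in> V (ord b - 1)"
      using q(1) [of a] flag_mono [OF V, of "ord a" "ord b - 1"] that by (simp add: subset_eq)
  qed
  have "herm (q a) (q b) = (if a = b then 1 else 0)" for a b
  proof (cases "a = b")
    case False
    then have "ord a \<noteq> ord b" using ord by (auto simp: bij_betw_def inj_on_def)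
    then consider "ord a < ord b" | "ord b < ord a" by linarith
    then have "herm (q a) (q b) = 0"
    proof cases
      case 2
      then show ?thesis using less [OF 2] cnj_herm [of "q b" "q a"] by simp
    qed (rule less)
    with False show ?thesis by simp
  qed (use q(2) in simp)
  then have unit: "adj Q ** Q = mat 1"
    by (simp add: vec_eq_iff matrix_matrix_mult_def mat_def Q_def herm_def)
  have "flag_act Q (coord_flag ord) k = V k" for k
  proof (rule vec.subspace_dim_equal)
    have C: "vec.subspace (coord_flag ord k)" "vec.dim (coord_flag ord k) = min k CARD('n)"
      using flag_subspace flag_dim coord_flag_in_manifold [OF ord] by blast+
    show "vec.subspace (flag_act Q (coord_flag ord) k)"
      unfolding flag_act_def by (rule vec.linear_subspace_image [OF matrix_vector_mul_linear_gen C(1)])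
    show "vec.subspace (V k)" by (rule flag_subspace [OF V])
    show "flag_act Q (coord_flag ord) k \<subseteq> V k"
      unfolding flag_act_def
    proof clarify
      fix x assume x: "x \<in> coord_flag ord k"
      show "Q *v x \<in> V k"
      proof (rule matrix_vector_in_subspace [OF flag_subspace [OF V]])
        fix a assume "x $ a \<noteq> 0"
        then have "ord a \<le> k" using x by (auto simp: coord_flag_iff not_less [symmetric])
        then have "q a \<in> V k" using q(1) flag_mono [OF V] by blast
        moreover have "column a Q = q a" by (simp add: column_def Q_def vec_eq_iff)
        ultimately show "column a Q \<in> V k" by simp
      qed
    qed
    show "vec.dim (V k) \<le> vec.dim (flag_act Q (coord_flag ord) k)"
      unfolding flag_act_def dim_image_inj [OF inj_unitary [OF unit]] C(2) flag_dim [OF V] by simp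
  qed
  then show thesis using unit that by (metis ext)
qed

lemmas matrix_mult_linear =
  bounded_bilinear.add_left [OF bounded_bilinear_matrix_mult]
  bounded_bilinear.add_right [OF bounded_bilinear_matrix_mult]
  bounded_bilinear.diff_left [OF bounded_bilinear_matrix_mult]
  bounded_bilinear.diff_right [OF bounded_bilinear_matrix_mult]
  bounded_bilinear.minus_left [OF bounded_bilinear_matrix_mult]
  bounded_bilinear.minus_right [OF bounded_bilinear_matrix_mult]
  bounded_bilinear.scaleR_left [OF bounded_bilinear_matrix_mult]
  bounded_bilinear.scaleR_right [OF bounded_bilinear_matrix_mult]

subsection \<open>Quaternionic matrices\<close>

text \<open>\<open>jmap\<close> exchanges the axes \<open>a\<close> and \<open>partner a\<close> up
  to the sign \<open>sgp\<close>; see \<open>jmap_nth\<close>.\<close>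

definition partner :: "'m + 'm \<Rightarrow> 'm + 'm" where
  "partner = case_sum Inr Inl"

definition sgp :: "'m + 'm \<Rightarrow> complex" where
  "sgp = case_sum (\<lambda>_. 1) (\<lambda>_. - 1)"

lemma partner_simps [simp]: "partner (Inl i) = Inr i" "partner (Inr i) = Inl i"
  by (simp_all add: partner_def)

lemma partner_partner [simp]: "partner (partner a) = a"
  by (cases a) auto

lemma partner_neq [simp]: "partner a \<noteq> a" "a \<noteq> partner a"
  by (cases a; auto)+

lemma partner_eq_iff [simp]: "partner a = partner b \<longleftrightarrow> a = b"
  by (metis partner_partner)

lemma bij_partner: "bij partner"
  by (rule o_bij [where g = partner]) (auto simp: fun_eq_iff)

lemma sgp_simps [simp]: "sgp (Inl i) = 1" "sgp (Inr i) = - 1"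
  by (simp_all add: sgp_def)

lemma sgp_partner [simp]: "sgp (partner a) = - sgp a"
  by (cases a) auto

lemma sgp_mult_self [simp]: "sgp a * sgp a = 1" "sgp a * (sgp a * z) = z"
  by (cases a; simp)+

lemma cnj_sgp [simp]: "cnj (sgp a) = sgp a"
  by (cases a) auto

lemma sgp_nonzero [simp]: "sgp a \<noteq> 0"
  by (cases a) auto

lemma sum_partner: "(\<Sum>a\<in>UNIV. f (partner a)) = (\<Sum>a\<in>UNIV. f a)"
  for f :: "'m::finite + 'm \<Rightarrow> complex"
  by (rule sum.reindex_bij_betw) (use bij_partner in simp)

lemma J_mat_nth: "J_mat $ a $ b = (if b = partner a then sgp a else 0)"
  by (cases a; cases b; auto simp: J_mat_def)

lemma jmap_nth: "jmap v $ a = sgp a * cnj (v $ partner a)"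
  by (simp add: jmap_def matrix_vector_mult_def J_mat_nth if_distrib [where f = "\<lambda>x. x * _"] cong: if_cong)

text \<open>Entrywise and without a condition on the determinant, so that it serves the group and
  its Lie algebra alike.\<close>

definition quaternionic :: "complex^('m::finite + 'm)^('m + 'm) \<Rightarrow> bool" where
  "quaternionic X \<longleftrightarrow> (\<forall>a b. X $ partner a $ partner b = sgp a * sgp b * cnj (X $ a $ b))"

lemma quaternionic_iff: "quaternionic X \<longleftrightarrow> (\<forall>v. jmap (X *v v) = X *v jmap v)"
proof
  assume X: "quaternionic X"
  have X': "X $ a $ partner b = - sgp a * sgp b * cnj (X $ partner a $ b)" for a b
    using X [unfolded quaternionic_def, rule_format, of "partner a" b] by simp
  show "\<forall>v. jmap (X *v v) = X *v jmap v"
  proof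
    fix v
    have "(X *v jmap v) $ a = jmap (X *v v) $ a" for a
    proof -
      have "(X *v jmap v) $ a = (\<Sum>b\<in>UNIV. X $ a $ b * (sgp b * cnj (v $ partner b)))"
        by (simp add: matrix_vector_mult_def jmap_nth)
      also have "\<dots> = (\<Sum>b\<in>UNIV. X $ a $ partner b * (sgp (partner b) * cnj (v $ b)))"
        by (subst sum_partner [symmetric]) simp
      also have "\<dots> = (\<Sum>b\<in>UNIV. sgp a * cnj (X $ partner a $ b * v $ b))"
        unfolding X' by (simp add: mult_ac)
      also have "\<dots> = jmap (X *v v) $ a"
        by (simp add: jmap_nth matrix_vector_mult_def sum_distrib_left)
      finally show ?thesis .
    qed
    then show "jmap (X *v v) = X *v jmap v" by (simp add: vec_eq_iff)
  qed
next
  assume *: "\<forall>v. jmap (X *v v) = X *v jmap v"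
  show "quaternionic X" unfolding quaternionic_def
  proof (intro allI)
    fix a b
    have 1: "jmap (X *v axis b 1) $ partner a = - sgp a * cnj (X $ a $ b)"
      by (simp add: jmap_nth matrix_vector_mul_component axis_def matrix_vector_mult_def
          if_distrib [where f = "\<lambda>x. _ * x"] cong: if_cong)
    have "(X *v jmap (axis b 1)) $ partner a = (\<Sum>c\<in>UNIV. X $ partner a $ c * (if c = partner b then sgp c else 0))"
      unfolding matrix_vector_mult_def
      by (auto simp: jmap_nth axis_def intro!: sum.cong)
    also have "\<dots> = - X $ partner a $ partner b * sgp b"
      by (simp add: if_distrib [where f = "\<lambda>x. _ * x"] cong: if_cong)
    finally have "X $ partner a $ partner b * sgp b = sgp a * cnj (X $ a $ b)"
      using * 1 by (metis (no_types, lifting) minus_mult_left neg_equal_iff_equal)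
    then show "X $ partner a $ partner b = sgp a * sgp b * cnj (X $ a $ b)"
      by (metis mult.assoc mult.commute sgp_mult_self(2))
  qed
qed

lemma quaternionic_mult: "quaternionic X \<Longrightarrow> quaternionic Y \<Longrightarrow> quaternionic (X ** Y)"
  by (simp add: quaternionic_iff matrix_vector_mul_assoc [symmetric])

lemma quaternionic_mat_1: "quaternionic (mat 1)"
  by (simp add: quaternionic_iff)

lemma quaternionic_inverse:
  assumes "quaternionic M" "M ** N = mat 1" "N ** M = mat 1"
  shows "quaternionic N"
proof -
  have "jmap (N *v v) = N *v jmap v" for v
  proof -
    have "M *v jmap (N *v v) = jmap v"
      using assms by (metis quaternionic_iff matrix_vector_mul_assoc matrix_vector_mul_lid)
    then show ?thesis using assms by (metis matrix_vector_mul_assoc matrix_vector_mul_lid)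
  qed
  then show ?thesis by (simp add: quaternionic_iff)
qed

lemma K\<^sub>0_iff: "X \<in> K\<^sub>0 \<longleftrightarrow> det X = 1 \<and> adj X ** X = mat 1 \<and> quaternionic X"
  by (auto simp: K\<^sub>0_def SU_def SL_H_def SL_C_def quaternionic_iff adj_def)

lemma K\<^sub>0_mult: "X \<in> K\<^sub>0 \<Longrightarrow> Y \<in> K\<^sub>0 \<Longrightarrow> X ** Y \<in> K\<^sub>0"
  by (auto simp: K\<^sub>0_iff det_mul quaternionic_mult adj_mult)
     (metis matrix_mul_assoc matrix_mul_lid)

lemma K\<^sub>0_unitary: "X \<in> K\<^sub>0 \<Longrightarrow> adj X ** X = mat 1"
  by (simp add: K\<^sub>0_iff)

lemma K\<^sub>0_adj: "X \<in> K\<^sub>0 \<Longrightarrow> adj X \<in> K\<^sub>0"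
proof -
  assume X: "X \<in> K\<^sub>0"
  then have "det (adj X) * det X = 1" using det_mul [of "adj X" X] by (simp add: K\<^sub>0_iff)
  then show ?thesis using X quaternionic_inverse [of X "adj X"] unitary_right [of X]
    by (simp add: K\<^sub>0_iff)
qed

lemma K\<^sub>0_mat_1: "mat 1 \<in> K\<^sub>0"
  by (simp add: K\<^sub>0_iff quaternionic_mat_1)

section \<open>The complex symplectic form attached to j\<close>

definition om :: "complex^('m::finite + 'm) \<Rightarrow> complex^('m + 'm) \<Rightarrow> complex" where
  "om x y = (\<Sum>a\<in>UNIV. sgp a * x $ a * y $ partner a)"

lemma om_herm: "om x y = - herm (jmap x) y"
proof -
  have "herm (jmap x) y = (\<Sum>a\<in>UNIV. sgp a * x $ partner a * y $ a)"
    by (simp add: herm_def jmap_nth)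
  also have "\<dots> = (\<Sum>a\<in>UNIV. sgp (partner a) * x $ a * y $ partner a)"
    by (subst sum_partner [symmetric]) simp
  finally show ?thesis by (simp add: om_def sum_negf)
qed

text \<open>By \<open>om_herm\<close> the form is assembled from \<open>herm\<close> and
  \<open>jmap\<close>, and \<open>K\<^sub>0\<close> respects both.\<close>

lemma om_K\<^sub>0: "g \<in> K\<^sub>0 \<Longrightarrow> om (g *v x) (g *v y) = om x y"
  by (simp add: om_herm K\<^sub>0_iff quaternionic_iff herm_adj matrix_vector_mul_assoc)

subsection \<open>The Lie algebra of the compact group\<close>

text \<open>The Lie algebra sp(m). Trace zero is automatic: diagonal entries are imaginary, and
  those at \<open>a\<close> and \<open>partner a\<close> are conjugate.\<close>

definition lie_K :: "(complex^('m::finite + 'm)^('m + 'm)) set" where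
  "lie_K = {A. adj A = - A \<and> quaternionic A}"

text \<open>A skew-Hermitian matrix has no nonzero real eigenvalue: if \<open>r *\<^sub>R A\<close>
  fixes \<open>x\<close>, then \<open>herm x x\<close> equals minus its conjugate.\<close>

lemma invertible_cayley:
  fixes A :: "complex^'n^('n::finite)"
  assumes "adj A = - A"
  shows "invertible (mat 1 - r *\<^sub>R A)"
proof -
  have "x = 0" if "(mat 1 - r *\<^sub>R A) *v x = 0" for x
  proof -
    have "(r *\<^sub>R A) *v x = x" using that by (simp add: matrix_vector_mult_diff_rdistrib)
    then have 1: "herm x x = herm x ((r *\<^sub>R A) *v x)" by simp
    also have "\<dots> = - herm ((r *\<^sub>R A) *v x) x"
      unfolding herm_adj by (simp add: adj_scaleR assms matrix_vector_mult_def herm_def sum_negf)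
    finally have "herm x x = - cnj (herm x x)" using 1 cnj_herm by metis
    then show "x = 0" by (simp add: herm_self)
  qed
  then have "inj ((*v) (mat 1 - r *\<^sub>R A))"
    by (metis (no_types, lifting) injI matrix_vector_mult_diff_distrib right_minus_eq)
  then show ?thesis
    by (simp add: invertible_left_inverse matrix_left_invertible_injective)
qed

lemma det_J_mat_nonzero: "det (J_mat :: complex^('m::finite + 'm)^('m + 'm)) \<noteq> 0"
proof -
  have "J_mat ** (- J_mat) = (mat 1 :: complex^('m + 'm)^('m + 'm))"
    by (auto simp: vec_eq_iff matrix_matrix_mult_def J_mat_nth mat_def
        if_distrib [where f = "\<lambda>x. x * _"] if_distrib [where f = "\<lambda>x. - x"] cong: if_cong)
  then show ?thesis by (metis det_I det_mul mult_zero_left zero_neq_one)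
qed

text \<open>Elements of \<open>lie_K\<close> are complex symplectic,
  \<open>A ** J_mat = - (J_mat ** transpose A)\<close>, so \<open>J_mat\<close> intertwines
  \<open>mat 1 + r *\<^sub>R A\<close> with the transpose of
  \<open>mat 1 - r *\<^sub>R A\<close>.\<close>

lemma det_cayley:
  fixes A :: "complex^('m::finite + 'm)^('m + 'm)"
  assumes A: "A \<in> lie_K"
  shows "det (mat 1 + r *\<^sub>R A) = det (mat 1 - r *\<^sub>R A)"
proof -
  have "(A ** J_mat) $ a $ b = - (J_mat ** transpose A) $ a $ b" for a b
  proof -
    have q: "A $ partner c $ partner d = sgp c * sgp d * cnj (A $ c $ d)" for c d
      using A by (simp add: lie_K_def quaternionic_def)
    have "adj A $ partner a $ b = - A $ partner a $ b" using A by (simp add: lie_K_def)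
    then have sk: "cnj (A $ b $ partner a) = - A $ partner a $ b" by simp
    have "(A ** J_mat) $ a $ b = - A $ a $ partner b * sgp b"
    proof -
      have "J_mat $ c $ b = (if c = partner b then sgp c else 0)" for c
        by (auto simp: J_mat_nth)
      then show ?thesis
        by (simp add: matrix_matrix_mult_def if_distrib [where f = "\<lambda>x. _ * x"] cong: if_cong)
    qed
    also have "\<dots> = sgp a * cnj (A $ partner a $ b)"
      using q [of "partner a" b] by (simp add: mult_ac)
    also have "\<dots> = - sgp a * A $ b $ partner a"
    proof -
      have "A $ b $ partner a = - cnj (A $ partner a $ b)" using arg_cong [OF sk, of cnj] by simp
      then show ?thesis by simp
    qed
    also have "\<dots> = - (J_mat ** transpose A) $ a $ b"
      by (simp add: matrix_matrix_mult_def J_mat_nth transpose_def if_distrib [where f = "\<lambda>x. x * _"] cong: if_cong)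
    finally show ?thesis .
  qed
  then have AJ: "A ** J_mat = - (J_mat ** transpose A)" by (simp add: vec_eq_iff)
  have "(mat 1 + r *\<^sub>R A) ** J_mat = J_mat + r *\<^sub>R (A ** J_mat)"
    by (simp add: matrix_mult_linear)
  also have "\<dots> = J_mat ** transpose (mat 1 - r *\<^sub>R A)"
  proof -
    have "transpose (mat 1 - r *\<^sub>R A) = mat 1 - r *\<^sub>R transpose A"
      by (simp add: vec_eq_iff transpose_def mat_def)
    then show ?thesis unfolding AJ by (simp add: matrix_mult_linear)
  qed
  finally have "(mat 1 + r *\<^sub>R A) ** J_mat = J_mat ** transpose (mat 1 - r *\<^sub>R A)" .
  from arg_cong [OF this, of det]
  have "det (mat 1 + r *\<^sub>R A) * det J = det J * det (mat 1 - r *\<^sub>R A)"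
    if "J = J_mat" for J :: "complex^('m + 'm)^('m + 'm)"
    unfolding that by (simp only: det_mul det_transpose)
  then show ?thesis using det_J_mat_nonzero by auto
qed

text \<open>The Cayley transform takes the place of the exponential; \<open>N\<close> is the inverse
  of \<open>mat 1 - (r / 2) *\<^sub>R A\<close>. The three formulas serve the limit of
  \<open>r\<close> to 0: the first bounds \<open>N\<close>, the last then shows that
  \<open>N\<close> tends to 1, and the middle one has the shape required by
  \<open>tangent_cone\<close>.\<close>

lemma cayley:
  assumes A: "A \<in> lie_K"
  obtains g N where "g \<in> K\<^sub>0" "N = (1/2) *\<^sub>R (mat 1 + g)" "g = mat 1 + r *\<^sub>R (N ** A)"
    "N = mat 1 + (r / 2) *\<^sub>R (N ** A)"
proof -
  define M where "M = mat 1 - (r / 2) *\<^sub>R A"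
  define P where "P = mat 1 + (r / 2) *\<^sub>R A"
  have sk: "adj A = - A" using A by (simp add: lie_K_def)
  obtain N where N: "M ** N = mat 1" "N ** M = mat 1"
    using invertible_cayley [OF sk] unfolding invertible_def M_def by blast
  have adjM: "adj M = P" "adj P = M" by (simp_all add: M_def P_def adj_add adj_diff adj_scaleR sk)
  have MP: "M ** P = P ** M"
  proof -
    define B where "B = (r / 2) *\<^sub>R A"
    show ?thesis unfolding M_def P_def B_def [symmetric] by (simp add: matrix_mult_linear)
  qed
  have L: "adj N ** P = mat 1" "P ** adj N = mat 1"
    using N adjM by (metis adj_mult adj_mat_1)+
  have NP: "N ** P = P ** N"
    by (metis MP N matrix_mul_assoc matrix_mul_lid matrix_mul_rid)
  define g where "g = N ** P"
  have "adj g = M ** adj N" by (simp add: g_def adj_mult adjM)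
  then have "adj g ** g = (M ** adj N) ** (P ** N)" unfolding g_def NP by simp
  also have "\<dots> = mat 1" using L N by (metis matrix_mul_assoc matrix_mul_rid)
  finally have unit: "adj g ** g = mat 1" .
  have "quaternionic A" using A by (simp add: lie_K_def)
  then have quat: "quaternionic (mat 1 + s *\<^sub>R A)" for s
    by (simp add: quaternionic_def mat_def algebra_simps)
  from quat [of "- (r / 2)"] have "quaternionic M" by (simp add: M_def)
  then have "quaternionic g" using quat [of "r / 2"] quaternionic_inverse [OF _ N] quaternionic_mult
    by (simp add: g_def P_def)
  have "det N * det M = 1" using det_mul [of N M] N by simp
  then have "det g = 1"
    using det_cayley [OF A, of "r / 2"] by (simp add: g_def det_mul M_def P_def)
  with \<open>quaternionic g\<close> have "g \<in> K\<^sub>0" using unit by (simp add: K\<^sub>0_iff)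
  have dist: "N ** (X + Y) = N ** X + N ** Y" for X Y by (rule matrix_add_ldistrib)
  have smul: "N ** (s *\<^sub>R X) = s *\<^sub>R (N ** X)" for s X
    by (simp add: vec_eq_iff matrix_matrix_mult_def scaleR_sum_right)
  have NA: "N ** M = N - (r / 2) *\<^sub>R (N ** A)" "N ** P = N + (r / 2) *\<^sub>R (N ** A)"
    using dist [of "mat 1" "- ((r / 2) *\<^sub>R A)"] dist [of "mat 1" "(r / 2) *\<^sub>R A"] smul [of "- (r/2)" A]
    by (simp_all add: M_def P_def smul)
  have 4: "N = mat 1 + (r / 2) *\<^sub>R (N ** A)" using NA(1) N by (simp add: algebra_simps)
  have 2: "mat 1 + g = 2 *\<^sub>R N"
    using NA N by (simp add: g_def scaleR_2)
  have 3: "g = mat 1 + r *\<^sub>R (N ** A)"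
  proof -
    define B where "B = (r / 2) *\<^sub>R (N ** A)"
    have "g = N + B" "N = mat 1 + B" using NA 4 by (simp_all add: g_def B_def)
    moreover have "B + B = r *\<^sub>R (N ** A)" by (simp add: B_def flip: scaleR_left_distrib)
    ultimately show ?thesis by (metis add.assoc)
  qed
  show thesis using that [OF \<open>g \<in> K\<^sub>0\<close> _ 3 4] 2 by simp
qed

lemma lie_K_tangent:
  assumes C: "C = flag_orbit K\<^sub>0 V" and p: "p \<in> C" and A: "A \<in> lie_K"
  shows "A \<in> tangent_cone C p"
proof -
  have "\<forall>n. \<exists>g N. g \<in> K\<^sub>0 \<and> N = (1/2) *\<^sub>R (mat 1 + g) \<and> g = mat 1 + inverse (real (Suc n)) *\<^sub>R (N ** A) \<and>
     N = mat 1 + (inverse (real (Suc n)) / 2) *\<^sub>R (N ** A)"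
    using cayley [OF A] by metis
  then obtain g N where g: "\<And>n. g n \<in> K\<^sub>0" "\<And>n. N n = (1/2) *\<^sub>R (mat 1 + g n)"
    "\<And>n. g n = mat 1 + inverse (real (Suc n)) *\<^sub>R (N n ** A)"
    "\<And>n. N n = mat 1 + (inverse (real (Suc n)) / 2) *\<^sub>R (N n ** A)"
    unfolding choice_iff by blast
  \<comment> \<open>\<open>N n\<close> is the average of two unitary matrices, hence bounded before
    anything is known about its limit.\<close>
  have "norm (N n) \<le> norm (mat 1 :: complex^('a + 'a)^('a + 'a)) + real CARD('a + 'a) * real CARD('a + 'a)" for n
  proof -
    have "norm (N n) = norm (mat 1 + g n) / 2" using arg_cong [OF g(2) [of n], of norm] by simp
    also have "\<dots> \<le> norm (mat 1 + g n)" by simp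
    also have "\<dots> \<le> norm (mat 1 :: complex^('a + 'a)^('a + 'a)) + norm (g n)" by (rule norm_triangle_ineq)
    finally show ?thesis using unitary_norm_le [OF K\<^sub>0_unitary [OF g(1) [of n]]] by simp
  qed
  then have "Bseq N" by (rule BseqI')
  have "Bseq (\<lambda>n. N n ** A)"
  proof -
    obtain K where K: "norm (X ** A) \<le> norm X * K" "0 < K" for X :: "complex^('a + 'a)^('a + 'a)"
      using bounded_linear.pos_bounded [OF bounded_bilinear.bounded_linear_left [OF bounded_bilinear_matrix_mult, of A]]
      by blast
    obtain B where B: "norm (N n) \<le> B" for n using \<open>Bseq N\<close> by (auto simp: Bseq_def)
    have "norm (N n ** A) \<le> B * K" for n
      using K(1) [of "N n"] mult_right_mono [OF B [of n], of K] K(2) by linarith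
    then show ?thesis by (rule BseqI')
  qed
  then have "(\<lambda>n. (inverse (real (Suc n)) / 2) *\<^sub>R (mat 1 ** (N n ** A))) \<longlonglongrightarrow> 0"
    by (rule matrix_mult_null [OF _ tendsto_divide_zero [OF LIMSEQ_inverse_real_of_nat] tendsto_const])
  then have "(\<lambda>n. mat 1 + (inverse (real (Suc n)) / 2) *\<^sub>R (N n ** A)) \<longlonglongrightarrow> mat 1 + 0"
    by (intro tendsto_add tendsto_const) simp
  moreover have "(\<lambda>n. mat 1 + (inverse (real (Suc n)) / 2) *\<^sub>R (N n ** A)) = N"
    by (rule ext) (rule g(4) [symmetric])
  ultimately have "N \<longlonglongrightarrow> mat 1" by simp
  then have "(\<lambda>n. N n ** A) \<longlonglongrightarrow> mat 1 ** A" by (intro tendsto_matrix_mult tendsto_const)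
  then have "(\<lambda>n. N n ** A) \<longlonglongrightarrow> A" by simp
  moreover have "flag_act (mat 1 + inverse (real (Suc n)) *\<^sub>R (N n ** A)) p \<in> C" for n
  proof -
    obtain h where "h \<in> K\<^sub>0" "p = flag_act h V" using p C by (auto simp: flag_orbit_def)
    then have "flag_act (g n) p = flag_act (g n ** h) V" "g n ** h \<in> K\<^sub>0"
      using K\<^sub>0_mult g(1) by (auto simp: flag_act_mult)
    then have "flag_act (g n) p \<in> C" by (auto simp: C flag_orbit_def)
    then show ?thesis using g(3) [of n] by metis
  qed
  ultimately show ?thesis
    by (intro tangent_coneI [OF _ LIMSEQ_inverse_real_of_nat]) auto
qed

subsection \<open>Unitary frames of nearby flags\<close>

text \<open>Column \<open>a\<close> of \<open>g\<close> lies in the image under \<open>A\<close> of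
  the member numbered \<open>ord a\<close>; a preimage there is column \<open>a\<close> of the
  triangular factor.\<close>

lemma flag_eq_factor:
  fixes A g :: "complex^'n^('n::finite)"
  assumes "flag_act A (coord_flag ord) = flag_act g (coord_flag ord)"
  obtains s where "\<And>a b. ord a < ord b \<Longrightarrow> s $ b $ a = 0" "g = A ** s"
proof -
  have "\<exists>x\<in>coord_flag ord (ord a). g *v axis a 1 = A *v x" for a
  proof -
    have "axis a 1 \<in> coord_flag ord (ord a)" by (auto simp: coord_flag_iff axis_def)
    then have "g *v axis a 1 \<in> flag_act g (coord_flag ord) (ord a)" by (simp add: flag_act_def)
    then show ?thesis using fun_cong [OF assms, of "ord a"] by (auto simp: flag_act_def)
  qed
  then obtain x where x: "\<And>a. x a \<in> coord_flag ord (ord a)" "\<And>a. g *v axis a 1 = A *v x a"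
    by metis
  define s where "s = (\<chi> b a. x a $ b)"
  have "g $ i $ a = (A ** s) $ i $ a" for i a
  proof -
    have "g $ i $ a = (g *v axis a 1) $ i"
      by (simp add: matrix_vector_mult_def axis_def if_distrib [where f = "\<lambda>x. _ * x"] cong: if_cong)
    also have "\<dots> = (A ** s) $ i $ a"
      unfolding x(2) by (simp add: matrix_vector_mult_def matrix_matrix_mult_def s_def)
    finally show ?thesis .
  qed
  then show thesis
    using x(1) that [of s] by (simp add: s_def coord_flag_iff vec_eq_iff)
qed

text \<open>A first-order QR decomposition: with \<open>L\<close> the part of \<open>X\<close> below
  the diagonal in the order \<open>ord\<close>, the off-diagonal part of \<open>g\<close> is
  asymptotically \<open>t\<close> times \<open>(L - adj L) ** G\<close>. Unitary frames of a flag
  are unique only up to diagonal phases, hence the subsequence and the diagonal limit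
  \<open>G\<close>.\<close>

lemma unitary_frame_asymptotics:
  fixes g :: "nat \<Rightarrow> complex^'n^('n::finite)"
  assumes inj: "inj ord" and t: "\<And>n. t n > 0" "t \<longlonglongrightarrow> (0::real)" and Z: "Z \<longlonglongrightarrow> X"
    and unit: "\<And>n. adj (g n) ** g n = mat 1"
    and eq: "\<And>n. flag_act (mat 1 + t n *\<^sub>R Z n) (coord_flag ord) = flag_act (g n) (coord_flag ord)"
  obtains r G where "strict_mono r" "(\<lambda>n. g (r n)) \<longlonglongrightarrow> G" "\<And>a b. a \<noteq> b \<Longrightarrow> G $ b $ a = 0"
    "\<And>a. cmod (G $ a $ a) = 1"
    "\<And>a b. ord a < ord b \<Longrightarrow> (\<lambda>n. g (r n) $ b $ a / complex_of_real (t (r n))) \<longlonglongrightarrow> X $ b $ a * G $ a $ a"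
    "\<And>a b. ord b < ord a \<Longrightarrow> (\<lambda>n. g (r n) $ b $ a / complex_of_real (t (r n))) \<longlonglongrightarrow> - cnj (X $ a $ b) * G $ a $ a"
proof -
  define A where "A n = mat 1 + t n *\<^sub>R Z n" for n
  have eqA: "flag_act (A n) (coord_flag ord) = flag_act (g n) (coord_flag ord)" for n
    using eq by (simp add: A_def)
  have "\<forall>n. \<exists>s. (\<forall>a b. ord a < ord b \<longrightarrow> s $ b $ a = 0) \<and> g n = A n ** s"
    using flag_eq_factor [OF eqA] by metis
  then obtain s where s: "\<And>n a b. ord a < ord b \<Longrightarrow> s n $ b $ a = 0" "\<And>n. g n = A n ** s n"
    unfolding choice_iff by blast
  \<comment> \<open>Factoring the other way, \<open>A n = g n ** r\<close>, exhibits
    \<open>adj (A n) ** g n\<close> as the adjoint of a triangular matrix.\<close>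
  have lower: "(adj (A n) ** g n) $ b $ a = 0" if "ord b < ord a" for n a b
  proof -
    obtain r where r: "\<And>a b. ord a < ord b \<Longrightarrow> r $ b $ a = 0" "A n = g n ** r"
      using flag_eq_factor [OF eqA [symmetric]] by metis
    have "adj (g n) ** A n = r"
      unfolding r(2) matrix_mul_assoc unit by simp
    then have "adj (A n) ** g n = adj r" by (metis adj_adj adj_mult)
    then show ?thesis using r(1) [OF that] by simp
  qed
  obtain K where K: "\<And>(A :: complex^'n^'n) (B :: complex^'n^'n). norm (A ** B) \<le> norm A * norm B * K"
    "0 \<le> K"
    using bounded_bilinear.nonneg_bounded [OF bounded_bilinear_matrix_mult] by blast
  have gs: "g n = s n + t n *\<^sub>R (Z n ** s n)" for n
    by (simp add: s(2) A_def matrix_mult_linear)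
  let ?B = "real CARD('n) * real CARD('n)"
  \<comment> \<open>For small \<open>t n\<close> the matrix \<open>s n\<close> differs from the
    unitary \<open>g n\<close> by at most half its own norm.\<close>
  have "Bseq s"
  proof -
    have "(\<lambda>n. t n * (norm (Z n) * K)) \<longlonglongrightarrow> 0 * (norm X * K)"
      by (intro tendsto_mult tendsto_norm tendsto_const t Z)
    then have "\<forall>\<^sub>F n in sequentially. t n * (norm (Z n) * K) < 1 / 2"
      by (rule order_tendstoD) simp
    then have "\<forall>\<^sub>F n in sequentially. norm (s n) \<le> 2 * ?B"
    proof eventually_elim
      case (elim n)
      have "norm (s n) = norm (g n - t n *\<^sub>R (Z n ** s n))" using gs [of n] by simp
      also have "\<dots> \<le> norm (g n) + norm (t n *\<^sub>R (Z n ** s n))" by (rule norm_triangle_ineq4)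
      also have "norm (t n *\<^sub>R (Z n ** s n)) \<le> t n * (norm (Z n) * norm (s n) * K)"
        using mult_left_mono [OF K(1) [of "Z n" "s n"], of "t n"] t(1) [of n] by simp
      also have "\<dots> = (t n * (norm (Z n) * K)) * norm (s n)" by simp
      also have "\<dots> \<le> 1 / 2 * norm (s n)" using elim by (intro mult_right_mono) auto
      finally show ?case using unitary_norm_le [OF unit [of n]] by linarith
    qed
    then show ?thesis by (rule BfunI)
  qed
  have "bounded (range g)"
    unfolding bounded_iff using unitary_norm_le [OF unit] by blast
  then obtain r G where r: "strict_mono (r :: nat \<Rightarrow> nat)" and G: "(g \<circ> r) \<longlonglongrightarrow> G"
    using bounded_imp_convergent_subsequence by blast
  have G': "(\<lambda>n. g (r n)) \<longlonglongrightarrow> G" using G by (simp add: o_def)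
  have tr: "(\<lambda>n. t (r n)) \<longlonglongrightarrow> 0" and Zr: "(\<lambda>n. Z (r n)) \<longlonglongrightarrow> X"
    using LIMSEQ_subseq_LIMSEQ [OF t(2) r] LIMSEQ_subseq_LIMSEQ [OF Z r] by (simp_all add: o_def)
  have Ar: "(\<lambda>n. A (r n)) \<longlonglongrightarrow> mat 1"
    using tendsto_add [OF tendsto_const tendsto_scaleR [OF tr Zr]] by (simp add: A_def)
  have "Bseq (\<lambda>n. s (r n))" using \<open>Bseq s\<close> by (auto simp: Bseq_def)
  then have "(\<lambda>n. t (r n) *\<^sub>R (Z (r n) ** s (r n))) \<longlonglongrightarrow> 0" by (rule matrix_mult_null [OF _ tr Zr])
  then have "(\<lambda>n. g (r n) - t (r n) *\<^sub>R (Z (r n) ** s (r n))) \<longlonglongrightarrow> G - 0"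
    by (intro tendsto_diff G')
  then have sr: "(\<lambda>n. s (r n)) \<longlonglongrightarrow> G" by (simp add: gs)
  \<comment> \<open>\<open>G\<close> is a limit of the triangular \<open>s\<close> and also of
    matrices triangular the other way.\<close>
  have G0: "G $ b $ a = 0" if "a \<noteq> b" for a b
  proof (cases "ord a < ord b")
    case True
    have "(\<lambda>n. s (r n) $ b $ a) \<longlonglongrightarrow> G $ b $ a" by (intro tendsto_vec_nth sr)
    then show ?thesis using s(1) [OF True] by (simp add: LIMSEQ_const_iff)
  next
    case False
    then have ba: "ord b < ord a" using inj that by (metis injD linorder_neqE_nat)
    have "(\<lambda>n. (adj (A (r n)) ** g (r n)) $ b $ a) \<longlonglongrightarrow> (adj (mat 1) ** G) $ b $ a"
      by (intro tendsto_vec_nth tendsto_matrix_mult tendsto_adj Ar G')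
    then show ?thesis using lower [OF ba] by (simp add: LIMSEQ_const_iff)
  qed
  have "(\<lambda>n. adj (g (r n)) ** g (r n)) \<longlonglongrightarrow> adj G ** G"
    by (intro tendsto_matrix_mult tendsto_adj G')
  then have GG: "adj G ** G = mat 1" by (simp add: unit LIMSEQ_const_iff)
  have G1: "cmod (G $ a $ a) = 1" for a
  proof -
    have "1 = (\<Sum>b\<in>UNIV. (cmod (G $ b $ a))\<^sup>2)" by (rule unitary_column [OF GG, symmetric])
    also have "\<dots> = (\<Sum>b\<in>UNIV. if b = a then (cmod (G $ a $ a))\<^sup>2 else 0)"
      by (intro sum.cong) (use G0 in auto)
    also have "\<dots> = (cmod (G $ a $ a))\<^sup>2" by simp
    finally show ?thesis by (metis abs_norm_cancel abs_square_eq_1)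
  qed
  have XG: "(X ** G) $ b $ a = X $ b $ a * G $ a $ a" for X :: "complex^'n^'n" and a b
  proof -
    have "(X ** G) $ b $ a = (\<Sum>c\<in>UNIV. if c = a then X $ b $ a * G $ a $ a else 0)"
      by (simp only: matrix_matrix_mult_def vec_lambda_beta, rule sum.cong) (use G0 in auto)
    then show ?thesis by simp
  qed
  have up: "(\<lambda>n. g (r n) $ b $ a / complex_of_real (t (r n))) \<longlonglongrightarrow> X $ b $ a * G $ a $ a"
    if ab: "ord a < ord b" for a b
  proof -
    have "g n $ b $ a / complex_of_real (t n) = (Z n ** s n) $ b $ a" for n
    proof -
      have "g n $ b $ a = t n *\<^sub>R (Z n ** s n) $ b $ a"
        using arg_cong [OF gs [of n], of "\<lambda>M. M $ b $ a"] s(1) [OF ab, of n] by simp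
      then have "g n $ b $ a = complex_of_real (t n) * (Z n ** s n) $ b $ a"
        by (simp only: scaleR_conv_of_real)
      then show ?thesis using t(1) [of n] by simp
    qed
    moreover have "(\<lambda>n. (Z (r n) ** s (r n)) $ b $ a) \<longlonglongrightarrow> (X ** G) $ b $ a"
      by (intro tendsto_vec_nth tendsto_matrix_mult Zr sr)
    ultimately show ?thesis by (simp add: XG)
  qed
  have down: "(\<lambda>n. g (r n) $ b $ a / complex_of_real (t (r n))) \<longlonglongrightarrow> - cnj (X $ a $ b) * G $ a $ a"
    if ba: "ord b < ord a" for a b
  proof -
    have "g n $ b $ a / complex_of_real (t n) = - (adj (Z n) ** g n) $ b $ a" for n
    proof -
      have "adj (A n) ** g n = g n + t n *\<^sub>R (adj (Z n) ** g n)"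
        by (simp add: A_def adj_add adj_scaleR matrix_mult_linear)
      from arg_cong [OF this, of "\<lambda>M. M $ b $ a"] lower [OF ba, of n]
      have "g n $ b $ a + t n *\<^sub>R (adj (Z n) ** g n) $ b $ a = 0" by simp
      then have "g n $ b $ a = - complex_of_real (t n) * (adj (Z n) ** g n) $ b $ a"
        by (simp only: scaleR_conv_of_real eq_neg_iff_add_eq_0 mult_minus_left)
      then show ?thesis using t(1) [of n] by simp
    qed
    moreover have "(\<lambda>n. - (adj (Z (r n)) ** g (r n)) $ b $ a) \<longlonglongrightarrow> - (adj X ** G) $ b $ a"
      by (intro tendsto_minus tendsto_vec_nth tendsto_matrix_mult tendsto_adj Zr G')
    ultimately show ?thesis by (simp add: XG)
  qed
  show thesis by (rule that [OF r G' G0 G1 up down])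
qed

text \<open>The gradient of the height function \<open>g \<mapsto> - \<Sum>a. ord a * (g\<^sup>*Hg)\<^sub>a\<^sub>a\<close> along the tangent direction \<open>H\<close> is
  \<open>\<Sum>a c. \<bar>ord a - ord c\<bar> \<bar>H\<^sub>c\<^sub>a\<bar>\<^sup>2\<close>, so \<open>H\<close> is diagonal at a maximum.\<close>

definition height :: "('n \<Rightarrow> nat) \<Rightarrow> complex^'n^('n::finite) \<Rightarrow> complex^'n^'n \<Rightarrow> real" where
  "height ord H g = - (\<Sum>a\<in>UNIV. real (ord a) * Re ((adj g ** H ** g) $ a $ a))"

lemma diagonal_of_maximal_height:
  fixes g :: "nat \<Rightarrow> complex^'n^('n::finite)"
  assumes inj: "inj ord" and t: "\<And>n. t n > 0" "t \<longlonglongrightarrow> (0::real)" and Z: "Z \<longlonglongrightarrow> H"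
    and unit: "\<And>n. adj (g n) ** g n = mat 1"
    and eq: "\<And>n. flag_act (mat 1 + t n *\<^sub>R Z n) (coord_flag ord) = flag_act (g n) (coord_flag ord)"
    and H: "adj H = H" and max: "\<And>n. height ord H (g n) \<le> height ord H (mat 1)" and "a \<noteq> b"
  shows "H $ b $ a = 0"
proof -
  obtain r G where r: "strict_mono r" and G: "(\<lambda>n. g (r n)) \<longlonglongrightarrow> G"
    and G0: "\<And>a b. a \<noteq> b \<Longrightarrow> G $ b $ a = 0" and G1: "\<And>a. cmod (G $ a $ a) = 1"
    and up: "\<And>a b. ord a < ord b \<Longrightarrow> (\<lambda>n. g (r n) $ b $ a / complex_of_real (t (r n))) \<longlonglongrightarrow> H $ b $ a * G $ a $ a"
    and down: "\<And>a b. ord b < ord a \<Longrightarrow> (\<lambda>n. g (r n) $ b $ a / complex_of_real (t (r n))) \<longlonglongrightarrow> - cnj (H $ a $ b) * G $ a $ a"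
    by (rule unitary_frame_asymptotics [OF inj t Z unit eq]) (rule that; assumption)
  have cH: "cnj (H $ a $ b) = H $ b $ a" for a b
    using H by (metis adj_nth)
  \<comment> \<open>For Hermitian \<open>H\<close> the two limits merge into one;
    \<open>\<sigma>\<close> is the sign telling on which side of the diagonal the entry
    lies.\<close>
  define \<sigma> :: "'n \<Rightarrow> 'n \<Rightarrow> real" where
    "\<sigma> a c = (if ord a < ord c then 1 else if ord c < ord a then - 1 else 0)" for a c
  have lim: "(\<lambda>n. g (r n) $ c $ a / complex_of_real (t (r n))) \<longlonglongrightarrow> complex_of_real (\<sigma> a c) * H $ c $ a * G $ a $ a"
    if "a \<noteq> c" for a c
    using up [of a c] down [of c a] that inj by (auto simp: \<sigma>_def cH dest: injD)
  have GG: "cnj (G $ a $ a) * G $ a $ a = 1" for a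
    using G1 [of a] by (simp add: complex_norm_square [symmetric] mult.commute)
  \<comment> \<open>As column \<open>a\<close> of \<open>g n\<close> has length 1, the terms sum to
    the change of the diagonal entry at \<open>a\<close>. The subtraction also removes the term
    \<open>b = c = a\<close>, so every remaining one has an off-diagonal factor and can be divided
    by \<open>t\<close>.\<close>
  define D where "D n a b c = cnj (g n $ b $ a) * g n $ c $ a * (H $ b $ c - (if b = c then H $ a $ a else 0))" for n a b c
  define L where "L a b c = (if b = a then \<sigma> a c * (cmod (H $ c $ a))\<^sup>2 else 0) +
      (if c = a then \<sigma> a b * (cmod (H $ b $ a))\<^sup>2 else 0)" for a b c
  have DL: "(\<lambda>n. D (r n) a b c / complex_of_real (t (r n))) \<longlonglongrightarrow> complex_of_real (L a b c)" for a b c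
  proof (cases "b = a")
    case ba: True
    show ?thesis
    proof (cases "c = a")
      case True
      then show ?thesis using ba by (simp add: D_def L_def \<sigma>_def)
    next
      case False
      have "(\<lambda>n. cnj (g (r n) $ a $ a) * (g (r n) $ c $ a / complex_of_real (t (r n))) * H $ a $ c)
         \<longlonglongrightarrow> cnj (G $ a $ a) * (complex_of_real (\<sigma> a c) * H $ c $ a * G $ a $ a) * H $ a $ c"
        using False by (intro tendsto_mult tendsto_cnj tendsto_const lim tendsto_vec_nth G) auto
      also have "cnj (G $ a $ a) * (complex_of_real (\<sigma> a c) * H $ c $ a * G $ a $ a) * H $ a $ c
         = (cnj (G $ a $ a) * G $ a $ a) * (complex_of_real (\<sigma> a c) * (H $ c $ a * cnj (H $ c $ a)))"
        unfolding cH by (simp add: mult_ac)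
      also have "\<dots> = complex_of_real (L a b c)"
        unfolding GG using False ba by (simp add: L_def complex_norm_square [symmetric] \<sigma>_def)
      finally show ?thesis using False ba by (simp add: D_def mult_ac)
    qed
  next
    case False
    have "(\<lambda>n. cnj (g (r n) $ b $ a / complex_of_real (t (r n))) * g (r n) $ c $ a * (H $ b $ c - (if b = c then H $ a $ a else 0)))
       \<longlonglongrightarrow> cnj (complex_of_real (\<sigma> a b) * H $ b $ a * G $ a $ a) * G $ c $ a * (H $ b $ c - (if b = c then H $ a $ a else 0))"
      using False by (intro tendsto_mult tendsto_cnj tendsto_const lim tendsto_vec_nth G) auto
    also have "cnj (complex_of_real (\<sigma> a b) * H $ b $ a * G $ a $ a) * G $ c $ a * (H $ b $ c - (if b = c then H $ a $ a else 0))
       = complex_of_real (L a b c)"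
    proof (cases "c = a")
      case True
      have "cnj (complex_of_real (\<sigma> a b) * H $ b $ a * G $ a $ a) * G $ a $ a * H $ b $ a
        = (cnj (G $ a $ a) * G $ a $ a) * (complex_of_real (\<sigma> a b) * (H $ b $ a * cnj (H $ b $ a)))"
        by (simp add: mult_ac)
      also have "\<dots> = complex_of_real (L a b c)"
        unfolding GG using False True by (simp add: L_def complex_norm_square [symmetric])
      finally show ?thesis using False True by simp
    qed (use False G0 in \<open>simp add: L_def\<close>)
    finally show ?thesis by (simp add: D_def mult_ac)
  qed
  have diag: "(adj (g n) ** H ** g n) $ a $ a - H $ a $ a = (\<Sum>b\<in>UNIV. \<Sum>c\<in>UNIV. D n a b c)" for n a
  proof -
    have "(\<Sum>b\<in>UNIV. \<Sum>c\<in>UNIV. D n a b c) = (\<Sum>b\<in>UNIV. \<Sum>c\<in>UNIV. cnj (g n $ b $ a) * g n $ c $ a * H $ b $ c)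
       - (\<Sum>b\<in>UNIV. \<Sum>c\<in>UNIV. cnj (g n $ b $ a) * g n $ c $ a * (if b = c then H $ a $ a else 0))"
      by (simp add: D_def right_diff_distrib sum_subtractf)
    also have "(\<Sum>b\<in>UNIV. \<Sum>c\<in>UNIV. cnj (g n $ b $ a) * g n $ c $ a * (if b = c then H $ a $ a else 0))
       = (adj (g n) ** g n) $ a $ a * H $ a $ a"
      by (simp add: matrix_matrix_mult_def sum_distrib_right if_distrib [where f = "\<lambda>x. _ * x"] cong: if_cong)
    also have "\<dots> = H $ a $ a" by (simp add: unit mat_def)
    also have "(\<Sum>b\<in>UNIV. \<Sum>c\<in>UNIV. cnj (g n $ b $ a) * g n $ c $ a * H $ b $ c) = (adj (g n) ** H ** g n) $ a $ a"
    proof -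
      have "(adj (g n) ** H ** g n) $ a $ a = (\<Sum>c\<in>UNIV. \<Sum>b\<in>UNIV. cnj (g n $ b $ a) * g n $ c $ a * H $ b $ c)"
        by (simp add: matrix_matrix_mult_def sum_distrib_right sum_distrib_left mult_ac)
      also have "\<dots> = (\<Sum>b\<in>UNIV. \<Sum>c\<in>UNIV. cnj (g n $ b $ a) * g n $ c $ a * H $ b $ c)"
        by (rule sum.swap)
      finally show ?thesis ..
    qed
    finally show ?thesis by simp
  qed
  define T where "T n = (\<Sum>a\<in>UNIV. real (ord a) * Re (\<Sum>b\<in>UNIV. \<Sum>c\<in>UNIV. D n a b c / complex_of_real (t n)))" for n
  have "T n \<ge> 0" for n
  proof -
    have "T n = (height ord H (mat 1) - height ord H (g n)) / t n"
      by (simp add: T_def height_def diag [symmetric] sum_subtractf right_diff_distrib diff_divide_distrib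
          sum_divide_distrib [symmetric] Re_divide_of_real)
    then show ?thesis using max [of n] t(1) [of n] by simp
  qed
  moreover have "(\<lambda>n. T (r n)) \<longlonglongrightarrow> (\<Sum>a\<in>UNIV. real (ord a) * Re (\<Sum>b\<in>UNIV. \<Sum>c\<in>UNIV. complex_of_real (L a b c)))"
    unfolding T_def by (intro tendsto_sum tendsto_mult tendsto_const tendsto_Re DL)
  ultimately have "0 \<le> (\<Sum>a\<in>UNIV. real (ord a) * Re (\<Sum>b\<in>UNIV. \<Sum>c\<in>UNIV. complex_of_real (L a b c)))"
    by (intro LIMSEQ_le_const) auto
  also have "\<dots> = (\<Sum>a\<in>UNIV. real (ord a) * (2 * (\<Sum>c\<in>UNIV. \<sigma> a c * (cmod (H $ c $ a))\<^sup>2)))"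
  proof -
    have "(\<Sum>b\<in>UNIV. \<Sum>c\<in>UNIV. if b = a then F c else 0) = (\<Sum>c\<in>UNIV. F c)" for F :: "'n \<Rightarrow> real" and a :: 'n
      by (subst sum.swap) simp
    then have "(\<Sum>b\<in>UNIV. \<Sum>c\<in>UNIV. L a b c) = 2 * (\<Sum>c\<in>UNIV. \<sigma> a c * (cmod (H $ c $ a))\<^sup>2)" for a
      by (simp add: L_def sum.distrib)
    then show ?thesis by (simp only: of_real_sum [symmetric] Re_complex_of_real)
  qed
  also have "\<dots> = 2 * (\<Sum>a\<in>UNIV. \<Sum>c\<in>UNIV. real (ord a) * (\<sigma> a c * (cmod (H $ c $ a))\<^sup>2))"
    by (simp add: sum_distrib_left mult_ac)
  finally have nonneg: "0 \<le> (\<Sum>a\<in>UNIV. \<Sum>c\<in>UNIV. real (ord a) * (\<sigma> a c * (cmod (H $ c $ a))\<^sup>2))" by simp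
  have sym: "cmod (H $ a $ c) = cmod (H $ c $ a)" for a c
    by (metis cH complex_mod_cnj)
  \<comment> \<open>Symmetrizing in \<open>a\<close> and \<open>c\<close> turns the weight into
    minus the distance of the two positions, so a sum of nonnegative terms is at most 0.\<close>
  have "(\<Sum>a\<in>UNIV. \<Sum>c\<in>UNIV. real (ord a) * (\<sigma> a c * (cmod (H $ c $ a))\<^sup>2))
     = (\<Sum>a\<in>UNIV. \<Sum>c\<in>UNIV. real (ord c) * (\<sigma> c a * (cmod (H $ c $ a))\<^sup>2))"
    by (subst sum.swap) (simp add: sym)
  then have "(\<Sum>a\<in>UNIV. \<Sum>c\<in>UNIV. (real (ord a) * \<sigma> a c + real (ord c) * \<sigma> c a) * (cmod (H $ c $ a))\<^sup>2)
     = 2 * (\<Sum>a\<in>UNIV. \<Sum>c\<in>UNIV. real (ord a) * (\<sigma> a c * (cmod (H $ c $ a))\<^sup>2))"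
    by (simp add: distrib_right sum.distrib mult.assoc)
  also have "(\<lambda>a c. real (ord a) * \<sigma> a c + real (ord c) * \<sigma> c a) = (\<lambda>a c. - \<bar>real (ord a) - real (ord c)\<bar>)"
    by (auto simp: \<sigma>_def fun_eq_iff)
  finally have "(\<Sum>a\<in>UNIV. \<Sum>c\<in>UNIV. \<bar>real (ord a) - real (ord c)\<bar> * (cmod (H $ c $ a))\<^sup>2) \<le> 0"
    using nonneg by (simp add: sum_negf)
  moreover have "0 \<le> (\<Sum>c\<in>UNIV. \<bar>real (ord a) - real (ord c)\<bar> * (cmod (H $ c $ a))\<^sup>2)" for a
    by (intro sum_nonneg) auto
  ultimately have "(\<Sum>c\<in>UNIV. \<bar>real (ord a) - real (ord c)\<bar> * (cmod (H $ c $ a))\<^sup>2) = 0"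
    by (metis (no_types, lifting) UNIV_I finite_code order_antisym sum_nonneg sum_nonneg_eq_0_iff)
  then have "\<bar>real (ord a) - real (ord b)\<bar> * (cmod (H $ b $ a))\<^sup>2 = 0"
    by (subst (asm) sum_nonneg_eq_0_iff) auto
  moreover have "ord a \<noteq> ord b" using inj \<open>a \<noteq> b\<close> by (auto dest: injD)
  ultimately show ?thesis by simp
qed

subsection \<open>Closed complex orbits of the compact group\<close>

lemma compact_K\<^sub>0: "compact (K\<^sub>0 :: (complex^('m::finite + 'm)^('m + 'm)) set)"
  unfolding compact_eq_bounded_closed
proof
  show "bounded (K\<^sub>0 :: (complex^('m + 'm)^('m + 'm)) set)"
    unfolding bounded_iff using unitary_norm_le [OF K\<^sub>0_unitary] by blast
  have "K\<^sub>0 = {X :: complex^('m + 'm)^('m + 'm). det X = 1} \<inter> (\<Inter>a b. {X. (adj X ** X) $ a $ b = mat 1 $ a $ b})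
      \<inter> (\<Inter>a b. {X. X $ partner a $ partner b = sgp a * sgp b * cnj (X $ a $ b)})"
    by (auto simp: K\<^sub>0_iff quaternionic_def vec_eq_iff)
  also have "closed \<dots>"
    unfolding det_def matrix_matrix_mult_def
    by (intro closed_Int closed_INT ballI closed_Collect_eq)
       (auto intro!: continuous_intros)
  finally show "closed (K\<^sub>0 :: (complex^('m + 'm)^('m + 'm)) set)" .
qed

lemma tangent_cone_complex_subspace:
  assumes "has_codim_at S p c"
  shows "X \<in> tangent_cone S p \<Longrightarrow> Y \<in> tangent_cone S p \<Longrightarrow> X + Y \<in> tangent_cone S p"
    and "X \<in> tangent_cone S p \<Longrightarrow> mat z ** X \<in> tangent_cone S p"
  by (rule tangent_cone_of_codim [OF assms]; simp add: clinear_add clinear_scale)+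

lemma base_cycle_orbit:
  assumes "C = flag_orbit K\<^sub>0 V" "p \<in> C"
  shows "C = flag_orbit K\<^sub>0 p"
proof -
  obtain h where h: "h \<in> K\<^sub>0" "p = flag_act h V" using assms by (auto simp: flag_orbit_def)
  have "flag_act g V = flag_act (g ** adj h) p" for g
    using unitary_right [OF K\<^sub>0_unitary [OF h(1)]] K\<^sub>0_unitary [OF h(1)]
    by (simp add: h(2) flag_act_mult [symmetric] matrix_mul_assoc [symmetric])
  then have "flag_orbit K\<^sub>0 V \<subseteq> flag_orbit K\<^sub>0 p"
    using K\<^sub>0_mult K\<^sub>0_adj h(1) by (fastforce simp: flag_orbit_def)
  moreover have "flag_orbit K\<^sub>0 p \<subseteq> flag_orbit K\<^sub>0 V"
    using K\<^sub>0_mult h by (force simp: flag_orbit_def flag_act_mult [symmetric])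
  ultimately show ?thesis using assms(1) by simp
qed

lemma tangent_cone_orbit_sequence:
  assumes "X \<in> tangent_cone (flag_orbit K\<^sub>0 p) p"
  obtains t Z g where "\<And>n. t n > 0" "t \<longlonglongrightarrow> (0::real)" "Z \<longlonglongrightarrow> X" "\<And>n. g n \<in> K\<^sub>0"
    "\<And>n. flag_act (mat 1 + t n *\<^sub>R Z n) p = flag_act (g n) p"
proof -
  obtain t Z where tZ: "\<And>n. t n > 0" "t \<longlonglongrightarrow> (0::real)" "Z \<longlonglongrightarrow> X"
    "\<And>n. flag_act (mat 1 + t n *\<^sub>R Z n) p \<in> flag_orbit K\<^sub>0 p"
    using assms by (auto simp: tangent_cone_def)
  have "\<forall>n. \<exists>g. g \<in> K\<^sub>0 \<and> flag_act (mat 1 + t n *\<^sub>R Z n) p = flag_act g p"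
    using tZ(4) by (auto simp: flag_orbit_def)
  then obtain g where "\<And>n. g n \<in> K\<^sub>0" "\<And>n. flag_act (mat 1 + t n *\<^sub>R Z n) p = flag_act (g n) p"
    unfolding choice_iff by blast
  with tZ show thesis using that by blast
qed

lemma flag_act_coord_flag_of_monomial:
  fixes Q :: "complex^'n^('n::finite)"
  assumes "adj Q ** Q = mat 1" and "\<And>a b. Q $ b $ a \<noteq> 0 \<Longrightarrow> ord' b = ord a"
  shows "flag_act Q (coord_flag ord) = coord_flag ord'"
proof
  fix k
  have 1: "Q *v x \<in> coord_flag ord' k" if x: "x \<in> coord_flag ord k"
      and m: "\<And>a b. Q $ b $ a \<noteq> 0 \<Longrightarrow> ord' b = ord a" for Q :: "complex^'n^'n" and x and ord ord' :: "'n \<Rightarrow> nat"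
  proof -
    have "Q $ b $ a * x $ a = 0" if "ord' b > k" for a b
    proof (cases "Q $ b $ a = 0")
      case False
      then have "ord a > k" using m [OF False] that by simp
      then show ?thesis using x by (simp add: coord_flag_iff)
    qed simp
    then show ?thesis
      unfolding coord_flag_iff matrix_vector_mult_def vec_lambda_beta
      by (intro allI impI sum.neutral ballI) auto
  qed
  show "flag_act Q (coord_flag ord) k = coord_flag ord' k"
  proof
    show "flag_act Q (coord_flag ord) k \<subseteq> coord_flag ord' k"
      using 1 assms(2) by (auto simp: flag_act_def)
    show "coord_flag ord' k \<subseteq> flag_act Q (coord_flag ord) k"
    proof
      fix y assume y: "y \<in> coord_flag ord' k"
      have "adj Q *v y \<in> coord_flag ord k"
        by (rule 1 [OF y]) (use assms(2) in force)
      moreover have "y = Q *v (adj Q *v y)"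
        using unitary_right [OF assms(1)] by (simp add: matrix_vector_mul_assoc)
      ultimately show "y \<in> flag_act Q (coord_flag ord) k" by (auto simp: flag_act_def)
    qed
  qed
qed

text \<open>With \<open>p\<close> a point of maximal height for a diagonal \<open>H\<close> with \<open>\<i>H\<close> in the Lie algebra and distinct eigenvalues, \<open>H\<close>
  lies in the tangent cone because this is a complex subspace; so \<open>H\<close> is diagonal in a unitary frame of \<open>p\<close>.\<close>

lemma base_cycle_contains_coord_flag:
  fixes V :: "('m::finite + 'm) flag"
  assumes C: "C = flag_orbit K\<^sub>0 V" and sub: "complex_submanifold C"
  obtains ord where "bij_betw ord (UNIV :: ('m + 'm) set) {1..CARD('m + 'm)}" "coord_flag ord \<in> C"
proof -
  obtain ord where ord: "bij_betw ord (UNIV :: ('m + 'm) set) {1..CARD('m + 'm)}"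
    using ex_bij_betw_finite_nat [of "UNIV :: ('m + 'm) set"] ex_bij_betw_nat_finite_1 by (metis bij_betw_inv finite_code)
  have inj: "inj ord" using ord by (simp add: bij_betw_def)
  have "V = flag_act (mat 1) V" by simp
  then have "V \<in> C" unfolding C flag_orbit_def using K\<^sub>0_mat_1 by blast
  then have "V \<in> flag_manifold" using sub by (auto simp: complex_submanifold_def)
  then obtain Q0 where Q0: "adj Q0 ** Q0 = mat 1" "V = flag_act Q0 (coord_flag ord)"
    using unitary_frame ord by blast
  obtain \<nu> :: "'m \<Rightarrow> nat" where \<nu>: "inj \<nu>" using finite_imp_inj_to_nat_seg [of "UNIV :: 'm set"] by auto
  \<comment> \<open>Opposite values on partners make i times \<open>H\<close> quaternionic;
    \<open>Suc\<close> keeps the values nonzero, so that all of them are distinct.\<close>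
  define ev :: "'m + 'm \<Rightarrow> real" where "ev = case_sum (\<lambda>i. real (Suc (\<nu> i))) (\<lambda>i. - real (Suc (\<nu> i)))"
  have ev: "inj ev" using \<nu> by (auto simp: ev_def inj_on_def split: sum.splits)
  have evp: "ev (partner a) = - ev a" for a by (cases a) (auto simp: ev_def)
  define H :: "complex^('m + 'm)^('m + 'm)" where "H = (\<chi> a b. if a = b then complex_of_real (ev a) else 0)"
  have H: "adj H = H" by (simp add: H_def vec_eq_iff)
  have "mat \<i> ** H \<in> lie_K"
    by (auto simp: lie_K_def quaternionic_def vec_eq_iff H_def evp)
  define f where "f g = height ord H (g ** Q0)" for g
  have "continuous_on K\<^sub>0 f"
    unfolding f_def height_def matrix_matrix_mult_def adj_def
    by (auto intro!: continuous_intros)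
  then obtain g0 where g0: "g0 \<in> K\<^sub>0" "\<And>g. g \<in> K\<^sub>0 \<Longrightarrow> f g \<le> f g0"
    using continuous_attains_sup [OF compact_K\<^sub>0] K\<^sub>0_mat_1 by (metis empty_iff)
  define Q where "Q = g0 ** Q0"
  have Q: "adj Q ** Q = mat 1"
  proof -
    have "adj Q ** Q = adj Q0 ** (adj g0 ** g0) ** Q0" by (simp add: Q_def adj_mult matrix_mul_assoc)
    then show ?thesis by (simp add: K\<^sub>0_unitary [OF g0(1)] Q0)
  qed
  have max: "height ord H (g ** Q) \<le> height ord H Q" if "g \<in> K\<^sub>0" for g
    using g0(2) [OF K\<^sub>0_mult [OF that g0(1)]] by (simp add: f_def Q_def matrix_mul_assoc)
  define p where "p = flag_act Q (coord_flag ord)"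
  have "p = flag_act g0 V" by (simp add: p_def Q_def flag_act_mult Q0(2))
  then have "p \<in> C" using g0(1) by (auto simp: C flag_orbit_def)
  then have Cp: "C = flag_orbit K\<^sub>0 p" using base_cycle_orbit [OF C] by simp
  obtain c where "has_codim_at C p c"
    using sub \<open>p \<in> C\<close> by (auto simp: complex_submanifold_def has_cdim_at_def)
  then have "mat (- \<i>) ** (mat \<i> ** H) \<in> tangent_cone C p"
    using tangent_cone_complex_subspace(2) lie_K_tangent [OF C \<open>p \<in> C\<close> \<open>mat \<i> ** H \<in> lie_K\<close>] by blast
  moreover have "mat (- \<i>) ** (mat \<i> ** H) = H" by (simp add: vec_eq_iff)
  ultimately have "H \<in> tangent_cone (flag_orbit K\<^sub>0 p) p" using Cp by simp
  then obtain t Z g where t: "\<And>n. t n > 0" "t \<longlonglongrightarrow> (0::real)" and Z: "Z \<longlonglongrightarrow> H" and g: "\<And>n. g n \<in> K\<^sub>0"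
    and eq: "\<And>n. flag_act (mat 1 + t n *\<^sub>R Z n) p = flag_act (g n) p"
    by (rule tangent_cone_orbit_sequence) (rule that; assumption)
  define H' where "H' = adj Q ** H ** Q"
  have cancel: "Q ** (adj Q ** X) = X" for X
    using unitary_right [OF Q] by (simp add: matrix_mul_assoc)
  \<comment> \<open>Conjugation by \<open>Q\<close> moves \<open>p\<close> to the coordinate flag
    and the maximum to the identity.\<close>
  have diag: "H' $ b $ a = 0" if "a \<noteq> b" for a b
  proof (rule diagonal_of_maximal_height [OF inj t, where Z = "\<lambda>n. adj Q ** Z n ** Q" and g = "\<lambda>n. adj Q ** g n ** Q"])
    show "(\<lambda>n. adj Q ** Z n ** Q) \<longlonglongrightarrow> H'"
      unfolding H'_def by (intro tendsto_matrix_mult tendsto_const Z)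
    show "adj H' = H'" by (simp add: H'_def adj_mult H matrix_mul_assoc)
    show "a \<noteq> b" by (rule that)
    fix n
    have "adj (adj Q ** g n ** Q) ** (adj Q ** g n ** Q) = adj Q ** (adj (g n) ** (Q ** (adj Q ** (g n ** Q))))"
      by (simp add: adj_mult matrix_mul_assoc)
    also have "\<dots> = adj Q ** ((adj (g n) ** g n) ** Q)" by (simp only: cancel) (simp only: matrix_mul_assoc)
    finally show "adj (adj Q ** g n ** Q) ** (adj Q ** g n ** Q) = mat 1"
      by (simp add: K\<^sub>0_unitary [OF g] Q)
    have "mat 1 + t n *\<^sub>R (adj Q ** Z n ** Q) = adj Q ** (mat 1 + t n *\<^sub>R Z n) ** Q"
      by (simp add: matrix_mult_linear Q)
    then have "flag_act (mat 1 + t n *\<^sub>R (adj Q ** Z n ** Q)) (coord_flag ord) = flag_act (adj Q) (flag_act (mat 1 + t n *\<^sub>R Z n) p)"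
      by (simp add: flag_act_mult p_def)
    also have "\<dots> = flag_act (adj Q ** g n ** Q) (coord_flag ord)"
      by (simp add: eq, simp add: flag_act_mult p_def)
    finally show "flag_act (mat 1 + t n *\<^sub>R (adj Q ** Z n ** Q)) (coord_flag ord) = flag_act (adj Q ** g n ** Q) (coord_flag ord)" .
    have "adj (adj Q ** g n ** Q) ** H' ** (adj Q ** g n ** Q)
        = adj Q ** (adj (g n) ** (Q ** (adj Q ** (H ** (Q ** (adj Q ** (g n ** Q)))))))"
      by (simp add: H'_def adj_mult matrix_mul_assoc)
    also have "\<dots> = adj (g n ** Q) ** H ** (g n ** Q)"
      by (simp only: cancel) (simp add: adj_mult matrix_mul_assoc)
    finally have "height ord H' (adj Q ** g n ** Q) = height ord H (g n ** Q)"
      by (simp add: height_def)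
    also have "\<dots> \<le> height ord H Q" by (rule max [OF g])
    also have "\<dots> = height ord H' (mat 1)" by (simp add: height_def H'_def)
    finally show "height ord H' (adj Q ** g n ** Q) \<le> height ord H' (mat 1)" .
  qed
  \<comment> \<open>With \<open>H'\<close> diagonal, the columns of \<open>Q\<close> are
    eigenvectors of \<open>H\<close>. Its eigenvalues are distinct, so each column has a single
    nonzero entry and \<open>Q\<close> merely permutes the axes.\<close>
  have eig: "complex_of_real (ev b) * Q $ b $ a = Q $ b $ a * H' $ a $ a" for a b
  proof -
    have "H ** Q = Q ** H'" by (simp add: H'_def matrix_mul_assoc [symmetric] cancel)
    then have "(H ** Q) $ b $ a = (Q ** H') $ b $ a" by simp
    moreover have "(H ** Q) $ b $ a = complex_of_real (ev b) * Q $ b $ a"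
      by (simp add: matrix_matrix_mult_def H_def if_distrib [where f = "\<lambda>x. x * _"] cong: if_cong)
    moreover have "(Q ** H') $ b $ a = (\<Sum>c\<in>UNIV. if c = a then Q $ b $ a * H' $ a $ a else 0)"
      by (simp only: matrix_matrix_mult_def vec_lambda_beta, rule sum.cong) (use diag in auto)
    ultimately show ?thesis by simp
  qed
  have uniq: "b = c" if "Q $ b $ a \<noteq> 0" "Q $ c $ a \<noteq> 0" for a b c
  proof -
    have "complex_of_real (ev b) = complex_of_real (ev c)"
      using eig [of b a] eig [of c a] that by simp
    then show ?thesis using ev by (auto dest: injD)
  qed
  have "\<exists>b. Q $ b $ a \<noteq> 0" for a
  proof (rule ccontr)
    assume "\<nexists>b. Q $ b $ a \<noteq> 0"
    then show False using unitary_column [OF Q, of a] by simp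
  qed
  then obtain \<theta> where \<theta>: "\<And>a. Q $ \<theta> a $ a \<noteq> 0" by metis
  have "inj \<theta>"
  proof (rule injI, rule ccontr)
    fix a a' assume "\<theta> a = \<theta> a'" "a \<noteq> a'"
    have "(adj Q ** Q) $ a $ a' = (\<Sum>c\<in>UNIV. if c = \<theta> a then cnj (Q $ \<theta> a $ a) * Q $ \<theta> a $ a' else 0)"
      by (simp only: matrix_matrix_mult_def vec_lambda_beta, rule sum.cong) (use uniq \<theta> in auto)
    then show False using \<theta> \<open>\<theta> a = \<theta> a'\<close> \<open>a \<noteq> a'\<close> Q by (simp add: mat_def) metis
  qed
  then have "bij \<theta>" by (simp add: finite_UNIV_inj_surj bij_def)
  have "p = coord_flag (ord \<circ> inv \<theta>)"
    unfolding p_def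
  proof (rule flag_act_coord_flag_of_monomial [OF Q])
    fix a b assume "Q $ b $ a \<noteq> 0"
    then have "b = \<theta> a" using uniq \<theta> by blast
    then show "(ord \<circ> inv \<theta>) b = ord a" using \<open>inj \<theta>\<close> by simp
  qed
  moreover have "bij_betw (ord \<circ> inv \<theta>) UNIV {1..CARD('m + 'm)}"
    using bij_betw_trans [OF bij_imp_bij_inv [OF \<open>bij \<theta>\<close>] ord] .
  ultimately show thesis using \<open>p \<in> C\<close> that by blast
qed

text \<open>If \<open>partner\<close> kept the order of \<open>a\<close> and \<open>b\<close>, the
  entries at (b, a) and (partner b, partner a) would both lie below the diagonal. There the frame
  depends complex linearly on the tangent vector, up to the phases \<open>G\<close>, whereas a
  quaternionic frame has the second entry conjugate to the first up to sign. For i times the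
  rotation \<open>A\<close>, which is tangent, both cannot hold.\<close>

lemma coord_flag_in_base_cycle_order_reversing:
  fixes V :: "('m::finite + 'm) flag"
  assumes C: "C = flag_orbit K\<^sub>0 V" and sub: "complex_submanifold C"
    and inj: "inj ord" and p: "coord_flag ord \<in> C" and ab: "ord a < ord b"
  shows "ord (partner b) < ord (partner a)"
proof (rule ccontr)
  assume "\<not> ord (partner b) < ord (partner a)"
  moreover have "ord (partner b) \<noteq> ord (partner a)" using ab inj by (auto dest: injD)
  ultimately have ab': "ord (partner a) < ord (partner b)" by simp
  have neq: "a \<noteq> b" "b \<noteq> partner a" using ab ab' by auto
  let ?p = "coord_flag ord"
  define s where "s = sgp a * sgp b"
  define A where "A = (\<chi> c d. if c = b \<and> d = a then 1 else if c = a \<and> d = b then - 1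
     else if c = partner b \<and> d = partner a then s else if c = partner a \<and> d = partner b then - s else (0::complex))"
  have s: "cnj s = s" "s * s = 1" by (simp_all add: s_def mult_ac)
  have "A \<in> lie_K"
    unfolding lie_K_def
  proof (intro CollectI conjI)
    show "adj A = - A" using neq s by (auto simp: A_def vec_eq_iff)
    have e: "partner c = d \<longleftrightarrow> c = partner d" for c d :: "'m + 'm" by auto
    show "quaternionic A" unfolding quaternionic_def A_def
      using neq s by (auto simp: e s_def mult_ac)
  qed
  have Cp: "C = flag_orbit K\<^sub>0 ?p" by (rule base_cycle_orbit [OF C p])
  obtain c where "has_codim_at C ?p c"
    using sub p by (auto simp: complex_submanifold_def has_cdim_at_def)
  then have "mat \<i> ** A \<in> tangent_cone C ?p"
    using tangent_cone_complex_subspace(2) lie_K_tangent [OF C p \<open>A \<in> lie_K\<close>] by blast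
  then have "mat \<i> ** A \<in> tangent_cone (flag_orbit K\<^sub>0 ?p) ?p" using Cp by simp
  then obtain t Z g where t: "\<And>n. t n > 0" "t \<longlonglongrightarrow> (0::real)" and Z: "Z \<longlonglongrightarrow> mat \<i> ** A" and g: "\<And>n. g n \<in> K\<^sub>0"
    and eq: "\<And>n. flag_act (mat 1 + t n *\<^sub>R Z n) ?p = flag_act (g n) ?p"
    by (rule tangent_cone_orbit_sequence) (rule that; assumption)
  obtain r G where r: "strict_mono r" and G: "(\<lambda>n. g (r n)) \<longlonglongrightarrow> G"
    and "\<And>a b. a \<noteq> b \<Longrightarrow> G $ b $ a = 0" and G1: "\<And>a. cmod (G $ a $ a) = 1"
    and up: "\<And>a b. ord a < ord b \<Longrightarrow> (\<lambda>n. g (r n) $ b $ a / complex_of_real (t (r n))) \<longlonglongrightarrow> (mat \<i> ** A) $ b $ a * G $ a $ a"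
    and "\<And>a b. ord b < ord a \<Longrightarrow> (\<lambda>n. g (r n) $ b $ a / complex_of_real (t (r n))) \<longlonglongrightarrow> - cnj ((mat \<i> ** A) $ a $ b) * G $ a $ a"
    by (rule unitary_frame_asymptotics [OF inj t Z K\<^sub>0_unitary [OF g] eq]) (rule that; assumption)
  have q: "g n $ partner c $ partner d = sgp c * sgp d * cnj (g n $ c $ d)" for n c d
    using g [of n] by (simp add: K\<^sub>0_iff quaternionic_def)
  have 1: "(\<lambda>n. g (r n) $ partner b $ partner a / complex_of_real (t (r n))) \<longlonglongrightarrow> \<i> * s * G $ partner a $ partner a"
    using up [OF ab'] neq by (simp add: A_def)
  have "(\<lambda>n. s * cnj (g (r n) $ b $ a / complex_of_real (t (r n)))) \<longlonglongrightarrow> s * cnj (\<i> * G $ a $ a)"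
    using up [OF ab] neq by (intro tendsto_mult tendsto_const tendsto_cnj) (simp add: A_def)
  moreover have "s * cnj (g n $ b $ a / complex_of_real (t n)) = g n $ partner b $ partner a / complex_of_real (t n)" for n
    unfolding q by (simp add: s_def mult_ac)
  ultimately have "(\<lambda>n. g (r n) $ partner b $ partner a / complex_of_real (t (r n))) \<longlonglongrightarrow> s * cnj (\<i> * G $ a $ a)"
    by (simp only:)
  with 1 have "\<i> * s * G $ partner a $ partner a = s * cnj (\<i> * G $ a $ a)"
    by (rule LIMSEQ_unique)
  moreover have "G $ partner a $ partner a = cnj (G $ a $ a)"
  proof -
    have "(\<lambda>n. cnj (g (r n) $ a $ a)) \<longlonglongrightarrow> cnj (G $ a $ a)"
      by (intro tendsto_cnj tendsto_vec_nth G)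
    moreover have "(\<lambda>n. g (r n) $ partner a $ partner a) \<longlonglongrightarrow> G $ partner a $ partner a"
      by (intro tendsto_vec_nth G)
    moreover have "g n $ partner a $ partner a = cnj (g n $ a $ a)" for n by (simp add: q)
    ultimately show ?thesis by (metis (no_types, lifting) LIMSEQ_unique ext)
  qed
  ultimately have "cnj (G $ a $ a) = 0" by (simp add: s_def)
  then show False using G1 [of a] by simp
qed

text \<open>An order-reversing involution of a finite chain is its reflection: the elements up to
  \<open>a\<close> correspond to those from \<open>partner a\<close> on.\<close>

lemma order_reversing_partner:
  assumes ord: "bij_betw ord (UNIV :: ('m::finite + 'm) set) {1..CARD('m + 'm)}"
    and rev: "\<And>a b. ord a < ord b \<Longrightarrow> ord (partner b) < ord (partner a)"
  shows "ord (partner a) + ord a = CARD('m + 'm) + 1"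
proof -
  have inj: "inj ord" using ord by (simp add: bij_betw_def)
  have range: "1 \<le> ord a \<and> ord a \<le> CARD('m + 'm)" for a using bij_betwE [OF ord] by auto
  have le: "ord b \<le> ord a \<longleftrightarrow> ord (partner a) \<le> ord (partner b)" for a b
    using rev [of a b] rev [of "partner b" "partner a"] by (metis linorder_not_le partner_partner)
  have "ord a = card {b. ord b \<le> ord a}" using card_ord_le [OF ord] range by simp
  also have "\<dots> = card (partner ` {b. ord b \<le> ord a})"
    by (rule card_image [symmetric]) (simp add: inj_on_def)
  also have "partner ` {b. ord b \<le> ord a} = {c. ord (partner a) \<le> ord c}"
  proof (intro equalityI subsetI)
    fix c assume "c \<in> {c. ord (partner a) \<le> ord c}"
    then have "partner c \<in> {b. ord b \<le> ord a}" using le [of "partner c" a] by simp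
    then show "c \<in> partner ` {b. ord b \<le> ord a}" by (metis image_eqI partner_partner)
  qed (use le in auto)
  also have "\<dots> = UNIV - {c. ord c \<le> ord (partner a) - 1}"
  proof -
    have "ord (partner a) \<le> ord c \<longleftrightarrow> \<not> ord c \<le> ord (partner a) - 1" for c
      using range [of "partner a"] by linarith
    then show ?thesis by blast
  qed
  also have "card \<dots> = CARD('m + 'm) - (ord (partner a) - 1)"
    using card_ord_le [OF ord, of "ord (partner a) - 1"] range [of "partner a"]
    by (subst card_Diff_subset) auto
  finally show ?thesis using range [of a] range [of "partner a"] by linarith
qed

text \<open>\<open>K\<^sub>0\<close> preserves \<open>om\<close>, so the coordinate flag decides.
  There \<open>ord a \<le> k\<close> puts \<open>partner a\<close> at n + 1 - ord a > n - k, and no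
  term of the form survives.\<close>

lemma base_cycle_isotropic:
  fixes V :: "('m::finite + 'm) flag"
  assumes C: "C = flag_orbit K\<^sub>0 V" and sub: "complex_submanifold C"
    and p: "p \<in> C" and k: "k \<le> CARD('m + 'm)" and xy: "x \<in> p k" "y \<in> p (CARD('m + 'm) - k)"
  shows "om x y = 0"
proof -
  obtain ord where ord: "bij_betw ord (UNIV :: ('m + 'm) set) {1..CARD('m + 'm)}" "coord_flag ord \<in> C"
    using base_cycle_contains_coord_flag [OF C sub] .
  have inj: "inj ord" using ord by (simp add: bij_betw_def)
  note rev = order_reversing_partner [OF ord(1) coord_flag_in_base_cycle_order_reversing [OF C sub inj ord(2)]]
  have "p \<in> flag_orbit K\<^sub>0 (coord_flag ord)" using base_cycle_orbit [OF C ord(2)] p by simp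
  then obtain g where g: "g \<in> K\<^sub>0" "p = flag_act g (coord_flag ord)" by (auto simp: flag_orbit_def)
  obtain x' y' where x': "x' \<in> coord_flag ord k" "x = g *v x'"
    and y': "y' \<in> coord_flag ord (CARD('m + 'm) - k)" "y = g *v y'"
    using xy by (auto simp: g(2) flag_act_def)
  have "x' $ a * y' $ partner a = 0" for a
  proof (cases "ord a \<le> k")
    case True
    then have "ord (partner a) > CARD('m + 'm) - k" using rev [of a] k by linarith
    then show ?thesis using y'(1) by (simp add: coord_flag_iff)
  qed (use x'(1) in \<open>simp add: coord_flag_iff\<close>)
  then have "om x' y' = 0" unfolding om_def mult.assoc by (intro sum.neutral) auto
  then show ?thesis by (simp add: x'(2) y'(2) om_K\<^sub>0 [OF g(1)])
qed

subsection \<open>Dimensions\<close>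

lemma has_codim_atI:
  fixes f :: "'i \<Rightarrow> complex^'n^('n::finite) \<Rightarrow> complex"
  assumes "finite I" "p \<in> S" "open U" "mat 1 \<in> U" "\<And>A. A \<in> U \<Longrightarrow> invertible A"
    and der: "\<And>A i. A \<in> U \<Longrightarrow> i \<in> I \<Longrightarrow> (f i has_derivative f' A i) (at A)"
    and scale: "\<And>A i z H. A \<in> U \<Longrightarrow> i \<in> I \<Longrightarrow> f' A i (mat z ** H) = z * f' A i H"
    and surj: "\<And>A y. A \<in> U \<Longrightarrow> \<exists>H. \<forall>i\<in>I. f' A i H = y i"
    and zero: "\<And>A. A \<in> U \<Longrightarrow> flag_act A p \<in> S \<longleftrightarrow> (\<forall>i\<in>I. f i A = 0)"
  shows "has_codim_at S p (card I)"
proof -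
  obtain h where h: "bij_betw h {..<card I} I"
    using ex_bij_betw_nat_finite [OF \<open>finite I\<close>] by (auto simp: atLeast0LessThan)
  have hI: "h i \<in> I" if "i < card I" for i using bij_betwE [OF h] that by auto
  have all: "(\<forall>i\<in>I. P i) \<longleftrightarrow> (\<forall>i<card I. P (h i))" for P
  proof -
    have "\<exists>j<card I. i = h j" if "i \<in> I" for i
      using h that by (auto simp: bij_betw_def image_iff)
    then show ?thesis using hI by metis
  qed
  have surj': "\<exists>H. \<forall>i<card I. f' A (h i) H = y i" if A: "A \<in> U" for A and y :: "nat \<Rightarrow> complex"
  proof -
    obtain H where "\<forall>i\<in>I. f' A i H = (y \<circ> inv_into {..<card I} h) i" using surj [OF A] by blast
    then show ?thesis unfolding all using h by (auto simp: bij_betw_def inv_into_f_f)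
  qed
  show ?thesis
    unfolding has_codim_at_def
    using assms hI surj'
    by (intro conjI exI [of _ U] exI [of _ "\<lambda>i. f (h i)"] exI [of _ "\<lambda>A i. f' A (h i)"]) (auto simp: all)
qed

lemma flag_act_in_manifold:
  fixes V :: "('n::finite) flag"
  assumes V: "V \<in> flag_manifold" and A: "invertible A"
  shows "flag_act A V \<in> flag_manifold"
proof -
  have inj: "inj ((*v) A)" using A by (rule inj_matrix_vector_mult)
  have "flag_act A V k = UNIV" if "k \<ge> CARD('n)" for k
  proof -
    have "V k = UNIV" using V that by (simp add: flag_manifold_def)
    then show ?thesis using image_UNIV_of_inj [OF inj] by (simp add: flag_act_def)
  qed
  moreover have "flag_act A V k \<subseteq> flag_act A V (Suc k)" for k
    using V by (auto simp: flag_manifold_def flag_act_def)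
  moreover have "vec.subspace (flag_act A V k)" for k
    unfolding flag_act_def
    by (rule vec.linear_subspace_image [OF matrix_vector_mul_linear_gen flag_subspace [OF V]])
  moreover have "vec.dim (flag_act A V k) = k" if "k \<le> CARD('n)" for k
    using that by (simp add: flag_act_def dim_image_inj [OF inj] flag_dim [OF V])
  ultimately show ?thesis by (simp add: flag_manifold_def)
qed

lemma flag_eqI:
  fixes V W :: "('n::finite) flag"
  assumes V: "V \<in> flag_manifold" and W: "W \<in> flag_manifold" and "\<And>k. V k \<subseteq> W k"
  shows "V = W"
  by (rule ext, rule vec.subspace_dim_equal)
     (use assms in \<open>auto simp: flag_subspace flag_dim\<close>)

lemma flag_act_eqI:
  fixes V W :: "('n::finite) flag"
  assumes V: "V \<in> flag_manifold" and W: "W \<in> flag_manifold" and A: "invertible A"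
    and "\<And>k x. x \<in> V k \<Longrightarrow> A *v x \<in> W k"
  shows "flag_act A V = W"
  using assms(4) by (intro flag_eqI flag_act_in_manifold V W A) (auto simp: flag_act_def)

lemma open_invertible: "open {A :: complex^'n^('n::finite). invertible A}"
proof -
  have "{A :: complex^'n^'n. invertible A} = {A. det A \<noteq> 0}" by (simp add: invertible_det_nz)
  also have "open \<dots>"
    unfolding det_def by (intro open_Collect_neq continuous_intros)
  finally show ?thesis .
qed

lemma upper_iff_stabilizes_coord_flag:
  fixes X :: "complex^'n^('n::finite)"
  shows "(\<forall>k. \<forall>x\<in>coord_flag ord k. X *v x \<in> coord_flag ord k) \<longleftrightarrow> (\<forall>a b. ord a < ord b \<longrightarrow> X $ b $ a = 0)"
proof safe
  fix a b assume *: "\<forall>k. \<forall>x\<in>coord_flag ord k. X *v x \<in> coord_flag ord k" and "ord a < ord b"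
  have "axis a 1 \<in> coord_flag ord (ord a)" by (auto simp: coord_flag_iff axis_def)
  then have "(X *v axis a 1) $ b = 0" using * \<open>ord a < ord b\<close> by (auto simp: coord_flag_iff)
  then show "X $ b $ a = 0"
    by (simp add: matrix_vector_mult_def axis_def if_distrib [where f = "\<lambda>x. _ * x"] cong: if_cong)
next
  fix k x assume *: "\<forall>a b. ord a < ord b \<longrightarrow> X $ b $ a = 0" and x: "x \<in> coord_flag ord k"
  have "X $ b $ a * x $ a = 0" if "ord b > k" for a b
  proof (cases "ord a < ord b")
    case False
    then show ?thesis using that x by (simp add: coord_flag_iff)
  qed (use * in simp)
  then show "X *v x \<in> coord_flag ord k"
    unfolding coord_flag_iff matrix_vector_mult_def vec_lambda_beta by (intro allI impI sum.neutral ballI)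
qed

text \<open>Such an \<open>X\<close> does not move \<open>p\<close> at all:
  \<open>mat 1 + t *\<^sub>R X\<close> fixes \<open>p\<close> as soon as it is invertible, which
  small \<open>t\<close> ensures.\<close>

lemma stabilizer_tangent:
  fixes p :: "('n::finite) flag"
  assumes p: "p \<in> S" "p \<in> flag_manifold" and X: "\<And>k x. x \<in> p k \<Longrightarrow> X *v x \<in> p k"
  shows "X \<in> tangent_cone S p"
proof -
  have "invertible (mat 1 :: complex^'n^'n)" by (simp add: invertible_det_nz)
  then obtain e where e: "e > 0" "\<And>A :: complex^'n^'n. dist A (mat 1) < e \<Longrightarrow> invertible A"
    using open_invertible [unfolded open_dist] by blast
  define \<delta> where "\<delta> = e / (norm X + 1)"
  have \<delta>: "\<delta> > 0" using e by (simp add: \<delta>_def add_nonneg_pos)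
  have act: "flag_act (mat 1 + t *\<^sub>R X) p = p" if "0 < t" "t \<le> \<delta>" for t
  proof (rule flag_act_eqI [OF p(2) p(2) e(2)])
    have "norm (t *\<^sub>R X) \<le> \<delta> * norm X" using that by (simp add: mult_right_mono)
    also have "\<dots> = e * (norm X / (norm X + 1))" by (simp add: \<delta>_def)
    also have "\<dots> < e * 1"
      using e add_nonneg_pos [OF norm_ge_zero [of X] zero_less_one] by (intro mult_strict_left_mono) auto
    finally show "dist (mat 1 + t *\<^sub>R X) (mat 1) < e" by (simp add: dist_norm)
    fix k x assume x: "x \<in> p k"
    have "(mat 1 + t *\<^sub>R X) *v x = x + complex_of_real t *s (X *v x)"
    proof -
      have "(t *\<^sub>R X) *v x = t *\<^sub>R (X *v x)"
        by (simp add: vec_eq_iff matrix_vector_mult_def scaleR_sum_right)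
      also have "\<dots> = complex_of_real t *s (X *v x)"
        by (simp add: vec_eq_iff, simp add: scaleR_conv_of_real)
      finally show ?thesis by (simp add: matrix_vector_mult_add_rdistrib)
    qed
    then show "(mat 1 + t *\<^sub>R X) *v x \<in> p k"
      using vec.subspace_add vec.subspace_scale flag_subspace [OF p(2)] x X [OF x] by metis
  qed
  show ?thesis
  proof (rule tangent_coneI)
    show "(\<lambda>n. \<delta> * inverse (real (Suc n))) \<longlonglongrightarrow> 0"
      using tendsto_mult [OF tendsto_const [of \<delta>] LIMSEQ_inverse_real_of_nat] by simp
    show "(\<lambda>n. X) \<longlonglongrightarrow> X" by simp
    fix n :: nat
    show "0 < \<delta> * inverse (real (Suc n))" using \<delta> by simp
    moreover have "\<delta> * inverse (real (Suc n)) \<le> \<delta> * 1"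
      using \<delta> by (intro mult_left_mono) (auto simp: field_simps)
    ultimately show "flag_act (mat 1 + (\<delta> * inverse (real (Suc n))) *\<^sub>R X) p \<in> S"
      using act p(1) by simp
  qed
qed

section \<open>Codimensions of points and of the base cycle\<close>

abbreviation ordered_pairs :: "('n \<Rightarrow> nat) \<Rightarrow> ('n::finite \<times> 'n) set" where
  "ordered_pairs ord \<equiv> {(b, a). ord a < ord b}"

lemma clinear_entry: "clinear (\<lambda>X :: complex^'n^('n::finite). X $ b $ a)"
  by (simp add: clinear_def)

lemma clinear_conj_entry:
  fixes P Q :: "complex^'n^('n::finite)"
  shows "clinear (\<lambda>X. (P ** X ** Q) $ b $ a)"
proof -
  have "P ** (mat z ** X) ** Q = mat z ** (P ** X ** Q)" for z and X :: "complex^'n^'n"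
  proof -
    have "P ** (mat z ** X) = mat z ** (P ** X)"
      by (simp add: vec_eq_iff matrix_matrix_mult_def [of P] sum_distrib_left mult_ac)
    then show ?thesis by (simp add: matrix_mul_assoc)
  qed
  then show ?thesis by (simp add: clinear_def matrix_mult_linear)
qed

text \<open>The cone of a point contains the Lie algebra of its stabilizer, which a unitary frame
  turns into triangular matrices.\<close>

lemma codim_point_le:
  fixes p :: "('n::finite) flag"
  assumes c: "has_codim_at {p} p e" and p: "p \<in> flag_manifold"
    and ord: "bij_betw ord (UNIV :: 'n set) {1..CARD('n)}"
  shows "e \<le> card (ordered_pairs ord)"
proof -
  obtain \<phi> H where \<phi>: "\<And>i. i < e \<Longrightarrow> clinear (\<phi> i)"
    "\<And>i j. i < e \<Longrightarrow> j < e \<Longrightarrow> \<phi> i (H j) = (if i = j then 1 else (0::complex))"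
    "\<And>X. X \<in> tangent_cone {p} p \<longleftrightarrow> (\<forall>i<e. \<phi> i X = 0)"
    by (rule tangent_cone_of_codim [OF c]) (rule that; assumption)
  obtain Q where Q: "adj Q ** Q = mat 1" "p = flag_act Q (coord_flag ord)"
    using unitary_frame [OF p ord] by blast
  have QQ: "Q ** adj Q = mat 1" by (rule unitary_right [OF Q(1)])
  have "card {..<e} \<le> card (ordered_pairs ord)"
  proof (rule card_le_of_kernel_subset [where \<psi> = "\<lambda>(b, a) X. (adj Q ** X ** Q) $ b $ a" and \<phi> = \<phi> and H = H])
    show "clinear (case i of (b, a) \<Rightarrow> \<lambda>X. (adj Q ** X ** Q) $ b $ a)" for i
      by (cases i) (simp add: clinear_conj_entry)
    fix X assume *: "\<forall>i\<in>ordered_pairs ord. (case i of (b, a) \<Rightarrow> \<lambda>X. (adj Q ** X ** Q) $ b $ a) X = 0"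
    then have up: "\<forall>k. \<forall>x\<in>coord_flag ord k. (adj Q ** X ** Q) *v x \<in> coord_flag ord k"
      unfolding upper_iff_stabilizes_coord_flag by auto
    have "X \<in> tangent_cone {p} p"
    proof (rule stabilizer_tangent)
      fix k x assume "x \<in> p k"
      then obtain y where y: "y \<in> coord_flag ord k" "x = Q *v y" by (auto simp: Q(2) flag_act_def)
      have "X *v x = Q *v ((adj Q ** X ** Q) *v y)"
        by (simp add: y(2) matrix_vector_mul_assoc matrix_mul_assoc QQ)
      then show "X *v x \<in> p k" using up y(1) by (auto simp: Q(2) flag_act_def)
    qed (use p in auto)
    then show "\<forall>j\<in>{..<e}. \<phi> j X = 0" using \<phi>(3) by simp
  qed (use \<phi> in auto)
  then show ?thesis by simp
qed

text \<open>Conversely, sequences that fix the coordinate flag are triangular, and so is their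
  limit.\<close>

lemma codim_coord_flag_ge:
  fixes ord :: "'n::finite \<Rightarrow> nat"
  assumes c: "has_codim_at {coord_flag ord} (coord_flag ord) e"
  shows "card (ordered_pairs ord) \<le> e"
proof -
  let ?p = "coord_flag ord"
  obtain \<phi> H where \<phi>: "\<And>i. i < e \<Longrightarrow> clinear (\<phi> i)"
    "\<And>i j. i < e \<Longrightarrow> j < e \<Longrightarrow> \<phi> i (H j) = (if i = j then 1 else (0::complex))"
    "\<And>X. X \<in> tangent_cone {?p} ?p \<longleftrightarrow> (\<forall>i<e. \<phi> i X = 0)"
    by (rule tangent_cone_of_codim [OF c]) (rule that; assumption)
  have "card (ordered_pairs ord) \<le> card {..<e}"
  proof (rule card_le_of_kernel_subset [where \<psi> = \<phi> and \<phi> = "\<lambda>(b, a) X. X $ b $ a"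
        and H = "\<lambda>(d, c). \<chi> i j. if i = d \<and> j = c then 1 else 0"])
    show "clinear (case i of (b, a) \<Rightarrow> \<lambda>X. X $ b $ a)" for i
      by (cases i) (simp add: clinear_entry)
    fix X assume "\<forall>i\<in>{..<e}. \<phi> i X = 0"
    then have "X \<in> tangent_cone {?p} ?p" using \<phi>(3) by simp
    then obtain t Z where tZ: "\<And>n. t n > 0" "Z \<longlonglongrightarrow> X"
      "\<And>n. flag_act (mat 1 + t n *\<^sub>R Z n) ?p = ?p"
      by (auto simp: tangent_cone_def)
    show "\<forall>j\<in>ordered_pairs ord. (case j of (b, a) \<Rightarrow> \<lambda>X. X $ b $ a) X = 0"
    proof clarify
      fix b a assume ab: "ord a < ord b"
      have "Z n $ b $ a = 0" for n
      proof -
        have "\<forall>k. \<forall>x\<in>?p k. (mat 1 + t n *\<^sub>R Z n) *v x \<in> ?p k"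
          using tZ(3) [of n] by (metis flag_act_def imageI)
        then have "(mat 1 + t n *\<^sub>R Z n) $ b $ a = 0"
          using ab unfolding upper_iff_stabilizes_coord_flag by blast
        moreover have "a \<noteq> b" using ab by auto
        ultimately show ?thesis using tZ(1) [of n] by (simp add: mat_def)
      qed
      moreover have "(\<lambda>n. Z n $ b $ a) \<longlonglongrightarrow> X $ b $ a" by (intro tendsto_vec_nth tZ)
      ultimately show "X $ b $ a = 0" by (simp add: LIMSEQ_const_iff)
    qed
  qed (use \<phi> in \<open>auto split: if_splits\<close>)
  then show ?thesis by simp
qed

lemma has_codim_coord_flag:
  fixes ord :: "'n::finite \<Rightarrow> nat"
  assumes ord: "bij_betw ord (UNIV :: 'n set) {1..CARD('n)}"
  shows "has_codim_at {coord_flag ord} (coord_flag ord) (card (ordered_pairs ord))"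
proof (rule has_codim_atI [where f = "\<lambda>(b, a) A. A $ b $ a" and f' = "\<lambda>A (b, a) H. H $ b $ a"
      and U = "{A. invertible A}"])
  show "open {A :: complex^'n^'n. invertible A}" by (rule open_invertible)
  show "mat 1 \<in> {A :: complex^'n^'n. invertible A}" by (simp add: invertible_det_nz)
  fix A :: "complex^'n^'n" and i :: "'n \<times> 'n"
  show "((case i of (b, a) \<Rightarrow> \<lambda>A. A $ b $ a) has_derivative (case i of (b, a) \<Rightarrow> \<lambda>H. H $ b $ a)) (at A)"
    by (cases i) (auto intro!: derivative_eq_intros bounded_linear_imp_has_derivative
      bounded_linear_compose [OF bounded_linear_vec_nth bounded_linear_vec_nth])
  show "(case i of (b, a) \<Rightarrow> \<lambda>H. H $ b $ a) (mat z ** H) = z * (case i of (b, a) \<Rightarrow> \<lambda>H. H $ b $ a) H"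
    for z and H :: "complex^'n^'n" by (cases i) simp
  show "\<exists>H. \<forall>i\<in>ordered_pairs ord. (case i of (b, a) \<Rightarrow> \<lambda>H. H $ b $ a) H = y i" for y :: "'n \<times> 'n \<Rightarrow> complex"
    by (intro exI [of _ "\<chi> b a. y (b, a)"]) auto
  assume A: "A \<in> {A. invertible A}"
  have C: "coord_flag ord \<in> flag_manifold" by (rule coord_flag_in_manifold [OF ord])
  have "flag_act A (coord_flag ord) = coord_flag ord \<longleftrightarrow> (\<forall>k. \<forall>x\<in>coord_flag ord k. A *v x \<in> coord_flag ord k)"
    using flag_act_eqI [OF C C] A by (auto simp: flag_act_def fun_eq_iff)
  then show "flag_act A (coord_flag ord) \<in> {coord_flag ord} \<longleftrightarrow> (\<forall>i\<in>ordered_pairs ord. (case i of (b, a) \<Rightarrow> \<lambda>A. A $ b $ a) A = 0)"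
    by (simp add: upper_iff_stabilizes_coord_flag) blast
qed auto

text \<open>The equations counted make the part of \<open>X\<close> below the diagonal complex
  symplectic. They are enough because the stabilizer absorbs the rest of \<open>X\<close>, and
  because the reflection of (b, a) to (partner a, partner b) pairs equivalent equations, those with
  \<open>b = partner a\<close> being trivial.\<close>

lemma codim_base_cycle_le:
  fixes V :: "('m::finite + 'm) flag"
  assumes C: "C = flag_orbit K\<^sub>0 V" and p: "coord_flag ord \<in> C"
    and ord: "bij_betw ord (UNIV :: ('m + 'm) set) {1..CARD('m + 'm)}"
    and rev: "\<And>a. ord (partner a) + ord a = CARD('m + 'm) + 1"
    and c: "has_codim_at C (coord_flag ord) c"
  shows "c \<le> card {(b, a). ord a < ord b \<and> ord a + ord b \<le> CARD('m + 'm)}" (is "c \<le> card ?P")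
proof -
  let ?p = "coord_flag ord" and ?n = "CARD('m + 'm)"
  obtain \<phi> H where \<phi>: "\<And>i. i < c \<Longrightarrow> clinear (\<phi> i)"
    "\<And>i j. i < c \<Longrightarrow> j < c \<Longrightarrow> \<phi> i (H j) = (if i = j then 1 else (0::complex))"
    "\<And>X. X \<in> tangent_cone C ?p \<longleftrightarrow> (\<forall>i<c. \<phi> i X = 0)"
    by (rule tangent_cone_of_codim [OF c]) (rule that; assumption)
  have "card {..<c} \<le> card ?P"
  proof (rule card_le_of_kernel_subset [where \<psi> = "\<lambda>(b, a) X. X $ b $ a + sgp a * sgp b * X $ partner a $ partner b"
        and \<phi> = \<phi> and H = H])
    show "clinear (case i of (b, a) \<Rightarrow> \<lambda>X. X $ b $ a + sgp a * sgp b * X $ partner a $ partner b)" for i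
      by (cases i) (simp add: clinear_def algebra_simps)
    fix X assume "\<forall>i\<in>?P. (case i of (b, a) \<Rightarrow> \<lambda>X. X $ b $ a + sgp a * sgp b * X $ partner a $ partner b) X = 0"
    then have X: "X $ b $ a + sgp a * sgp b * X $ partner a $ partner b = 0"
      if "ord a < ord b" "ord a + ord b \<le> ?n" for a b using that by auto
    define L where "L = (\<chi> b a. if ord a < ord b then X $ b $ a else 0)"
    have revless: "ord (partner b) < ord (partner a) \<longleftrightarrow> ord a < ord b" for a b
      using rev [of a] rev [of b] by linarith
    have L: "L $ partner a $ partner b = - (sgp a * sgp b * L $ b $ a)" for a b
    proof (cases "ord a < ord b")
      case less: True
      have goal: "X $ partner a $ partner b = - (sgp a * sgp b * X $ b $ a)"
      proof -
        consider "ord a + ord b \<le> ?n" | "ord a + ord b = ?n + 1" | "ord a + ord b > ?n + 1" by linarith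
        then show ?thesis
        proof cases
          case 1
          from X [OF less 1] have "X $ b $ a = - (sgp a * sgp b * X $ partner a $ partner b)"
            by (simp add: eq_neg_iff_add_eq_0)
          then show ?thesis by (simp add: mult_ac)
        next
          case 2
          then have "ord b = ord (partner a)" using rev [of a] by linarith
          then have "b = partner a" using ord by (auto simp: bij_betw_def dest: injD)
          then show ?thesis by simp
        next
          case 3
          then have "ord (partner b) < ord (partner a)" "ord (partner b) + ord (partner a) \<le> ?n"
            using revless less rev [of a] rev [of b] by (simp, linarith)
          from X [OF this] show ?thesis by (simp add: eq_neg_iff_add_eq_0 mult_ac)
        qed
      qed
      then show ?thesis using less revless by (simp add: L_def)
    qed (simp add: L_def revless)
    \<comment> \<open>\<open>L\<close> is \<open>A1\<close> plus i times \<open>A2\<close>; the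
      symmetry of \<open>L\<close> makes both its skew-Hermitian part and -i times its Hermitian
      part quaternionic.\<close>
    define A1 where "A1 = mat (1/2) ** (L - adj L)"
    define A2 where "A2 = mat (- \<i> / 2) ** (L + adj L)"
    have "A1 \<in> lie_K" "A2 \<in> lie_K"
      unfolding lie_K_def quaternionic_def A1_def A2_def
      by (simp_all add: vec_eq_iff L algebra_simps add_divide_distrib diff_divide_distrib)
    then have "A1 \<in> tangent_cone C ?p" "A2 \<in> tangent_cone C ?p"
      using lie_K_tangent [OF C p] by blast+
    then have "A1 + mat \<i> ** A2 \<in> tangent_cone C ?p"
      using tangent_cone_complex_subspace [OF c] by blast
    moreover have "X - L \<in> tangent_cone C ?p"
    proof (rule stabilizer_tangent [OF p coord_flag_in_manifold [OF ord]])
      have "\<forall>a b. ord a < ord b \<longrightarrow> (X - L) $ b $ a = 0" by (simp add: L_def)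
      then show "(X - L) *v x \<in> coord_flag ord k" if "x \<in> coord_flag ord k" for k x
        using that unfolding upper_iff_stabilizes_coord_flag [symmetric] by blast
    qed
    ultimately have "A1 + mat \<i> ** A2 + (X - L) \<in> tangent_cone C ?p"
      using tangent_cone_complex_subspace [OF c] by blast
    moreover have "A1 + mat \<i> ** A2 + (X - L) = X"
      by (simp add: vec_eq_iff A1_def A2_def algebra_simps add_divide_distrib diff_divide_distrib)
    ultimately show "\<forall>j\<in>{..<c}. \<phi> j X = 0" using \<phi>(3) by simp
  qed (use \<phi> in auto)
  then show ?thesis by simp
qed

section \<open>Bounds for the dimension function\<close>

lemma cdim_flag_manifold_le:
  assumes ord: "bij_betw ord (UNIV :: 'n::finite set) {1..CARD('n)}"
  shows "cdim (flag_manifold :: 'n flag set) \<le> card (ordered_pairs ord)"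
proof -
  let ?D = "{d. \<exists>p\<in>(flag_manifold :: 'n flag set). has_cdim_at flag_manifold p d}"
  have "d \<le> card (ordered_pairs ord)" if "d \<in> ?D" for d
    using that codim_point_le [OF _ _ ord] by (fastforce simp: has_cdim_at_def)
  then show ?thesis
  proof (cases "?D = {}")
    case True
    \<comment> \<open>The supremum of the empty set of natural numbers is 0.\<close>
    then show ?thesis unfolding cdim_def True Sup_nat_def by simp
  next
    case False
    then show ?thesis unfolding cdim_def using \<open>\<And>d. d \<in> ?D \<Longrightarrow> d \<le> _\<close> by (rule cSup_least)
  qed
qed

text \<open>On natural numbers \<open>Sup\<close> is an upper bound only of bounded sets. The bound
  comes from \<open>codim_point_le\<close>, since \<open>d\<close> is at most the codimension
  \<open>d + c\<close> of the point.\<close>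

lemma le_cdim:
  fixes S :: "('n::finite) flag set"
  assumes "S \<subseteq> flag_manifold" "p \<in> S" "has_cdim_at S p d"
  shows "d \<le> cdim S"
  unfolding cdim_def
proof (rule cSup_upper)
  obtain ord :: "'n \<Rightarrow> nat" where ord: "bij_betw ord (UNIV :: 'n set) {1..CARD('n)}"
    using ex_bij_betw_finite_nat [of "UNIV :: 'n set"] ex_bij_betw_nat_finite_1 by (metis bij_betw_inv finite_code)
  show "d \<in> {d. \<exists>p\<in>S. has_cdim_at S p d}" using assms by blast
  show "bdd_above {d. \<exists>p\<in>S. has_cdim_at S p d}"
    by (rule bdd_aboveI [of _ "card (ordered_pairs ord)"])
       (use codim_point_le [OF _ _ ord] assms(1) in \<open>fastforce simp: has_cdim_at_def\<close>)
qed

text \<open>For fixed \<open>i\<close> there are 2m - 2i choices of \<open>j\<close>.\<close>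

lemma card_isotropic_pairs:
  "card {(j, i). 1 \<le> i \<and> i < j \<and> i + j \<le> 2 * m} = m * (m - 1)" for m :: nat
proof -
  have "{(j, i). 1 \<le> i \<and> i < j \<and> i + j \<le> 2 * m} = prod.swap ` (SIGMA i:{1..m}. {i + 1..2 * m - i})"
    by (auto simp: image_iff)
  then have "card {(j, i). 1 \<le> i \<and> i < j \<and> i + j \<le> 2 * m} = (\<Sum>i\<in>{1..m}. 2 * m - 2 * i)"
    by (simp add: card_image mult_2)
  moreover have "(\<Sum>i\<in>{1..m}. 2 * m - 2 * i) + (\<Sum>i\<in>{1..m}. 2 * i) = (\<Sum>i\<in>{1..m}. 2 * m)"
    by (subst sum.distrib [symmetric]) (auto intro!: sum.cong)
  moreover have "(\<Sum>i\<in>{1..m}. 2 * i) = m * (m + 1)"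
    by (induction m) auto
  ultimately show ?thesis by (cases m) (auto simp: algebra_simps)
qed

text \<open>Evaluated at the coordinate flag in \<open>C\<close>: the codimension \<open>c\<close>
  there is at most m(m-1), while \<open>d + c\<close> reaches the dimension of the flag
  manifold.\<close>

lemma cdim_le_of_complementary:
  fixes C :: "('m::finite + 'm) flag set"
  assumes C: "C = flag_orbit K\<^sub>0 V" and sub: "complex_submanifold C"
  shows "cdim (flag_manifold :: ('m + 'm) flag set) \<le> cdim C + CARD('m) * (CARD('m) - 1)"
proof -
  let ?n = "CARD('m + 'm)"
  obtain ord where ord: "bij_betw ord (UNIV :: ('m + 'm) set) {1..?n}" and p: "coord_flag ord \<in> C"
    using base_cycle_contains_coord_flag [OF C sub] .
  have inj: "inj ord" using ord by (simp add: bij_betw_def)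
  note rev = order_reversing_partner [OF ord coord_flag_in_base_cycle_order_reversing [OF C sub inj p]]
  obtain d c where d: "has_cdim_at C (coord_flag ord) d"
    and c: "has_codim_at C (coord_flag ord) c" "has_codim_at {coord_flag ord} (coord_flag ord) (d + c)"
    using sub p unfolding complex_submanifold_def has_cdim_at_def by meson
  have "c \<le> card {(b, a). ord a < ord b \<and> ord a + ord b \<le> ?n}" (is "_ \<le> card ?P")
    by (rule codim_base_cycle_le [OF C p ord rev c(1)])
  also have "card ?P = card (map_prod ord ord ` ?P)"
    using inj by (intro card_image [symmetric]) (auto simp: inj_on_def)
  also have "map_prod ord ord ` ?P \<subseteq> {(j, i). 1 \<le> i \<and> i < j \<and> i + j \<le> 2 * CARD('m)}"
    using bij_betwE [OF ord] by (auto simp: mult_2)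
  then have "card (map_prod ord ord ` ?P) \<le> card {(j, i). 1 \<le> i \<and> i < j \<and> i + j \<le> 2 * CARD('m)}"
    by (rule card_mono [rotated]) (rule finite_subset [of _ "{..2 * CARD('m)} \<times> {..2 * CARD('m)}"], auto)
  also have "\<dots> = CARD('m) * (CARD('m) - 1)" by (rule card_isotropic_pairs)
  finally have "c \<le> CARD('m) * (CARD('m) - 1)" .
  moreover have "card (ordered_pairs ord) \<le> d + c" by (rule codim_coord_flag_ge [OF c(2)])
  moreover have "d \<le> cdim C" using le_cdim [OF _ p d] sub by (simp add: complex_submanifold_def)
  ultimately show ?thesis using cdim_flag_manifold_le [OF ord] by linarith
qed

subsection \<open>Polynomial functions of matrices\<close>

text \<open>Continuity of each directional derivative in the base point keeps a nonzero Jacobian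
  determinant nonzero nearby; \<open>has_codim_at\<close> asks for independence on a whole
  neighbourhood.\<close>

definition C1_holomorphic :: "(complex^'n^('n::finite) \<Rightarrow> complex) \<Rightarrow> (complex^'n^'n \<Rightarrow> complex^'n^'n \<Rightarrow> complex) \<Rightarrow> bool"
  where "C1_holomorphic f f' \<longleftrightarrow> (\<forall>A. (f has_derivative f' A) (at A)) \<and>
    (\<forall>A z H. f' A (mat z ** H) = z * f' A H) \<and> (\<forall>H. continuous_on UNIV (\<lambda>A. f' A H))"

lemma C1_holomorphic_continuous: "C1_holomorphic f f' \<Longrightarrow> continuous_on UNIV f"
  unfolding C1_holomorphic_def by (meson continuous_at_imp_continuous_on has_derivative_continuous)

lemma C1_holomorphic_clinear: "C1_holomorphic f f' \<Longrightarrow> clinear (f' A)"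
  unfolding C1_holomorphic_def clinear_def by (metis has_derivative_linear linear_add)

lemma C1_holomorphic_const: "C1_holomorphic (\<lambda>A. z) (\<lambda>A H. 0)"
  by (simp add: C1_holomorphic_def)

lemma C1_holomorphic_entry: "C1_holomorphic (\<lambda>A. A $ i $ j) (\<lambda>A H. H $ i $ j)"
  unfolding C1_holomorphic_def
  by (auto intro!: bounded_linear_imp_has_derivative
      bounded_linear_compose [OF bounded_linear_vec_nth bounded_linear_vec_nth])

lemma C1_holomorphic_add:
  "C1_holomorphic f f' \<Longrightarrow> C1_holomorphic g g' \<Longrightarrow> C1_holomorphic (\<lambda>A. f A + g A) (\<lambda>A H. f' A H + g' A H)"
  unfolding C1_holomorphic_def by (auto intro!: has_derivative_add continuous_on_add simp: algebra_simps)

lemma C1_holomorphic_mult: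
  assumes f: "C1_holomorphic f f'" and g: "C1_holomorphic g g'"
  shows "C1_holomorphic (\<lambda>A. f A * g A) (\<lambda>A H. f A * g' A H + f' A H * g A)"
  unfolding C1_holomorphic_def
proof (intro conjI allI)
  fix A z H
  show "((\<lambda>A. f A * g A) has_derivative (\<lambda>H. f A * g' A H + f' A H * g A)) (at A)"
    using f g unfolding C1_holomorphic_def by (blast intro: has_derivative_mult)
  show "f A * g' A (mat z ** H) + f' A (mat z ** H) * g A = z * (f A * g' A H + f' A H * g A)"
    using f g by (simp add: C1_holomorphic_def algebra_simps)
  show "continuous_on UNIV (\<lambda>A. f A * g' A H + f' A H * g A)"
    using f g C1_holomorphic_continuous [OF f] C1_holomorphic_continuous [OF g]
    unfolding C1_holomorphic_def by (intro continuous_on_add continuous_on_mult) auto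
qed

lemma C1_holomorphic_sum:
  "(\<And>i. i \<in> I \<Longrightarrow> \<exists>f'. C1_holomorphic (f i) f') \<Longrightarrow> \<exists>f'. C1_holomorphic (\<lambda>A. \<Sum>i\<in>I. f i A) f'"
proof (induction I rule: infinite_finite_induct)
  case (insert i I)
  then obtain f' g' where "C1_holomorphic (f i) f'" "C1_holomorphic (\<lambda>A. \<Sum>i\<in>I. f i A) g'" by blast
  from C1_holomorphic_add [OF this] show ?case using insert.hyps by auto
qed (use C1_holomorphic_const [of 0] in auto)

lemma C1_holomorphic_prod:
  "(\<And>i. i \<in> I \<Longrightarrow> \<exists>f'. C1_holomorphic (f i) f') \<Longrightarrow> \<exists>f'. C1_holomorphic (\<lambda>A. \<Prod>i\<in>I. f i A) f'"
proof (induction I rule: infinite_finite_induct)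
  case (insert i I)
  then obtain f' g' where "C1_holomorphic (f i) f'" "C1_holomorphic (\<lambda>A. \<Prod>i\<in>I. f i A) g'" by blast
  from C1_holomorphic_mult [OF this] show ?case using insert.hyps by auto
qed (use C1_holomorphic_const [of 1] in auto)

lemma C1_holomorphic_det:
  assumes "\<And>i j. \<exists>f'. C1_holomorphic (\<lambda>A. M A $ i $ j) f'"
  shows "\<exists>f'. C1_holomorphic (\<lambda>A. det (M A :: complex^'k^('k::finite))) f'"
  unfolding det_def
proof (rule C1_holomorphic_sum)
  fix p :: "'k \<Rightarrow> 'k"
  obtain g' where "C1_holomorphic (\<lambda>A. \<Prod>i\<in>UNIV. M A $ i $ p i) g'"
    using C1_holomorphic_prod [of UNIV "\<lambda>i A. M A $ i $ p i"] assms by blast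
  from C1_holomorphic_mult [OF C1_holomorphic_const this]
  show "\<exists>f'. C1_holomorphic (\<lambda>A. of_int (sign p) * (\<Prod>i\<in>UNIV. M A $ i $ p i)) f'" by blast
qed

text \<open>Reads off a directional derivative from the values on a line, so that no determinant has
  to be differentiated explicitly.\<close>

lemma C1_holomorphic_directional:
  assumes f: "C1_holomorphic f f'" and line: "\<And>t. f (A + t *\<^sub>R E) = complex_of_real t * \<delta>"
  shows "f' A E = \<delta>"
proof -
  have "((\<lambda>t. f (A + t *\<^sub>R E)) has_derivative (\<lambda>t. f' A (t *\<^sub>R E))) (at 0)"
  proof (rule has_derivative_compose [where g = f])
    show "((\<lambda>t. A + t *\<^sub>R E) has_derivative (\<lambda>t. t *\<^sub>R E)) (at 0)"
      by (auto intro!: derivative_eq_intros)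
    show "(f has_derivative f' A) (at (A + 0 *\<^sub>R E))" using f by (simp add: C1_holomorphic_def)
  qed
  moreover have "((\<lambda>t. f (A + t *\<^sub>R E)) has_derivative (\<lambda>t. complex_of_real t * \<delta>)) (at 0)"
    unfolding line by (auto intro!: derivative_eq_intros)
  ultimately have "(\<lambda>t. f' A (t *\<^sub>R E)) = (\<lambda>t. complex_of_real t * \<delta>)" by (rule has_derivative_unique)
  from fun_cong [OF this, of 1] show ?thesis by simp
qed

text \<open>Padded by the identity outside \<open>I\<close>, so that a determinant over the whole
  index type tests the block on \<open>I\<close>.\<close>

definition jacobian :: "'i set \<Rightarrow> ('i \<Rightarrow> complex^'n^'n \<Rightarrow> complex) \<Rightarrow> ('i \<Rightarrow> complex^'n^('n::finite)) \<Rightarrow> complex^'i^'i" where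
  "jacobian I \<phi> E = (\<chi> i j. if i \<in> I \<and> j \<in> I then \<phi> i (E j) else mat 1 $ i $ j)"

lemma jacobian_surj:
  fixes I :: "'i::finite set"
  assumes \<phi>: "\<And>i. i \<in> I \<Longrightarrow> clinear (\<phi> i)" and nz: "det (jacobian I \<phi> E) \<noteq> 0"
  shows "\<exists>H. \<forall>i\<in>I. \<phi> i H = y i"
proof -
  let ?M = "jacobian I \<phi> E"
  have "surj ((*v) ?M)"
    using nz by (intro image_UNIV_of_inj inj_matrix_vector_mult) (simp add: invertible_det_nz)
  then obtain x where x: "(\<chi> i. y i) = ?M *v x" by (metis surjD)
  have "\<phi> i (\<Sum>j\<in>I. mat (x $ j) ** E j) = y i" if i: "i \<in> I" for i
  proof -
    have "y i = (\<Sum>j\<in>UNIV. ?M $ i $ j * x $ j)"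
      using arg_cong [OF x, of "\<lambda>v. v $ i"] by (simp add: matrix_vector_mult_def)
    also have "\<dots> = (\<Sum>j\<in>UNIV. if j \<in> I then \<phi> i (E j) * x $ j else 0)"
      using i by (intro sum.cong) (auto simp: jacobian_def mat_def)
    also have "\<dots> = (\<Sum>j\<in>I. \<phi> i (E j) * x $ j)" by (simp add: sum.If_cases)
    finally show ?thesis using \<phi> [OF i] by (simp add: clinear_sum clinear_scale mult.commute)
  qed
  then show ?thesis by blast
qed

subsection \<open>Schubert varieties\<close>

definition flag_borel :: "('n \<Rightarrow> nat) \<Rightarrow> (complex^'n^('n::finite)) set" where
  "flag_borel \<pi> = {X. det X = 1 \<and> flag_act X (coord_flag \<pi>) = coord_flag \<pi>}"

definition schubert_variety :: "('n \<Rightarrow> nat) \<Rightarrow> ('n \<Rightarrow> nat) \<Rightarrow> ('n::finite) flag set" where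
  "schubert_variety \<pi> ord = flag_topology closure_of (flag_orbit (flag_borel \<pi>) (coord_flag ord))"

lemma invertible_det_1: "det X = 1 \<Longrightarrow> invertible X" for X :: "complex^'n^('n::finite)"
  by (simp add: invertible_det_nz)

lemma topspace_flag_topology: "topspace flag_topology = (flag_manifold :: ('n::finite) flag set)"
proof -
  have "{X :: complex^'n^'n. invertible X \<and> flag_act X V \<in> flag_manifold} = {X. invertible X}"
    if "V \<in> flag_manifold" for V :: "'n flag" using flag_act_in_manifold [OF that] by blast
  then have "openin flag_topology (flag_manifold :: 'n flag set)"
    by (simp add: openin_flag_topology open_invertible)
  then show ?thesis
    by (metis openin_flag_topology openin_subset openin_topspace subset_antisym)
qed

lemma schubert_variety_subset: "schubert_variety \<pi> ord \<subseteq> flag_manifold"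
  unfolding schubert_variety_def using closure_of_subset_topspace topspace_flag_topology by metis

lemma orbit_subset_schubert_variety:
  assumes "bij_betw ord (UNIV :: 'n::finite set) {1..CARD('n)}"
  shows "flag_orbit (flag_borel \<pi>) (coord_flag ord) \<subseteq> schubert_variety \<pi> (ord :: 'n \<Rightarrow> nat)"
  unfolding schubert_variety_def
  by (rule closure_of_subset)
     (auto simp: topspace_flag_topology flag_orbit_def flag_borel_def invertible_det_1
       intro!: flag_act_in_manifold coord_flag_in_manifold [OF assms])

text \<open>By compactness of the unit sphere of \<open>V k\<close>, the matrices that move one of
  its vectors into \<open>M\<close> form a closed set.\<close>

lemma openin_trivial_intersection:
  fixes M :: "(complex^'n::finite) set"
  assumes M: "vec.subspace M"
  shows "openin flag_topology {V \<in> flag_manifold. V k \<inter> M \<subseteq> {0}}"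
  unfolding openin_flag_topology
proof (intro conjI ballI)
  fix V :: "'n flag" assume V: "V \<in> flag_manifold"
  define K where "K = V k \<inter> sphere 0 1"
  have "closed (V k)" by (intro closed_subspace subspace_of_vec_subspace flag_subspace V)
  then have K: "compact K" unfolding K_def by (intro closed_Int_compact) auto
  have "closed M" by (intro closed_subspace subspace_of_vec_subspace M)
  have lim: "(\<lambda>n. X n *v v n) \<longlonglongrightarrow> X0 *v v0" if "X \<longlonglongrightarrow> X0" "v \<longlonglongrightarrow> v0"
    for X :: "nat \<Rightarrow> complex^'n^'n" and X0 v v0
    by (intro vec_tendstoI) (simp add: matrix_vector_mult_def,
        intro tendsto_sum tendsto_mult tendsto_vec_nth that)
  have "closed {X :: complex^'n^'n. \<exists>v\<in>K. X *v v \<in> M}"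
    unfolding closed_sequential_limits
  proof (intro allI impI)
    fix X :: "nat \<Rightarrow> complex^'n^'n" and X0
    assume "(\<forall>n. X n \<in> {X. \<exists>v\<in>K. X *v v \<in> M}) \<and> X \<longlonglongrightarrow> X0"
    then obtain v where v: "\<And>n. v n \<in> K" "\<And>n. X n *v v n \<in> M" and X: "X \<longlonglongrightarrow> X0" by auto metis
    obtain r v0 where r: "strict_mono (r :: nat \<Rightarrow> nat)" "v0 \<in> K" "(v \<circ> r) \<longlonglongrightarrow> v0"
      using K v(1) unfolding compact_def by metis
    have "(\<lambda>n. X (r n) *v v (r n)) \<longlonglongrightarrow> X0 *v v0"
      using lim [OF LIMSEQ_subseq_LIMSEQ [OF X r(1)] r(3)] by simp
    then have "X0 *v v0 \<in> M" using closed_sequentially [OF \<open>closed M\<close>, of "\<lambda>n. X (r n) *v v (r n)"] v(2) by simp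
    then show "X0 \<in> {X. \<exists>v\<in>K. X *v v \<in> M}" using r(2) by blast
  qed
  then have "open ({X. invertible X} \<inter> - {X :: complex^'n^'n. \<exists>v\<in>K. X *v v \<in> M})"
    by (intro open_Int open_invertible open_Compl)
  also have "{X. invertible X} \<inter> - {X :: complex^'n^'n. \<exists>v\<in>K. X *v v \<in> M}
      = {X. invertible X \<and> flag_act X V \<in> {V \<in> flag_manifold. V k \<inter> M \<subseteq> {0}}}"
  proof (intro equalityI subsetI; clarsimp)
    fix X :: "complex^'n^'n"
    assume X: "invertible X" and *: "\<forall>v\<in>K. X *v v \<notin> M"
    have "X *v v = 0" if v: "v \<in> V k" "X *v v \<in> M" for v
    proof (rule ccontr)
      assume "X *v v \<noteq> 0"
      then have nz: "v \<noteq> 0" by auto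
      let ?c = "complex_of_real (inverse (norm v))"
      have "norm (?c *s v) = 1"
        using nz by (simp add: norm_vec_def norm_mult L2_set_right_distrib [symmetric] norm_inverse)
          (simp add: norm_vec_def [symmetric])
      moreover have "?c *s v \<in> V k" by (intro vec.subspace_scale flag_subspace V v)
      moreover have "X *v (?c *s v) \<in> M"
        using vec.subspace_scale [OF M v(2)] by (simp add: vector_scalar_commute)
      ultimately show False using * by (auto simp: K_def)
    qed
    then show "flag_act X V \<in> flag_manifold \<and> flag_act X V k \<inter> M \<subseteq> {0}"
      using flag_act_in_manifold [OF V X] by (auto simp: flag_act_def)
  next
    fix X :: "complex^'n^'n" and v
    assume X: "invertible X" "flag_act X V k \<inter> M \<subseteq> {0}" and v: "v \<in> K" "X *v v \<in> M"
    have "X *v v = 0" using X(2) v by (auto simp: flag_act_def K_def)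
    then have "v = 0" using inj_matrix_vector_mult [OF X(1)] by (metis injD matrix_vector_mult_0_right)
    then show False using v(1) by (simp add: K_def)
  qed
  finally show "open {X. invertible X \<and> flag_act X V \<in> {V \<in> flag_manifold. V k \<inter> M \<subseteq> {0}}}" .
qed auto

lemma complementary_subspace:
  fixes W :: "(complex^'n::finite) set"
  assumes "vec.subspace W"
  obtains L where "vec.subspace L" "vec.dim L + vec.dim W = CARD('n)" "W \<inter> L \<subseteq> {0}"
proof -
  obtain B where B: "B \<subseteq> W" "vec.independent B" "W \<subseteq> vec.span B" "card B = vec.dim W"
    by (rule vec.basis_exists)
  have WB: "W = vec.span B" using B assms by (metis subset_antisym vec.span_minimal)
  let ?B' = "vec.extend_basis B"
  have B': "B \<subseteq> ?B'" "vec.independent ?B'" "vec.span ?B' = UNIV"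
    using B(2) vec.extend_basis_superset vec.independent_extend_basis vec.span_extend_basis by blast+
  define L where "L = vec.span (?B' - B)"
  have fin: "finite ?B'" using B'(2) vec.finiteI_independent by blast
  have "vec.dim L = card (?B' - B)"
    unfolding L_def by (rule vec.dim_span_eq_card_independent) (rule vec.independent_mono [OF B'(2)], blast)
  moreover have "card ?B' = CARD('n)"
    using vec.dim_span_eq_card_independent [OF B'(2)] by (simp add: B'(3) vec.dim_UNIV card_cart_basis)
  moreover have "card ?B' = card B + card (?B' - B)"
    using fin B'(1) by (metis card_Diff_subset card_mono finite_subset le_add_diff_inverse)
  ultimately have dim: "vec.dim L + vec.dim W = CARD('n)" using B(4) by simp
  have "{x + y |x y. x \<in> W \<and> y \<in> L} = vec.span (B \<union> (?B' - B))"
    unfolding WB L_def vec.span_Un by auto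
  also have "B \<union> (?B' - B) = ?B'" using B'(1) by blast
  finally have "{x + y |x y. x \<in> W \<and> y \<in> L} = UNIV" using B'(3) by simp
  then have "CARD('n) + vec.dim (W \<inter> L) = vec.dim W + vec.dim L"
    using vec.dim_sums_Int [OF assms, of L] by (simp add: L_def vec.dim_UNIV card_cart_basis)
  then have "vec.dim (W \<inter> L) = 0" using dim by linarith
  then show thesis using that [of L] dim by (simp add: L_def vec.dim_eq_0)
qed

text \<open>On the orbit the dimension equals the count. If it dropped at \<open>V\<close>, a
  complement \<open>L\<close> of the smaller intersection would still meet the intersections of
  nearby flags trivially, leaving no room for the larger dimension that they have on the
  orbit.\<close>

lemma schubert_variety_rank:
  fixes ord :: "'n::finite \<Rightarrow> nat"
  assumes V: "V \<in> schubert_variety \<pi> ord"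
  shows "card {c. ord c \<le> k \<and> \<pi> c \<le> l} \<le> vec.dim (V k \<inter> coord_flag \<pi> l)"
proof (rule ccontr)
  let ?E = "coord_flag \<pi> l"
  let ?r = "card {c. ord c \<le> k \<and> \<pi> c \<le> l}"
  assume less: "\<not> ?r \<le> vec.dim (V k \<inter> ?E)"
  have VZ: "V \<in> flag_manifold" using V schubert_variety_subset by blast
  have E: "vec.subspace ?E" by (auto simp: coord_flag_def vec.subspace_def)
  obtain L where L: "vec.subspace L" "vec.dim L + vec.dim (V k \<inter> ?E) = CARD('n)" "(V k \<inter> ?E) \<inter> L \<subseteq> {0}"
    using complementary_subspace [OF vec.subspace_inter [OF flag_subspace [OF VZ] E]] by blast
  let ?U = "{V \<in> flag_manifold. V k \<inter> (?E \<inter> L) \<subseteq> {0}}"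
  have "openin flag_topology ?U" by (intro openin_trivial_intersection vec.subspace_inter E L)
  moreover have "V \<in> ?U" using VZ L(3) by auto
  ultimately obtain V' where V': "V' \<in> flag_orbit (flag_borel \<pi>) (coord_flag ord)" "V' \<in> ?U"
    using V [unfolded schubert_variety_def in_closure_of, THEN conjunct2, rule_format, of ?U] by auto
  then obtain X where X: "det X = 1" "flag_act X (coord_flag \<pi>) = coord_flag \<pi>" "V' = flag_act X (coord_flag ord)"
    by (auto simp: flag_orbit_def flag_borel_def)
  have inj: "inj ((*v) X)" by (intro inj_matrix_vector_mult invertible_det_1 X)
  have "?E = (*v) X ` ?E" using fun_cong [OF X(2), of l] by (simp add: flag_act_def)
  then have "V' k \<inter> ?E = (*v) X ` (coord_flag ord k \<inter> ?E)"
    using inj by (metis X(3) flag_act_def image_Int)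
  then have "vec.dim (V' k \<inter> ?E) = vec.dim (coord_flag ord k \<inter> ?E)" by (simp add: dim_image_inj [OF inj])
  also have "coord_flag ord k \<inter> ?E = {x. \<forall>a. a \<notin> {c. ord c \<le> k \<and> \<pi> c \<le> l} \<longrightarrow> x $ a = 0}"
    by (auto simp: coord_flag_iff not_le)
  also have "vec.dim \<dots> = ?r" by (rule dim_coord_subspace)
  finally have r: "vec.dim (V' k \<inter> ?E) = ?r" .
  have "vec.subspace (V' k \<inter> ?E)" using V'(2) flag_subspace E by (blast intro: vec.subspace_inter)
  note vec.dim_sums_Int [OF this L(1)]
  moreover have "vec.dim ((V' k \<inter> ?E) \<inter> L) = 0" using V'(2) by (auto simp: vec.dim_eq_0 Int_assoc)
  moreover have "vec.dim {x + y |x y. x \<in> V' k \<inter> ?E \<and> y \<in> L} \<le> CARD('n)"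
    using vec.dim_subset [OF subset_UNIV, of "{x + y |x y. x \<in> V' k \<inter> ?E \<and> y \<in> L}"] by (simp only: vec.dim_UNIV card_cart_basis)
  ultimately show False using r less L(2) by linarith
qed

text \<open>Near the coordinate flag \<open>p\<close>, the flag \<open>A p\<close> lies in the cell iff for every \<open>a\<close> the column \<open>A e\<^sub>a\<close> lies in the
  span of the \<open>e\<^sub>j\<close> with \<open>\<pi> j \<le> \<pi> a\<close> and the columns \<open>A e\<^sub>c\<close> with \<open>c\<close> in \<open>earlier_inv a\<close>. By Cramer's rule this is
  the vanishing of the minors \<open>cell_minor (r, a)\<close>.\<close>

definition earlier_inv :: "('n \<Rightarrow> nat) \<Rightarrow> ('n \<Rightarrow> nat) \<Rightarrow> 'n \<Rightarrow> 'n set" where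
  "earlier_inv \<pi> ord a = {c. ord c < ord a \<and> \<pi> a < \<pi> c}"

definition cell_frame :: "('n \<Rightarrow> nat) \<Rightarrow> ('n \<Rightarrow> nat) \<Rightarrow> 'n \<Rightarrow> complex^'n^('n::finite) \<Rightarrow> complex^'n^'n" where
  "cell_frame \<pi> ord a A = (\<chi> i j. if j \<in> earlier_inv \<pi> ord a then A $ i $ j else mat 1 $ i $ j)"

definition cell_minor :: "('n \<Rightarrow> nat) \<Rightarrow> ('n \<Rightarrow> nat) \<Rightarrow> 'n \<times> 'n \<Rightarrow> complex^'n^('n::finite) \<Rightarrow> complex" where
  "cell_minor \<pi> ord = (\<lambda>(r, a) A. det (\<chi> i j. if j = r then A $ i $ a else cell_frame \<pi> ord a A $ i $ j))"

definition noninversions :: "('n \<Rightarrow> nat) \<Rightarrow> ('n \<Rightarrow> nat) \<Rightarrow> ('n \<times> 'n) set" where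
  "noninversions \<pi> ord = {(r, a). \<pi> a < \<pi> r \<and> ord a < ord r}"

lemma cell_frame_holomorphic: "\<exists>f'. C1_holomorphic (\<lambda>A. cell_frame \<pi> ord a A $ i $ j) f'"
  using C1_holomorphic_const C1_holomorphic_entry
  by (cases "j \<in> earlier_inv \<pi> ord a") (auto simp: cell_frame_def)

lemma cell_minor_holomorphic: "\<exists>f'. C1_holomorphic (cell_minor \<pi> ord q) f'"
proof (cases q)
  case (Pair r a)
  show ?thesis unfolding Pair cell_minor_def prod.case
  proof (rule C1_holomorphic_det)
    fix i j
    show "\<exists>f'. C1_holomorphic (\<lambda>A. (\<chi> i j. if j = r then A $ i $ a else cell_frame \<pi> ord a A $ i $ j) $ i $ j) f'"
      using cell_frame_holomorphic [of \<pi> ord a i j] C1_holomorphic_entry [of i a]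
      by (cases "j = r") (simp_all, blast)
  qed
qed

abbreviation unit_matrix :: "'n \<times> 'n \<Rightarrow> complex^'n^('n::finite)" where
  "unit_matrix q \<equiv> (\<chi> i j. if i = fst q \<and> j = snd q then 1 else 0)"

text \<open>At the identity the minors thus have the identity as Jacobian. For \<open>q'\<close> in
  column \<open>a\<close>, the minor is the determinant of the identity with column \<open>r\<close>
  replaced, that is, an entry of the new column; for \<open>q'\<close> in another column, columns
  \<open>r\<close> and \<open>a\<close> coincide.\<close>

lemma cell_minor_line:
  assumes q: "q \<in> noninversions \<pi> ord" and q': "q' \<in> noninversions \<pi> ord"
  shows "cell_minor \<pi> ord q (mat 1 + t *\<^sub>R unit_matrix q') = complex_of_real t * (if q = q' then 1 else 0)"
proof -
  obtain r a where ra: "q = (r, a)" "\<pi> a < \<pi> r" "ord a < ord r" using q by (auto simp: noninversions_def)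
  obtain r' a' where ra': "q' = (r', a')" using q' by (auto simp: noninversions_def)
  have aR: "a \<notin> earlier_inv \<pi> ord a" by (simp add: earlier_inv_def)
  have "a \<noteq> r" using ra by auto
  let ?A = "mat 1 + t *\<^sub>R unit_matrix q' :: complex^'a^'a"
  let ?M = "\<chi> i j. if j = r then ?A $ i $ a else cell_frame \<pi> ord a ?A $ i $ j"
  have A: "?A $ i $ j = (if i = j then 1 else 0) + complex_of_real t * (if i = r' \<and> j = a' then 1 else 0)" for i j
    by (simp add: ra' mat_entry_eq of_real_def)
  have minor: "cell_minor \<pi> ord q ?A = det ?M" by (simp only: cell_minor_def ra(1) prod.case)
  show ?thesis
  proof (cases "a' = a")
    case True
    define x :: "complex^'a" where "x = axis a 1 + axis r' (complex_of_real t)"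
    have "?M = (\<chi> i j. if j = r then (mat 1 *v x) $ i else mat 1 $ i $ j)"
      using True aR unfolding vec_eq_iff vec_lambda_beta cell_frame_def A
      by (auto simp: x_def axis_def mat_entry_eq)
    then have "det ?M = x $ r" using cramer_lemma [of r "mat 1" x] by simp
    then show ?thesis unfolding minor using True ra(1) ra' \<open>a \<noteq> r\<close> by (simp only:) (simp add: x_def axis_def)
  next
    case False
    have "column r ?M = column a ?M"
      using False aR \<open>a \<noteq> r\<close> unfolding vec_eq_iff column_def vec_lambda_beta cell_frame_def A
      by (auto simp: mat_entry_eq)
    with \<open>a \<noteq> r\<close> [symmetric] have "det ?M = 0" by (rule det_identical_columns)
    moreover have "q \<noteq> q'" using False ra(1) ra' by simp
    ultimately show ?thesis unfolding minor by (simp only: if_False mult_zero_right)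
  qed
qed

lemma cell_frame_solution:
  assumes "det (cell_frame \<pi> ord a A) \<noteq> 0"
  shows "cell_frame \<pi> ord a A *v x = column a A \<longleftrightarrow> (\<forall>r. x $ r = cell_minor \<pi> ord (r, a) A / det (cell_frame \<pi> ord a A))"
  unfolding cramer [OF assms] cell_minor_def column_def prod.case vec_lambda_beta by (simp add: vec_eq_iff)

lemma smult_eq_mat: "(mat z ** b) *v x = z *s (b *v x)"
  for b :: "complex^'n^('n::finite)"
  by (simp add: vec_eq_iff matrix_vector_mult_def sum_distrib_left mult_ac)

lemma flag_act_scale:
  fixes V :: "('n::finite) flag"
  assumes V: "V \<in> flag_manifold" and z: "z \<noteq> 0" and b: "invertible b"
  shows "flag_act (mat z ** b) V = flag_act b V"
proof (rule flag_act_eqI [OF V flag_act_in_manifold [OF V b]])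
  have "det (mat z :: complex^'n^'n) \<noteq> 0" using z by (subst det_diagonal) (auto simp: mat_def)
  then show "invertible (mat z ** b)" using b by (simp add: invertible_det_nz det_mul)
  fix k x assume "x \<in> V k"
  then have "b *v x \<in> flag_act b V k" by (simp add: flag_act_def)
  then show "(mat z ** b) *v x \<in> flag_act b V k"
    unfolding smult_eq_mat by (intro vec.subspace_scale flag_subspace flag_act_in_manifold V b)
qed

text \<open>Scalars act trivially on flags, so an n-th root of the inverse determinant normalizes
  \<open>b\<close> to determinant 1.\<close>

lemma triangular_in_borel_orbit:
  fixes b :: "complex^'n^('n::finite)"
  assumes \<pi>: "bij_betw \<pi> (UNIV :: 'n set) {1..CARD('n)}"
    and b: "invertible b" "\<And>a i. \<pi> a < \<pi> i \<Longrightarrow> b $ i $ a = 0" and V: "V \<in> flag_manifold"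
  shows "flag_act b V \<in> flag_orbit (flag_borel \<pi>) V"
proof -
  have E: "coord_flag \<pi> \<in> flag_manifold" by (rule coord_flag_in_manifold [OF \<pi>])
  have "\<forall>k. \<forall>x\<in>coord_flag \<pi> k. b *v x \<in> coord_flag \<pi> k"
    unfolding upper_iff_stabilizes_coord_flag using b(2) by blast
  then have bE: "flag_act b (coord_flag \<pi>) = coord_flag \<pi>"
    by (intro flag_act_eqI E b(1)) blast
  have nz: "det b \<noteq> 0" using b(1) by (simp add: invertible_det_nz)
  define z where "z = exp (Ln (inverse (det b)) / of_nat CARD('n))"
  have "z ^ CARD('n) = inverse (det b)"
    using nz by (simp add: z_def exp_of_nat_mult [symmetric])
  moreover have "det (mat z :: complex^'n^'n) = z ^ CARD('n)"
    by (subst det_diagonal) (auto simp: mat_def)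
  ultimately have "det (mat z ** b) = 1" using nz by (simp add: det_mul)
  moreover have "z \<noteq> 0" by (simp add: z_def)
  ultimately have "mat z ** b \<in> flag_borel \<pi>"
    using bE by (simp add: flag_borel_def flag_act_scale [OF E _ b(1)])
  moreover have "flag_act (mat z ** b) V = flag_act b V" by (rule flag_act_scale [OF V \<open>z \<noteq> 0\<close> b(1)])
  ultimately show ?thesis unfolding flag_orbit_def by (metis imageI)
qed

text \<open>The Cramer coefficients give column operations \<open>s\<close> that make
  \<open>A ** s\<close> triangular in the order \<open>\<pi>\<close>. As \<open>s\<close> is
  unipotent triangular in the order \<open>ord\<close>, it fixes the coordinate flag.\<close>

lemma minors_zero_imp_in_cell:
  fixes A :: "complex^'n^('n::finite)"
  assumes \<pi>: "bij_betw \<pi> (UNIV :: 'n set) {1..CARD('n)}" and ord: "bij_betw ord (UNIV :: 'n set) {1..CARD('n)}"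
    and A: "invertible A" and nz: "\<And>a. det (cell_frame \<pi> ord a A) \<noteq> 0"
    and zero: "\<And>q. q \<in> noninversions \<pi> ord \<Longrightarrow> cell_minor \<pi> ord q A = 0"
  shows "flag_act A (coord_flag ord) \<in> flag_orbit (flag_borel \<pi>) (coord_flag ord)"
proof -
  have P: "coord_flag ord \<in> flag_manifold" by (rule coord_flag_in_manifold [OF ord])
  define x :: "'n \<Rightarrow> complex^'n" where "x a = (\<chi> r. cell_minor \<pi> ord (r, a) A / det (cell_frame \<pi> ord a A))" for a
  have x: "cell_frame \<pi> ord a A *v x a = column a A" for a
    unfolding cell_frame_solution [OF nz] by (simp add: x_def)
  define s :: "complex^'n^'n" where "s = (\<chi> c a. if c = a then 1 else if c \<in> earlier_inv \<pi> ord a then - x a $ c else 0)"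
  have aR: "a \<notin> earlier_inv \<pi> ord a" for a by (simp add: earlier_inv_def)
  have b0: "(A ** s) $ i $ a = 0" if less: "\<pi> a < \<pi> i" for a i
  proof -
    let ?R = "earlier_inv \<pi> ord a"
    have "(A ** s) $ i $ a = (\<Sum>c\<in>UNIV. (if c = a then A $ i $ a else 0) - (if c \<in> ?R then A $ i $ c * x a $ c else 0))"
      unfolding matrix_matrix_mult_def s_def using aR by (auto intro!: sum.cong)
    also have "\<dots> = A $ i $ a - (\<Sum>c\<in>UNIV. if c \<in> ?R then A $ i $ c * x a $ c else 0)"
      by (simp add: sum_subtractf)
    also have "A $ i $ a = (cell_frame \<pi> ord a A *v x a) $ i" by (simp add: x column_def)
    also have "\<dots> = (\<Sum>c\<in>UNIV. (if c \<in> ?R then A $ i $ c * x a $ c else 0) + (if c = i \<and> i \<notin> ?R then x a $ i else 0))"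
      unfolding matrix_vector_mult_def cell_frame_def by (auto simp: mat_def intro!: sum.cong)
    also have "\<dots> = (\<Sum>c\<in>UNIV. if c \<in> ?R then A $ i $ c * x a $ c else 0) + (if i \<notin> ?R then x a $ i else 0)"
      by (cases "i \<in> ?R") (simp_all add: sum.distrib)
    finally have "(A ** s) $ i $ a = (if i \<notin> ?R then x a $ i else 0)" by simp
    moreover have "x a $ i = 0" if "i \<notin> ?R"
    proof -
      have "ord i \<noteq> ord a" using less ord by (auto simp: bij_betw_def dest: injD)
      then have "(i, a) \<in> noninversions \<pi> ord"
        using that less by (auto simp: noninversions_def earlier_inv_def)
      then show ?thesis using zero by (simp add: x_def)
    qed
    ultimately show ?thesis by simp
  qed
  have s0: "s $ c $ a = 0" if "ord a < ord c" for a c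
    using that by (auto simp: s_def earlier_inv_def)
  \<comment> \<open>\<open>s\<close> reproduces the coordinate of highest \<open>ord\<close> of any
    vector, so a kernel vector cannot have one.\<close>
  have "y = 0" if y: "s *v y = 0" for y
  proof (rule ccontr)
    assume "y \<noteq> 0"
    then have ne: "{a. y $ a \<noteq> 0} \<noteq> {}" by (auto simp: vec_eq_iff)
    then obtain a where a: "y $ a \<noteq> 0" "\<And>c. y $ c \<noteq> 0 \<Longrightarrow> ord c \<le> ord a"
    proof -
      have "Max (ord ` {a. y $ a \<noteq> 0}) \<in> ord ` {a. y $ a \<noteq> 0}" using ne by (intro Max_in) auto
      then obtain a where "y $ a \<noteq> 0" "Max (ord ` {a. y $ a \<noteq> 0}) = ord a" by blast
      moreover have "ord c \<le> Max (ord ` {a. y $ a \<noteq> 0})" if "y $ c \<noteq> 0" for c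
        using that by (intro Max_ge) auto
      ultimately show thesis using that [of a] by simp
    qed
    have "(s *v y) $ a = (\<Sum>c\<in>UNIV. if c = a then y $ a else 0)"
      unfolding matrix_vector_mult_def vec_lambda_beta
    proof (rule sum.cong [OF refl])
      fix c
      show "s $ a $ c * y $ c = (if c = a then y $ a else 0)"
      proof (cases "c = a \<or> y $ c = 0")
        case False
        then have "ord c \<le> ord a" "ord c \<noteq> ord a" using a(2) ord by (auto simp: bij_betw_def dest: injD)
        then show ?thesis using s0 [of c a] False by simp
      qed (use a in \<open>auto simp: s_def\<close>)
    qed
    then show False using y a(1) by simp
  qed
  then have s: "invertible s"
    by (metis (no_types, lifting) injI invertible_left_inverse matrix_left_invertible_injective matrix_vector_mult_diff_distrib right_minus_eq)
  have "\<forall>k. \<forall>y\<in>coord_flag ord k. s *v y \<in> coord_flag ord k"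
    unfolding upper_iff_stabilizes_coord_flag using s0 by blast
  then have "flag_act s (coord_flag ord) = coord_flag ord" by (intro flag_act_eqI P s) blast
  then have "flag_act A (coord_flag ord) = flag_act (A ** s) (coord_flag ord)" by (simp add: flag_act_mult)
  moreover have "invertible (A ** s)" using A s by (rule invertible_mult)
  ultimately show ?thesis using triangular_in_borel_orbit [OF \<pi> _ b0 P] by metis
qed

text \<open>The rank condition at \<open>ord a\<close> and \<open>\<pi> a\<close> caps the dimension
  of \<open>?WE\<close> by that of \<open>?Y\<close>; the invertible frame maps \<open>?Y\<close>
  into \<open>?WE\<close>, hence onto it. So column \<open>a\<close> of \<open>A\<close> has a
  preimage supported in \<open>?Y\<close>, and its uniqueness kills the Cramer numerator at
  \<open>r\<close>, an index outside that support.\<close>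

lemma in_schubert_imp_minors_zero:
  fixes A :: "complex^'n^('n::finite)"
  assumes \<pi>: "bij_betw \<pi> (UNIV :: 'n set) {1..CARD('n)}" and ord: "bij_betw ord (UNIV :: 'n set) {1..CARD('n)}"
    and A: "invertible A" and nz: "\<And>a. det (cell_frame \<pi> ord a A) \<noteq> 0"
    and S: "flag_act A (coord_flag ord) \<in> schubert_variety \<pi> ord" and q: "q \<in> noninversions \<pi> ord"
  shows "cell_minor \<pi> ord q A = 0"
proof -
  obtain r a where ra: "q = (r, a)" "\<pi> a < \<pi> r" "ord a < ord r" using q by (auto simp: noninversions_def)
  let ?R = "earlier_inv \<pi> ord a" and ?M = "cell_frame \<pi> ord a A"
  let ?W = "flag_act A (coord_flag ord) (ord a)" and ?E = "coord_flag \<pi> (\<pi> a)"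
  have oa: "1 \<le> ord a" "ord a \<le> CARD('n)" "\<pi> a \<le> CARD('n)" using bij_betwE [OF ord] bij_betwE [OF \<pi>] by auto
  have Z: "flag_act A (coord_flag ord) \<in> flag_manifold" "coord_flag \<pi> \<in> flag_manifold"
    using flag_act_in_manifold coord_flag_in_manifold \<pi> ord A by blast+
  have W: "vec.subspace ?W" "vec.dim ?W = ord a" and E: "vec.subspace ?E" "vec.dim ?E = \<pi> a"
    using flag_subspace [OF Z(1)] flag_subspace [OF Z(2)] flag_dim [OF Z(1)] flag_dim [OF Z(2)] oa by simp_all
  let ?WE = "{x + y |x y. x \<in> ?W \<and> y \<in> ?E}"
  have "{c. ord c \<le> ord a} = {c. ord c \<le> ord a \<and> \<pi> c \<le> \<pi> a} \<union> ?R"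
  proof -
    have "x = a" if "ord x = ord a" for x using that ord by (auto simp: bij_betw_def dest: injD)
    then show ?thesis by (force simp: earlier_inv_def not_le)
  qed
  moreover have "{c. ord c \<le> ord a \<and> \<pi> c \<le> \<pi> a} \<inter> ?R = {}" by (auto simp: earlier_inv_def)
  ultimately have "ord a = card {c. ord c \<le> ord a \<and> \<pi> c \<le> \<pi> a} + card ?R"
    using card_ord_le [OF ord oa(2)] by (metis card_Un_disjoint finite_code)
  moreover have "card {c. ord c \<le> ord a \<and> \<pi> c \<le> \<pi> a} \<le> vec.dim (?W \<inter> ?E)"
    by (rule schubert_variety_rank [OF S])
  ultimately have dimWE: "vec.dim ?WE \<le> \<pi> a + card ?R"
    using vec.dim_sums_Int [OF W(1) E(1)] W(2) E(2) by linarith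
  let ?Y = "{y :: complex^'n. \<forall>j. j \<notin> {j. \<pi> j \<le> \<pi> a} \<union> ?R \<longrightarrow> y $ j = 0}"
  have "card ({j. \<pi> j \<le> \<pi> a} \<union> ?R) = \<pi> a + card ?R"
    using card_ord_le [OF \<pi> oa(3)] by (subst card_Un_disjoint) (auto simp: earlier_inv_def)
  then have dimY: "vec.dim ?Y = \<pi> a + card ?R" by (simp only: dim_coord_subspace)
  have inj: "inj ((*v) ?M)" using nz by (intro inj_matrix_vector_mult) (simp add: invertible_det_nz)
  have subWE: "vec.subspace ?WE" by (rule vec.subspace_sums [OF W(1) E(1)])
  have subY: "vec.subspace ?Y" by (auto simp: vec.subspace_def)
  have colW: "column c A \<in> ?W" if "ord c \<le> ord a" for c
  proof -
    have "column c A = A *v axis c 1"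
      by (simp add: vec_eq_iff column_def matrix_vector_mult_def axis_def if_distrib [where f = "\<lambda>x. _ * x"] cong: if_cong)
    moreover have "axis c 1 \<in> coord_flag ord (ord a)" using that by (auto simp: coord_flag_iff axis_def)
    ultimately show ?thesis by (auto simp: flag_act_def)
  qed
  have "(*v) ?M ` ?Y = ?WE"
  proof (rule vec.subspace_dim_equal [OF _ subWE])
    show "vec.subspace ((*v) ?M ` ?Y)"
      by (rule vec.linear_subspace_image [OF matrix_vector_mul_linear_gen subY])
    show "vec.dim ?WE \<le> vec.dim ((*v) ?M ` ?Y)" using dimWE dimY by (simp add: dim_image_inj [OF inj])
    show "(*v) ?M ` ?Y \<subseteq> ?WE"
    proof clarify
      fix y :: "complex^'n" assume y: "\<forall>j. j \<notin> {j. \<pi> j \<le> \<pi> a} \<union> ?R \<longrightarrow> y $ j = 0"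
      have "?M *v y \<in> ?WE"
      proof (rule matrix_vector_in_subspace [OF subWE])
        fix j assume "y $ j \<noteq> 0"
        then consider "j \<in> ?R" | "\<pi> j \<le> \<pi> a" "j \<notin> ?R" using y by auto
        then show "column j ?M \<in> ?WE"
        proof cases
          case 1
          then have "column j ?M = column j A + 0" by (simp add: column_def cell_frame_def vec_eq_iff)
          moreover have "column j A \<in> ?W" using colW 1 by (simp add: earlier_inv_def)
          moreover have "0 \<in> ?E" by (simp add: coord_flag_iff)
          ultimately show ?thesis by blast
        next
          case 2
          then have "column j ?M = 0 + axis j 1" by (auto simp: column_def cell_frame_def vec_eq_iff mat_def axis_def)
          moreover have "axis j 1 \<in> ?E" using 2 by (auto simp: coord_flag_iff axis_def)
          moreover have "0 \<in> ?W" by (rule vec.subspace_0 [OF W(1)])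
          ultimately show ?thesis by blast
        qed
      qed
      then show "\<exists>x' y'. ?M *v y = x' + y' \<and> x' \<in> ?W \<and> y' \<in> ?E" by blast
    qed
  qed
  moreover have "column a A \<in> ?WE"
  proof -
    have "column a A = column a A + 0" "0 \<in> ?E" by (simp_all add: coord_flag_iff)
    then show ?thesis using colW [of a] by blast
  qed
  ultimately obtain y where y: "?M *v y = column a A" "y \<in> ?Y" by (metis (no_types, lifting) imageE)
  have "y $ r = 0" using y(2) ra by (auto simp: earlier_inv_def)
  then have "cell_minor \<pi> ord (r, a) A / det ?M = 0" using y(1) cell_frame_solution [OF nz] by metis
  then show ?thesis using nz ra(1) by simp
qed

text \<open>Near the coordinate flag the closure adds nothing to the cell: rank conditions force the
  minors to vanish, and vanishing minors put the flag in the orbit. On \<open>U\<close> all frames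
  and the Jacobian stay invertible.\<close>

lemma schubert_variety_codim:
  fixes ord :: "'n::finite \<Rightarrow> nat"
  assumes \<pi>: "bij_betw \<pi> (UNIV :: 'n set) {1..CARD('n)}" and ord: "bij_betw ord (UNIV :: 'n set) {1..CARD('n)}"
  shows "has_codim_at (schubert_variety \<pi> ord) (coord_flag ord) (card (noninversions \<pi> ord))"
proof -
  let ?I = "noninversions \<pi> ord" and ?p = "coord_flag ord"
  have "\<forall>q. \<exists>f'. C1_holomorphic (cell_minor \<pi> ord q) f'" using cell_minor_holomorphic by blast
  then obtain f' where f': "\<And>q. C1_holomorphic (cell_minor \<pi> ord q) (f' q)" unfolding choice_iff by blast
  have d1: "f' q (mat 1) (unit_matrix q') = (if q = q' then 1 else 0)" if "q \<in> ?I" "q' \<in> ?I" for q q'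
    by (rule C1_holomorphic_directional [OF f' cell_minor_line [OF that]])
  define U where "U = {A. invertible A} \<inter> (\<Inter>a\<in>UNIV. {A. det (cell_frame \<pi> ord a A) \<noteq> 0}) \<inter>
    {A. det (jacobian ?I (\<lambda>q. f' q A) unit_matrix) \<noteq> 0}"
  have fin: "finite ?I" by simp
  have "open U" unfolding U_def
  proof (intro open_Int open_INT ballI open_invertible finite)
    fix a
    obtain g where "C1_holomorphic (\<lambda>A. det (cell_frame \<pi> ord a A)) g"
      using C1_holomorphic_det [OF cell_frame_holomorphic] by blast
    then show "open {A. det (cell_frame \<pi> ord a A) \<noteq> 0}"
      by (intro open_Collect_neq continuous_on_const) (rule C1_holomorphic_continuous)
  next
    have "continuous_on UNIV (\<lambda>A. if q \<in> ?I \<and> q' \<in> ?I then f' q A (unit_matrix q') else mat 1 $ q $ q')" for q q'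
      using f' by (cases "q \<in> ?I \<and> q' \<in> ?I") (auto simp: C1_holomorphic_def)
    then show "open {A. det (jacobian ?I (\<lambda>q. f' q A) unit_matrix) \<noteq> 0}"
      unfolding det_def jacobian_def vec_lambda_beta
      by (intro open_Collect_neq continuous_intros)
  qed
  have "cell_frame \<pi> ord a (mat 1) = mat 1" for a by (simp add: cell_frame_def vec_eq_iff)
  moreover have "jacobian ?I (\<lambda>q. f' q (mat 1)) unit_matrix = mat 1"
    using d1 by (auto simp: jacobian_def vec_eq_iff mat_entry_eq)
  ultimately have "mat 1 \<in> U" by (simp add: U_def invertible_det_nz)
  have nz: "det (cell_frame \<pi> ord a A) \<noteq> 0" if "A \<in> U" for A a using that by (auto simp: U_def)
  have inv: "invertible A" if "A \<in> U" for A using that by (auto simp: U_def)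
  have "?p = flag_act (mat 1) ?p" by simp
  moreover have "mat 1 \<in> flag_borel \<pi>" by (simp add: flag_borel_def)
  ultimately have "?p \<in> flag_orbit (flag_borel \<pi>) ?p" unfolding flag_orbit_def by blast
  then have p: "?p \<in> schubert_variety \<pi> ord" using orbit_subset_schubert_variety [OF ord] by blast
  show ?thesis
  proof (rule has_codim_atI [OF fin p \<open>open U\<close> \<open>mat 1 \<in> U\<close> inv, where f = "cell_minor \<pi> ord" and f' = "\<lambda>A q. f' q A"])
    show "(cell_minor \<pi> ord q has_derivative f' q A) (at A)" for A q
      using f' by (simp add: C1_holomorphic_def)
    show "f' q A (mat z ** H) = z * f' q A H" for A q z H
      using f' by (simp add: C1_holomorphic_def)
    show "\<exists>H. \<forall>q\<in>?I. f' q A H = y q" if "A \<in> U" for A and y :: "'n \<times> 'n \<Rightarrow> complex"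
      by (rule jacobian_surj [OF C1_holomorphic_clinear [OF f'], where E = unit_matrix])
         (use that in \<open>auto simp: U_def\<close>)
    show "flag_act A ?p \<in> schubert_variety \<pi> ord \<longleftrightarrow> (\<forall>q\<in>?I. cell_minor \<pi> ord q A = 0)" if A: "A \<in> U" for A
      using in_schubert_imp_minors_zero [OF \<pi> ord inv [OF A] nz [OF A]]
        minors_zero_imp_in_cell [OF \<pi> ord inv [OF A] nz [OF A]] orbit_subset_schubert_variety [OF ord] by blast
  qed
qed

lemma cdim_schubert_variety_ge:
  fixes ord :: "'n::finite \<Rightarrow> nat"
  assumes \<pi>: "bij_betw \<pi> (UNIV :: 'n set) {1..CARD('n)}" and ord: "bij_betw ord (UNIV :: 'n set) {1..CARD('n)}"
  shows "card {(r, a). \<pi> r < \<pi> a \<and> ord a < ord r} \<le> cdim (schubert_variety \<pi> ord)"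
proof (rule le_cdim [OF schubert_variety_subset])
  let ?J = "{(r, a). \<pi> r < \<pi> a \<and> ord a < ord r}" and ?I = "noninversions \<pi> ord"
  have "\<pi> r \<noteq> \<pi> a" if "ord a < ord r" for a r using that \<pi> by (auto simp: bij_betw_def dest: injD)
  then have "ordered_pairs ord = ?J \<union> ?I" by (auto simp: noninversions_def) (metis linorder_neqE_nat)
  moreover have "?J \<inter> ?I = {}" by (auto simp: noninversions_def)
  ultimately have "card (ordered_pairs ord) = card ?J + card ?I" by (simp add: card_Un_disjoint)
  then have "has_codim_at {coord_flag ord} (coord_flag ord) (card ?J + card ?I)"
    using has_codim_coord_flag [OF ord] by simp
  then show "has_cdim_at (schubert_variety \<pi> ord) (coord_flag ord) (card ?J)"
    using schubert_variety_codim [OF \<pi> ord] unfolding has_cdim_at_def by blast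
  show "coord_flag ord \<in> schubert_variety \<pi> ord"
    using schubert_variety_codim [OF \<pi> ord] by (simp add: has_codim_at_def)
qed

subsection \<open>Inversions of self-dual words\<close>

lemma block_le_iff: "(x + 1) div 2 \<le> i \<longleftrightarrow> x \<le> 2 * i" for x i :: nat
  by linarith

lemma card_filter_le_add:
  fixes f :: "'a \<Rightarrow> nat"
  assumes "finite A"
  shows "card {a \<in> A. f a \<le> y} + card {a \<in> A. y < f a} = card A"
proof -
  have "card ({a \<in> A. f a \<le> y} \<union> {a \<in> A. y < f a}) = card {a \<in> A. f a \<le> y} + card {a \<in> A. y < f a}"
    by (rule card_Un_disjoint) (use assms in auto)
  moreover have "{a \<in> A. f a \<le> y} \<union> {a \<in> A. y < f a} = A" by auto
  ultimately show ?thesis by simp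
qed

text \<open>If \<open>f\<close> misses \<open>y\<close>, then \<open>f a \<le> y\<close> means
  \<open>f a < y\<close>, and \<open>dom\<close> is applied at the predecessor of \<open>y\<close>;
  if \<open>g\<close> misses it, at \<open>y\<close> itself.\<close>

lemma dominance_count:
  fixes f g :: "'a \<Rightarrow> nat"
  assumes "finite A" and dom: "\<And>y. card {a \<in> A. f a \<le> y} \<le> card {a \<in> A. g a \<le> y}"
    and once: "(\<forall>a\<in>A. f a \<noteq> y) \<or> (\<forall>a\<in>A. g a \<noteq> y)"
  shows "card A \<le> card {a \<in> A. y < f a} + card {a \<in> A. g a < y}"
  using once
proof
  assume f: "\<forall>a\<in>A. f a \<noteq> y"
  show ?thesis
  proof (cases y)
    case 0
    then have "{a \<in> A. y < f a} = A" using f by auto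
    then show ?thesis by simp
  next
    case (Suc z)
    then have eq: "{a \<in> A. f a \<le> y} = {a \<in> A. f a \<le> z}" "{a \<in> A. g a < y} = {a \<in> A. g a \<le> z}"
      using f by (auto simp: le_Suc_eq less_Suc_eq_le)
    show ?thesis using card_filter_le_add [OF \<open>finite A\<close>, of f y] dom [of z] unfolding eq by linarith
  qed
next
  assume "\<forall>a\<in>A. g a \<noteq> y"
  then have "{a \<in> A. g a \<le> y} = {a \<in> A. g a < y}" by (auto simp: le_less)
  then show ?thesis using card_filter_le_add [OF \<open>finite A\<close>, of f y] dom [of y] by simp
qed

text \<open>\<open>balanced\<close> is what isotropy leaves on ranks: the reference space of
  dimension \<open>2 * i\<close> is j-invariant, and the members \<open>k\<close> and
  \<open>2 * m - k\<close> of the flag meet it in mutually orthogonal subspaces. Only unions of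
  whole blocks {2i-1, 2i} of letters are visible to it.\<close>

locale self_dual_word =
  fixes m :: nat and w :: "nat \<Rightarrow> nat"
  assumes w: "w permutes {1..2 * m}"
    and balanced: "\<And>k i. k \<le> 2 * m \<Longrightarrow> i \<le> m \<Longrightarrow>
      card {a \<in> {1..k}. w a \<le> 2 * i} + card {a \<in> {1..2 * m - k}. w a \<le> 2 * i} \<le> 2 * i"
begin

abbreviation dual :: "nat \<Rightarrow> nat" where "dual a \<equiv> 2 * m + 1 - a"

text \<open>The number of the block {2i-1, 2i} containing the letter; \<open>right\<close> is the
  same at the mirror position.\<close>

definition left :: "nat \<Rightarrow> nat" where "left a = (w a + 1) div 2"
definition right :: "nat \<Rightarrow> nat" where "right a = (w (dual a) + 1) div 2"

lemma w_range: "a \<in> {1..2 * m} \<Longrightarrow> w a \<in> {1..2 * m}"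
  using permutes_in_image [OF w] by blast

lemma w_inj: "w a = w b \<longleftrightarrow> a = b"
  using permutes_inj [OF w] by (auto dest: injD)

lemma card_w_le: "i \<le> m \<Longrightarrow> card {a \<in> {1..2 * m}. w a \<le> 2 * i} = 2 * i"
proof -
  assume i: "i \<le> m"
  have "bij_betw w {a \<in> {1..2 * m}. w a \<le> 2 * i} {1..2 * i}"
  proof (rule bij_betw_imageI)
    show "inj_on w {a \<in> {1..2 * m}. w a \<le> 2 * i}" using w_inj by (auto simp: inj_on_def)
    show "w ` {a \<in> {1..2 * m}. w a \<le> 2 * i} = {1..2 * i}"
    proof (intro equalityI subsetI)
      fix y assume y: "y \<in> {1..2 * i}"
      then have "y \<in> w ` {1..2 * m}" using i permutes_image [OF w] by auto
      then show "y \<in> w ` {a \<in> {1..2 * m}. w a \<le> 2 * i}" using y by auto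
    qed (use w_range in auto)
  qed
  then show ?thesis by (auto dest: bij_betw_same_card)
qed

lemma card_split:
  assumes "k \<le> 2 * m"
  shows "card {a \<in> {1..2 * m}. w a \<le> l} = card {a \<in> {1..2 * m - k}. w a \<le> l} + card {a \<in> {1..k}. w (dual a) \<le> l}"
proof -
  have "{a \<in> {1..2 * m}. w a \<le> l} = {a \<in> {1..2 * m - k}. w a \<le> l} \<union> dual ` {a \<in> {1..k}. w (dual a) \<le> l}"
  proof (intro equalityI subsetI)
    fix b assume b: "b \<in> {a \<in> {1..2 * m}. w a \<le> l}"
    show "b \<in> {a \<in> {1..2 * m - k}. w a \<le> l} \<union> dual ` {a \<in> {1..k}. w (dual a) \<le> l}"
    proof (cases "b \<le> 2 * m - k")
      case False
      have "b = dual (dual b)" using b by auto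
      moreover have "dual b \<in> {a \<in> {1..k}. w (dual a) \<le> l}" using b False by auto
      ultimately show ?thesis by blast
    qed (use b in auto)
  qed (use assms in auto)
  moreover have "card (dual ` {a \<in> {1..k}. w (dual a) \<le> l}) = card {a \<in> {1..k}. w (dual a) \<le> l}"
    using assms by (intro card_image) (auto simp: inj_on_def)
  moreover have "{a \<in> {1..2 * m - k}. w a \<le> l} \<inter> dual ` {a \<in> {1..k}. w (dual a) \<le> l} = {}"
    using assms by auto
  ultimately show ?thesis by (simp add: card_Un_disjoint)
qed

text \<open>Of the \<open>2 * y\<close> letters in the first \<open>y\<close> blocks, those not at
  the first \<open>2 * m - k\<close> positions sit at the last \<open>k\<close>;
  \<open>balanced\<close> says that the first \<open>k\<close> positions carry no more of
  them.\<close>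

lemma left_dominates:
  assumes k: "k \<le> m"
  shows "card {a \<in> {1..k}. left a \<le> y} \<le> card {a \<in> {1..k}. right a \<le> y}"
proof (cases "y \<le> m")
  case True
  then show ?thesis
    using balanced [of k y] card_split [of k "2 * y"] card_w_le [OF True] k
    unfolding left_def right_def block_le_iff by linarith
next
  case False
  have "right a \<le> y" if "a \<in> {1..k}" for a
  proof -
    have "w (dual a) \<in> {1..2 * m}" using that k by (intro w_range) auto
    then show ?thesis unfolding right_def block_le_iff using False by simp
  qed
  then have "{a \<in> {1..k}. right a \<le> y} = {1..k}" by auto
  moreover have "card {a \<in> {1..k}. left a \<le> y} \<le> card {1..k}" by (rule card_mono) auto
  ultimately show ?thesis by (simp only:)
qed

lemma block_no_three:
  assumes "(w p + 1) div 2 = (w q + 1) div 2" "(w p + 1) div 2 = (w r + 1) div 2" "p \<noteq> q" "p \<noteq> r" "q \<noteq> r"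
  shows False
proof -
  have "w p \<noteq> w q" "w p \<noteq> w r" "w q \<noteq> w r" using assms w_inj by auto
  moreover have "x + 1 = 2 * ((x + 1) div 2) \<or> x + 1 = 2 * ((x + 1) div 2) + 1" for x :: nat by presburger
  ultimately show False using assms(1,2) by (metis add_right_cancel)
qed

definition inversions :: "(nat \<times> nat) set" where
  "inversions = {(p, q). p \<in> {1..2 * m} \<and> q \<in> {1..2 * m} \<and> p < q \<and> w q < w p}"

text \<open>The word is peeled from both ends: an inversion belongs to the layer of whichever member
  lies deeper inside, at \<open>k\<close> or at \<open>dual k\<close>.\<close>

definition layer :: "nat \<Rightarrow> (nat \<times> nat) set" where
  "layer k = {(p, q) \<in> inversions. max (min p (dual p)) (min q (dual q)) = k}"

lemma finite_inversions: "finite inversions"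
  by (rule finite_subset [of _ "{1..2 * m} \<times> {1..2 * m}"]) (auto simp: inversions_def)

text \<open>For \<open>a < k\<close> each of the positions \<open>k\<close> and \<open>dual k\<close> is inverted with \<open>a\<close> or \<open>dual a\<close> at least \<open>k - 1\<close> times in total.\<close>

lemma card_layer_ge:
  assumes k: "k \<in> {1..m}"
  shows "2 * (k - 1) + (if w (dual k) < w k then 1 else 0) \<le> card (layer k)"
proof -
  let ?A = "{1..k - 1}"
  \<comment> \<open>\<open>?A1\<close> and \<open>?A2\<close> are inversions of position
    \<open>k\<close> with outer positions on the left and on the right, \<open>?A3\<close> and
    \<open>?A4\<close> those of \<open>dual k\<close>, \<open>?A5\<close> the pair of both.
    Comparing blocks instead of letters loses inversions within a block but makes
    \<open>dominance_count\<close> applicable.\<close>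
  let ?A1 = "(\<lambda>a. (a, k)) ` {a \<in> ?A. left k < left a}"
  let ?A2 = "(\<lambda>a. (k, dual a)) ` {a \<in> ?A. right a < left k}"
  let ?A3 = "(\<lambda>a. (a, dual k)) ` {a \<in> ?A. right k < left a}"
  let ?A4 = "(\<lambda>a. (dual k, dual a)) ` {a \<in> ?A. right a < right k}"
  let ?A5 = "if w (dual k) < w k then {(k, dual k)} else {}"
  have lt: "(x + 1) div 2 < (y + 1) div 2 \<Longrightarrow> x < y" for x y :: nat by linarith
  have sub: "?A1 \<union> (?A2 \<union> (?A3 \<union> (?A4 \<union> ?A5))) \<subseteq> layer k"
  proof (intro Un_least)
    have mn: "min a (dual a) = a" "min (dual a) (dual (dual a)) = a" if "a \<in> {1..m}" for a
      using that by auto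
    have layerI: "(p, q) \<in> layer k"
      if "p \<in> {1..2 * m}" "q \<in> {1..2 * m}" "p < q" "w q < w p" "min p (dual p) = c" "min q (dual q) = d" "max c d = k"
      for p q c d using that by (simp add: layer_def inversions_def)
    have a: "a \<in> {1..m}" "a < k" if "a \<in> ?A" for a using that k by auto
    show "?A1 \<subseteq> layer k"
    proof clarify
      fix a assume *: "a \<in> ?A" "left k < left a"
      have "w k < w a" by (rule lt) (use *(2) in \<open>simp add: left_def\<close>)
      then show "(a, k) \<in> layer k" using a [OF *(1)] k by (intro layerI [OF _ _ _ _ mn(1) mn(1)]) auto
    qed
    show "?A2 \<subseteq> layer k"
    proof clarify
      fix a assume *: "a \<in> ?A" "right a < left k"
      have "w (dual a) < w k" by (rule lt) (use *(2) in \<open>simp add: left_def right_def\<close>)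
      then show "(k, dual a) \<in> layer k" using a [OF *(1)] k by (intro layerI [OF _ _ _ _ mn(1) mn(2)]) auto
    qed
    show "?A3 \<subseteq> layer k"
    proof clarify
      fix a assume *: "a \<in> ?A" "right k < left a"
      have "w (dual k) < w a" by (rule lt) (use *(2) in \<open>simp add: left_def right_def\<close>)
      then show "(a, dual k) \<in> layer k" using a [OF *(1)] k by (intro layerI [OF _ _ _ _ mn(1) mn(2)]) auto
    qed
    show "?A4 \<subseteq> layer k"
    proof clarify
      fix a assume *: "a \<in> ?A" "right a < right k"
      have "w (dual a) < w (dual k)" by (rule lt) (use *(2) in \<open>simp add: right_def\<close>)
      then show "(dual k, dual a) \<in> layer k" using a [OF *(1)] k by (intro layerI [OF _ _ _ _ mn(2) mn(2)]) auto
    qed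
    show "?A5 \<subseteq> layer k"
    proof (cases "w (dual k) < w k")
      case True
      then have "(k, dual k) \<in> layer k" using k by (intro layerI [OF _ _ _ _ mn(1) mn(2)]) auto
      then show ?thesis using True by simp
    qed simp
  qed
  have dom: "card {a \<in> ?A. left a \<le> y} \<le> card {a \<in> ?A. right a \<le> y}" for y
    using left_dominates [of "k - 1" y] k by auto
  \<comment> \<open>Otherwise the letters at \<open>c\<close>, \<open>a\<close> and
    \<open>dual b\<close> would share one block of two letters.\<close>
  have once: "(\<forall>a\<in>?A. left a \<noteq> (w c + 1) div 2) \<or> (\<forall>a\<in>?A. right a \<noteq> (w c + 1) div 2)"
    if "c = k \<or> c = dual k" for c
  proof (rule ccontr)
    assume "\<not> ?thesis"
    then obtain a b where ab: "a \<in> ?A" "b \<in> ?A" "left a = (w c + 1) div 2" "right b = (w c + 1) div 2" by blast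
    show False
      by (rule block_no_three [of c a "dual b"]) (use ab that k in \<open>auto simp: left_def right_def\<close>)
  qed
  have "k - 1 \<le> card {a \<in> ?A. left k < left a} + card {a \<in> ?A. right a < left k}"
    using dominance_count [OF _ dom once [of k, folded left_def]] by simp
  moreover have "k - 1 \<le> card {a \<in> ?A. right k < left a} + card {a \<in> ?A. right a < right k}"
    using dominance_count [OF _ dom once [of "dual k", folded right_def]] by simp
  moreover have "card ?A1 = card {a \<in> ?A. left k < left a}" "card ?A2 = card {a \<in> ?A. right a < left k}"
    "card ?A3 = card {a \<in> ?A. right k < left a}" "card ?A4 = card {a \<in> ?A. right a < right k}"
    using k by (auto intro!: card_image simp: inj_on_def)
  moreover have "card (?A1 \<union> (?A2 \<union> (?A3 \<union> (?A4 \<union> ?A5)))) = card ?A1 + (card ?A2 + (card ?A3 + (card ?A4 + card ?A5)))"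
  proof -
    have gen: "card (B1 \<union> (B2 \<union> (B3 \<union> (B4 \<union> B5)))) = card B1 + (card B2 + (card B3 + (card B4 + card B5)))"
      if fin: "finite B1" "finite B2" "finite B3" "finite B4" "finite B5"
        and B: "B1 \<subseteq> {(p, q). p < k \<and> q = k}" "B2 \<subseteq> {(p, q). p = k \<and> dual k < q}"
          "B3 \<subseteq> {(p, q). p < k \<and> k < q}" "B4 \<subseteq> {(p, q). k < p}" "B5 \<subseteq> {(p, q). p = k \<and> q = dual k}"
      for B1 B2 B3 B4 B5 :: "(nat \<times> nat) set"
    proof -
      have "B1 \<inter> (B2 \<union> (B3 \<union> (B4 \<union> B5))) = {}" "B2 \<inter> (B3 \<union> (B4 \<union> B5)) = {}"
        "B3 \<inter> (B4 \<union> B5) = {}" "B4 \<inter> B5 = {}"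
        using B by (fastforce+)
      then show ?thesis using fin by (simp add: card_Un_disjoint)
    qed
    have lt: "a < k" "dual k < dual a" "k < dual k" if "a \<in> ?A" for a using that k by auto
    show ?thesis
    proof (rule gen)
      show "?A1 \<subseteq> {(p, q). p < k \<and> q = k}" using lt(1) by blast
      show "?A2 \<subseteq> {(p, q). p = k \<and> dual k < q}" using lt(2) by blast
      show "?A3 \<subseteq> {(p, q). p < k \<and> k < q}" using lt(1,3) by blast
      show "?A4 \<subseteq> {(p, q). k < p}" using lt(3) by blast
    qed auto
  qed
  moreover have "card (?A1 \<union> (?A2 \<union> (?A3 \<union> (?A4 \<union> ?A5)))) \<le> card (layer k)"
    by (rule card_mono [OF _ sub]) (rule finite_subset [OF _ finite_inversions], auto simp: layer_def)
  moreover have "card ?A5 = (if w (dual k) < w k then 1 else 0)" by simp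
  ultimately show ?thesis by linarith
qed

lemma card_inversions_ge:
  "m * (m - 1) + card {k \<in> {1..m}. w (dual k) < w k} \<le> card inversions"
proof -
  have fin: "finite (layer k)" for k
    by (rule finite_subset [OF _ finite_inversions]) (auto simp: layer_def)
  have "(\<Sum>k\<in>{1..m}. 2 * (k - 1)) = m * (m - 1)"
  proof (induction m)
    case (Suc m)
    then show ?case by (cases m) auto
  qed simp
  moreover have "card {k \<in> {1..m}. w (dual k) < w k} = (\<Sum>k\<in>{1..m}. if w (dual k) < w k then 1 else 0)"
    by (simp add: sum.If_cases Int_def conj_commute)
  ultimately have "m * (m - 1) + card {k \<in> {1..m}. w (dual k) < w k}
     = (\<Sum>k\<in>{1..m}. 2 * (k - 1) + (if w (dual k) < w k then 1 else 0))"
    by (simp add: sum.distrib)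
  also have "\<dots> \<le> (\<Sum>k\<in>{1..m}. card (layer k))" by (intro sum_mono card_layer_ge)
  also have "\<dots> = card (\<Union>k\<in>{1..m}. layer k)"
    using fin by (intro card_UN_disjoint [symmetric]) (auto simp: layer_def)
  also have "\<dots> \<le> card inversions"
    by (rule card_mono [OF finite_inversions]) (auto simp: layer_def)
  finally show ?thesis .
qed

text \<open>The layers already use up m(m-1) inversions, so no pair \<open>k\<close>,
  \<open>dual k\<close> is inverted and \<open>left\<close> never exceeds \<open>right\<close>. If
  both agree before \<open>a\<close>, a strict inequality at \<open>a\<close> contradicts
  \<open>left_dominates\<close> at level \<open>left a\<close>. Two increasing letters of one block
  are an odd number and its successor.\<close>

lemma few_inversions_structure:
  assumes few: "card inversions \<le> m * (m - 1)" and a: "a \<in> {1..m}"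
  shows "odd (w a)" "w (dual a) = w a + 1"
proof -
  have "card {k \<in> {1..m}. w (dual k) < w k} = 0" using card_inversions_ge few by linarith
  then have less: "w k < w (dual k)" if "k \<in> {1..m}" for k
  proof -
    have "\<not> w (dual k) < w k" using \<open>card _ = 0\<close> that by auto
    moreover have "w k \<noteq> w (dual k)" using that by (auto simp: w_inj)
    ultimately show ?thesis by simp
  qed
  have "left a = right a" using a
  proof (induction a rule: less_induct)
    case (less a)
    have le: "left a \<le> right a"
      using \<open>\<And>k. k \<in> {1..m} \<Longrightarrow> w k < w (dual k)\<close> [OF less.prems] by (simp add: left_def right_def div_le_mono)
    show ?case
    proof (rule ccontr)
      assume "left a \<noteq> right a"
      then have lt: "left a < right a" using le by simp
      have split: "{b \<in> {1..a}. P b} = {b \<in> {1..a - 1}. P b} \<union> (if P a then {a} else {})" for P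
        using less.prems by (auto simp: le_less)
      have "{b \<in> {1..a - 1}. left b \<le> left a} = {b \<in> {1..a - 1}. right b \<le> left a}"
        using less.IH less.prems by auto
      then have "card {b \<in> {1..a}. right b \<le> left a} < card {b \<in> {1..a}. left b \<le> left a}"
        unfolding split [of "\<lambda>b. left b \<le> left a"] split [of "\<lambda>b. right b \<le> left a"] using lt by simp
      then show False using left_dominates [of a "left a"] less.prems by simp
    qed
  qed
  then have "(w a + 1) div 2 = (w (dual a) + 1) div 2" "w a < w (dual a)"
    using less a by (auto simp: left_def right_def)
  then show "odd (w a)" "w (dual a) = w a + 1" by presburger+
qed

end

subsection \<open>Isotropic flags in Schubert varieties\<close>

lemma jmap_add: "jmap (x + y) = jmap x + jmap y"
  and jmap_smult: "jmap (z *s x) = cnj z *s jmap x"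
  and jmap_zero: "jmap 0 = 0"
  by (simp_all add: vec_eq_iff jmap_nth algebra_simps)

lemma jmap_sum: "jmap (\<Sum>i\<in>I. x i) = (\<Sum>i\<in>I. jmap (x i))"
  by (induction I rule: infinite_finite_induct) (auto simp: jmap_add jmap_zero)

lemma jmap_jmap: "jmap (jmap x) = - x"
  by (simp add: vec_eq_iff jmap_nth)

lemma om_add_left: "om (x + x') y = om x y + om x' y"
  and om_smult_left: "om (z *s x) y = z * om x y"
  by (simp_all add: om_def sum.distrib sum_distrib_left algebra_simps)

lemma om_diff_left: "om (x - x') y = om x y - om x' y"
  by (simp add: om_def sum_subtractf algebra_simps)

text \<open>By \<open>om_herm\<close> the image of \<open>A\<close> under \<open>jmap\<close> is
  Hermitian orthogonal to \<open>B\<close>, and both live on the coordinates in \<open>P\<close>. A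
  linear relation between them would give a nonzero vector orthogonal to itself.\<close>

lemma om_orthogonal_dim_le:
  fixes A B :: "(complex^('m::finite + 'm)) set"
  assumes A: "vec.subspace A" and B: "vec.subspace B" and P: "\<And>a. a \<in> P \<Longrightarrow> partner a \<in> P"
    and supp: "\<And>x a. x \<in> A \<union> B \<Longrightarrow> a \<notin> P \<Longrightarrow> x $ a = 0"
    and om: "\<And>x y. x \<in> A \<Longrightarrow> y \<in> B \<Longrightarrow> om x y = 0"
  shows "vec.dim A + vec.dim B \<le> card P"
proof (rule ccontr)
  assume less: "\<not> vec.dim A + vec.dim B \<le> card P"
  obtain BA where BA: "BA \<subseteq> A" "vec.independent BA" "A \<subseteq> vec.span BA" "card BA = vec.dim A"
    by (rule vec.basis_exists)
  obtain BB where BB: "BB \<subseteq> B" "vec.independent BB" "B \<subseteq> vec.span BB" "card BB = vec.dim B"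
    by (rule vec.basis_exists)
  have fin: "finite BA" "finite BB" using BA(2) BB(2) vec.finiteI_independent by blast+
  let ?J = "BA <+> BB"
  let ?M = "\<lambda>a v. case v of Inl x \<Rightarrow> jmap x $ a | Inr y \<Rightarrow> y $ a"
  have "card P < card ?J" using less fin BA(4) BB(4) by (simp add: card_Plus)
  then obtain z where z: "\<exists>j\<in>?J. z j \<noteq> 0" "\<forall>a\<in>P. (\<Sum>j\<in>?J. z j * ?M a j) = 0"
    using homogeneous_system_nontrivial [of P ?J ?M] fin by auto
  \<comment> \<open>\<open>jmap\<close> is conjugate linear, hence the conjugated
    coefficients.\<close>
  define x where "x = (\<Sum>v\<in>BA. cnj (z (Inl v)) *s v)"
  define y where "y = (\<Sum>v\<in>BB. z (Inr v) *s v)"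
  have xA: "x \<in> A" unfolding x_def using BA(1) by (intro vec.subspace_sum [OF A] vec.subspace_scale [OF A]) auto
  have yB: "y \<in> B" unfolding y_def using BB(1) by (intro vec.subspace_sum [OF B] vec.subspace_scale [OF B]) auto
  have "(jmap x + y) $ a = 0" for a
  proof (cases "a \<in> P")
    case True
    have "(\<Sum>j\<in>?J. z j * ?M a j) = (\<Sum>v\<in>BA. z (Inl v) * jmap v $ a) + (\<Sum>v\<in>BB. z (Inr v) * v $ a)"
      using fin by (simp add: sum.Plus)
    also have "\<dots> = (jmap x + y) $ a" by (simp add: x_def y_def jmap_sum jmap_smult)
    finally show ?thesis using z(2) True by simp
  next
    case False
    then have "partner a \<notin> P" using P by fastforce
    then show ?thesis using False supp [of x] supp [of y] xA yB by (simp add: jmap_nth)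
  qed
  then have "jmap x + y = 0" by (simp add: vec_eq_iff)
  then have y': "y = - jmap x" by (simp add: eq_neg_iff_add_eq_0 add.commute)
  have "herm (jmap x) (jmap x) = om x y" by (simp add: om_herm y' herm_def sum_negf)
  then have "jmap x = 0" using om [OF xA yB] by (simp add: herm_self)
  then have "y = 0" "x = 0" using y' jmap_jmap [of x] by (simp_all add: jmap_zero)
  have "z (Inl v) = 0" if "v \<in> BA" for v
    using vec.independentD [OF BA(2) fin(1) subset_refl _ that, of "\<lambda>v. cnj (z (Inl v))"] \<open>x = 0\<close> by (simp add: x_def)
  moreover have "z (Inr v) = 0" if "v \<in> BB" for v
    using vec.independentD [OF BB(2) fin(2) subset_refl _ that, of "\<lambda>v. z (Inr v)"] \<open>y = 0\<close> by (simp add: y_def)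
  ultimately show False using z(1) by auto
qed

text \<open>By \<open>dims\<close> the two intersections exhaust the bound of
  \<open>om_orthogonal_dim_le\<close>. The part \<open>q\<close> outside \<open>P\<close> pairs
  trivially with vectors supported in \<open>P\<close>, so \<open>z\<close> is orthogonal to the
  second intersection; if it were new, it would enlarge the first beyond the bound.\<close>

lemma lower_part_in_isotropic_flag:
  fixes V :: "('m::finite + 'm) flag"
  assumes V: "V \<in> flag_manifold" and k: "k \<le> CARD('m + 'm)"
    and om: "\<And>x y. x \<in> V k \<Longrightarrow> y \<in> V (CARD('m + 'm) - k) \<Longrightarrow> om x y = 0"
    and P: "\<And>a. partner a \<in> P \<longleftrightarrow> a \<in> P"
    and dims: "card P \<le> vec.dim (V k \<inter> {x. \<forall>a. a \<notin> P \<longrightarrow> x $ a = 0}) +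
      vec.dim (V (CARD('m + 'm) - k) \<inter> {x. \<forall>a. a \<notin> P \<longrightarrow> x $ a = 0})"
    and b: "q + z \<in> V k" and z: "\<And>a. a \<notin> P \<Longrightarrow> z $ a = 0" and q: "\<And>a. a \<in> P \<Longrightarrow> q $ a = 0"
  shows "z \<in> V k"
proof (rule ccontr)
  let ?E = "{x :: complex^('m + 'm). \<forall>a. a \<notin> P \<longrightarrow> x $ a = 0}"
  let ?V' = "V (CARD('m + 'm) - k)"
  assume "z \<notin> V k"
  have E: "vec.subspace ?E" by (auto simp: vec.subspace_def)
  have N: "vec.subspace (V k \<inter> ?E)" "vec.subspace (?V' \<inter> ?E)"
    by (intro vec.subspace_inter flag_subspace V E)+
  have omz: "om z y = 0" if y: "y \<in> ?V' \<inter> ?E" for y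
  proof -
    have "q $ a * y $ partner a = 0" for a using y q [of a] P [of a] by auto
    then have "om q y = 0" unfolding om_def mult.assoc by (intro sum.neutral) auto
    then show ?thesis using om [OF b, of y] y by (simp add: om_add_left)
  qed
  have span: "om x y = 0" if x: "x \<in> vec.span (insert z (V k \<inter> ?E))" and y: "y \<in> ?V' \<inter> ?E" for x y
  proof -
    obtain c where "x - c *s z \<in> vec.span (V k \<inter> ?E)" using x unfolding vec.span_insert by blast
    then have "x - c *s z \<in> V k \<inter> ?E" using N(1) by (simp add: vec.span_eq_iff [THEN iffD2, OF N(1)])
    then have "om (x - c *s z) y = 0" using y om by blast
    then show ?thesis using omz [OF y] by (simp add: om_diff_left om_smult_left)
  qed
  have "z \<in> ?E" using z by blast
  have "vec.span (insert z (V k \<inter> ?E)) \<subseteq> ?E"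
    by (rule vec.span_minimal [OF _ E]) (use \<open>z \<in> ?E\<close> in blast)
  then have "vec.dim (vec.span (insert z (V k \<inter> ?E))) + vec.dim (?V' \<inter> ?E) \<le> card P"
    using span P by (intro om_orthogonal_dim_le vec.subspace_span N(2)) auto
  moreover have "z \<notin> vec.span (V k \<inter> ?E)"
    using \<open>z \<notin> V k\<close> vec.span_eq_iff [THEN iffD2, OF N(1)] by blast
  ultimately show False using dims by (simp add: vec.dim_insert)
qed

lemma flag_of_basis_eq_coord_flag:
  fixes v :: "nat \<Rightarrow> complex^('n::finite)"
  assumes ord: "bij_betw ord (UNIV :: 'n set) {1..CARD('n)}"
    and v: "\<And>a. \<exists>z. z \<noteq> 0 \<and> v (ord a) = z *s axis a 1"
  shows "flag_of_basis v = coord_flag ord"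
proof
  fix k
  have E: "vec.subspace (coord_flag ord k)" by (auto simp: coord_flag_def vec.subspace_def)
  show "flag_of_basis v k = coord_flag ord k"
  proof
    show "flag_of_basis v k \<subseteq> coord_flag ord k"
      unfolding flag_of_basis_def
    proof (rule vec.span_minimal [OF _ E], clarify)
      fix j assume j: "j \<in> {1..min k CARD('n)}"
      then obtain a where a: "j = ord a" using ord by (auto simp: bij_betw_def image_iff set_eq_iff)
      then show "v j \<in> coord_flag ord k" using v [of a] j by (auto simp: coord_flag_iff axis_def)
    qed
    show "coord_flag ord k \<subseteq> flag_of_basis v k"
    proof
      fix x assume x: "x \<in> coord_flag ord k"
      have "x = (\<Sum>a\<in>UNIV. x $ a *s axis a 1)" by (simp add: basis_expansion)
      also have "\<dots> \<in> flag_of_basis v k" unfolding flag_of_basis_def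
      proof (rule vec.span_sum)
        fix a
        show "x $ a *s axis a 1 \<in> vec.span (v ` {1..min k CARD('n)})"
        proof (cases "ord a \<le> k")
          case True
          then have "v (ord a) \<in> vec.span (v ` {1..min k CARD('n)})"
            using bij_betwE [OF ord] by (intro vec.span_base) auto
          moreover obtain z where "z \<noteq> 0" "v (ord a) = z *s axis a 1" using v by blast
          moreover from this have "x $ a *s axis a 1 = (x $ a / z) *s v (ord a)" by simp
          ultimately show ?thesis using vec.span_scale by metis
        next
          case False
          then have "x $ a = 0" using x by (simp add: coord_flag_iff)
          then show ?thesis by (simp add: vec.span_zero)
        qed
      qed
      finally show "x \<in> flag_of_basis v k" .
    qed
  qed
qed

section \<open>Coordinates adapted to the Iwasawa basis\<close>

locale iwasawa_frame =
  fixes m :: nat and \<iota> :: "nat \<Rightarrow> 'm::finite"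
  assumes \<iota>: "bij_betw \<iota> {1..m} UNIV"
begin

definition idx :: "'m \<Rightarrow> nat" where "idx = inv_into {1..m} \<iota>"

text \<open>Up to sign, \<open>axis a 1\<close> is the vector numbered \<open>pos a\<close> in
  \<open>iwasawa_basis \<iota>\<close>; partners occupy a block {2i-1, 2i}.\<close>

definition pos :: "'m + 'm \<Rightarrow> nat" where
  "pos = case_sum (\<lambda>i. 2 * idx i - 1) (\<lambda>i. 2 * idx i)"

lemma CARD_m: "CARD('m) = m" "CARD('m + 'm) = 2 * m"
  using bij_betw_same_card [OF \<iota>] by simp_all

lemma idx: "idx i \<in> {1..m}" "\<iota> (idx i) = i"
  using \<iota> unfolding idx_def by (metis UNIV_I bij_betw_def inv_into_into, metis UNIV_I bij_betw_inv_into_right)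

text \<open>This makes the members of even index in the reference flag invariant under
  \<open>jmap\<close>.\<close>

lemma pos_partner_le: "pos (partner a) \<le> 2 * i \<longleftrightarrow> pos a \<le> 2 * i"
  using idx(1) by (cases a) (auto simp: pos_def)

lemma bij_pos: "bij_betw pos UNIV {1..CARD('m + 'm)}"
proof (rule bij_betw_imageI)
  show "inj pos"
  proof (rule injI)
    fix a b assume eq: "pos a = pos b"
    have ge: "idx i \<ge> 1" for i using idx(1) [of i] by simp
    have ij: "i = j" if "idx i = idx j" for i j using idx(2) that by metis
    show "a = b"
    proof (cases a; cases b)
      fix i j assume [simp]: "a = Inl i" "b = Inl j"
      have "idx i = idx j" using eq ge [of i] ge [of j] by (simp add: pos_def)
      then show ?thesis using ij by simp
    next
      fix i j assume [simp]: "a = Inl i" "b = Inr j"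
      have "2 * idx i = 2 * idx j + 1" using eq ge [of i] by (simp add: pos_def)
      then show ?thesis by presburger
    next
      fix i j assume [simp]: "a = Inr i" "b = Inl j"
      have "2 * idx j = 2 * idx i + 1" using eq ge [of j] by (simp add: pos_def)
      then show ?thesis by presburger
    next
      fix i j assume [simp]: "a = Inr i" "b = Inr j"
      have "idx i = idx j" using eq by (simp add: pos_def)
      then show ?thesis using ij by simp
    qed
  qed
  show "range pos = {1..CARD('m + 'm)}"
  proof (rule card_subset_eq)
    show "range pos \<subseteq> {1..CARD('m + 'm)}"
    proof clarify
      fix a show "pos a \<in> {1..CARD('m + 'm)}"
      proof (cases a)
        case (Inl i)
        then show ?thesis using idx(1) [of i] CARD_m(2) by (auto simp: pos_def)
      next
        case (Inr i)
        then show ?thesis using idx(1) [of i] CARD_m(2) by (auto simp: pos_def)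
      qed
    qed
    show "card (range pos) = card {1..CARD('m + 'm)}" using \<open>inj pos\<close> by (simp add: card_image)
  qed simp
qed

lemma iwasawa_basis_pos: "\<exists>z. z \<noteq> 0 \<and> iwasawa_basis \<iota> (pos a) = z *s axis a 1"
proof (cases a)
  case (Inl i)
  have "odd (pos a)" "(pos a + 1) div 2 = idx i"
    using idx(1) [of i] by (auto simp: Inl pos_def)
  then have "iwasawa_basis \<iota> (pos a) = 1 *s axis a 1"
    by (simp add: iwasawa_basis_def e_vec_def idx(2) Inl)
  then show ?thesis by (intro exI [of _ 1]) auto
next
  case (Inr i)
  have "iwasawa_basis \<iota> (pos a) = (- 1) *s axis a 1"
    by (simp add: iwasawa_basis_def Inr pos_def jmap_e_vec idx(2) vec_eq_iff)
  then show ?thesis by (intro exI [of _ "- 1"]) auto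
qed

lemma iwasawa_flag: "flag_of_basis (iwasawa_basis \<iota>) = coord_flag pos"
  by (rule flag_of_basis_eq_coord_flag [OF bij_pos iwasawa_basis_pos])

lemma borel_eq: "iwasawa_borel \<iota> = flag_borel pos"
  by (auto simp: iwasawa_borel_def flag_borel_def iwasawa_flag SL_C_def)

context
  fixes w :: "nat \<Rightarrow> nat"
  assumes w: "w permutes {1..2 * m}"
begin

text \<open>The axis \<open>a\<close> enters the coordinate flag of \<open>w\<close> at the step
  \<open>k\<close> with \<open>w k = pos a\<close>, hence the inverse of \<open>w\<close>.\<close>

lemma bij_order: "bij_betw (inv w \<circ> pos) UNIV {1..CARD('m + 'm)}"
  using bij_betw_trans [OF bij_pos permutes_imp_bij [OF permutes_inv [OF w], folded CARD_m(2)]] .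

lemma w_order: "w ((inv w \<circ> pos) a) = pos a"
  using permutes_inverses(1) [OF w] by simp

lemma coordinate_flag_eq: "coordinate_flag \<iota> w = coord_flag (inv w \<circ> pos)"
  unfolding coordinate_flag_def
  by (rule flag_of_basis_eq_coord_flag [OF bij_order]) (simp only: w_order iwasawa_basis_pos)

lemma schubert_eq: "schubert \<iota> w = schubert_variety pos (inv w \<circ> pos)"
  by (simp add: schubert_def schubert_variety_def borel_eq coordinate_flag_eq)

lemma card_order_pairs: "card {c. (inv w \<circ> pos) c \<le> k \<and> pos c \<le> l} = card {a \<in> {1..k}. w a \<le> l}" if "k \<le> 2 * m"
proof -
  have "bij_betw (inv w \<circ> pos) {c. (inv w \<circ> pos) c \<le> k \<and> pos c \<le> l} {a \<in> {1..k}. w a \<le> l}"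
  proof (rule bij_betw_imageI)
    show "inj_on (inv w \<circ> pos) {c. (inv w \<circ> pos) c \<le> k \<and> pos c \<le> l}"
      using bij_order by (auto simp: bij_betw_def inj_on_def)
    show "(inv w \<circ> pos) ` {c. (inv w \<circ> pos) c \<le> k \<and> pos c \<le> l} = {a \<in> {1..k}. w a \<le> l}"
    proof (intro equalityI subsetI)
      fix a assume "a \<in> (inv w \<circ> pos) ` {c. (inv w \<circ> pos) c \<le> k \<and> pos c \<le> l}"
      then obtain c where c: "a = (inv w \<circ> pos) c" "(inv w \<circ> pos) c \<le> k" "pos c \<le> l" by blast
      have "(inv w \<circ> pos) c \<in> {1..CARD('m + 'm)}" using bij_betwE [OF bij_order] by blast
      then show "a \<in> {a \<in> {1..k}. w a \<le> l}" using c w_order [of c] by simp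
    next
      fix a assume a: "a \<in> {a \<in> {1..k}. w a \<le> l}"
      then have "a \<in> {1..CARD('m + 'm)}" using that CARD_m(2) by auto
      then obtain c where c: "a = (inv w \<circ> pos) c" using bij_order by (auto simp: bij_betw_def image_iff set_eq_iff)
      then show "a \<in> (inv w \<circ> pos) ` {c. (inv w \<circ> pos) c \<le> k \<and> pos c \<le> l}"
        using a w_order [of c] by auto
    qed
  qed
  then show ?thesis by (rule bij_betw_same_card)
qed

end

end

text \<open>Once \<open>w\<close> is known, it is enough to find each axis in the member where it
  should enter. A dimension count supplies a vector there with the right leading coordinate, and the
  equality of dimensions at even levels allows its tail to be stripped.\<close>

lemma isotropic_flag_in_schubert_variety:
  fixes m :: nat and \<iota> :: "nat \<Rightarrow> 'm::finite" and V :: "('m + 'm) flag"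
  assumes \<iota>: "bij_betw \<iota> {1..m} UNIV" and w: "w permutes {1..2 * m}"
    and V: "V \<in> schubert \<iota> w"
    and om: "\<And>k x y. k \<le> CARD('m + 'm) \<Longrightarrow> x \<in> V k \<Longrightarrow> y \<in> V (CARD('m + 'm) - k) \<Longrightarrow> om x y = 0"
    and few: "cdim (schubert \<iota> w) \<le> m * (m - 1)"
  shows "(\<forall>a\<in>{1..m}. odd (w a) \<and> w (2 * m + 1 - a) = w a + 1) \<and> V = coordinate_flag \<iota> w"
proof -
  interpret iwasawa_frame m \<iota> by unfold_locales (rule \<iota>)
  let ?ord = "inv w \<circ> pos" and ?n = "CARD('m + 'm)"
  have VS: "V \<in> schubert_variety pos ?ord" using V by (simp add: schubert_eq [OF w])
  then have VZ: "V \<in> flag_manifold" using schubert_variety_subset by blast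
  have ord: "bij_betw ?ord UNIV {1..?n}" by (rule bij_order [OF w])
  define cnt where "cnt k l = card {a \<in> {1..k}. w a \<le> l}" for k l
  define E where "E l = coord_flag pos l" for l
  have E: "vec.subspace (E l)" for l by (auto simp: E_def coord_flag_def vec.subspace_def)
  have VE: "vec.subspace (V k \<inter> E l)" for k l by (intro vec.subspace_inter flag_subspace VZ E)
  have EP: "E l = {x. \<forall>a. a \<notin> {a. pos a \<le> l} \<longrightarrow> x $ a = 0}" for l
    by (auto simp: E_def coord_flag_def)
  have rank: "cnt k l \<le> vec.dim (V k \<inter> E l)" if "k \<le> 2 * m" for k l
    using schubert_variety_rank [OF VS, of k l] card_order_pairs [OF w that] by (simp add: cnt_def E_def)
  have card_pos: "card {a. pos a \<le> 2 * i} = 2 * i" if "i \<le> m" for i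
    using card_ord_le [OF bij_pos, of "2 * i"] that CARD_m(2) by simp
  have dual_dim: "vec.dim (V k \<inter> E (2 * i)) + vec.dim (V (2 * m - k) \<inter> E (2 * i)) \<le> 2 * i"
    if k: "k \<le> 2 * m" and i: "i \<le> m" for k i
  proof (rule om_orthogonal_dim_le [OF VE VE, where P = "{a. pos a \<le> 2 * i}", unfolded card_pos [OF i]])
    show "partner a \<in> {a. pos a \<le> 2 * i}" if "a \<in> {a. pos a \<le> 2 * i}" for a
      using that pos_partner_le by simp
    show "x $ a = 0" if "x \<in> V k \<inter> E (2 * i) \<union> V (2 * m - k) \<inter> E (2 * i)" "a \<notin> {a. pos a \<le> 2 * i}" for x a
      using that EP by blast
    show "om x y = 0" if "x \<in> V k \<inter> E (2 * i)" "y \<in> V (2 * m - k) \<inter> E (2 * i)" for x y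
      using om [of k x y] that k CARD_m(2) by auto
  qed
  interpret self_dual_word m w
  proof
    show "w permutes {1..2 * m}" by (rule w)
    fix k i assume "k \<le> 2 * m" "i \<le> m"
    then show "card {a \<in> {1..k}. w a \<le> 2 * i} + card {a \<in> {1..2 * m - k}. w a \<le> 2 * i} \<le> 2 * i"
      using dual_dim [of k i] rank [of k "2 * i"] rank [of "2 * m - k" "2 * i"] by (simp add: cnt_def)
  qed
  have "card inversions \<le> m * (m - 1)"
  proof -
    let ?J = "{(r, a). pos r < pos a \<and> ?ord a < ?ord r}"
    have "inversions \<subseteq> (\<lambda>(r, a). (?ord a, ?ord r)) ` ?J"
    proof
      fix pq assume "pq \<in> inversions"
      then obtain p q where pq: "pq = (p, q)" "p \<in> {1..2 * m}" "q \<in> {1..2 * m}" "p < q" "w q < w p"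
        by (auto simp: inversions_def)
      then obtain a r where "p = ?ord a" "q = ?ord r"
        using ord unfolding bij_betw_def CARD_m(2) by (metis imageE)
      then have "(r, a) \<in> ?J" "pq = (\<lambda>(r, a). (?ord a, ?ord r)) (r, a)"
        using pq w_order [OF w, of a] w_order [OF w, of r] by simp_all
      then show "pq \<in> (\<lambda>(r, a). (?ord a, ?ord r)) ` ?J" by blast
    qed
    then have "card inversions \<le> card ?J" by (rule surj_card_le [rotated]) simp
    also have "\<dots> \<le> cdim (schubert \<iota> w)"
      using cdim_schubert_variety_ge [OF bij_pos ord] by (simp only: schubert_eq [OF w])
    finally show ?thesis using few by linarith
  qed
  then have struct: "odd (w a)" "w (dual a) = w a + 1" if "a \<in> {1..m}" for a
    using few_inversions_structure that by blast+
  \<comment> \<open>Mirror positions carry letters of the same block, which makes the inequalities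
    of \<open>balanced\<close> equalities.\<close>
  have le_iff: "w (dual a) \<le> 2 * i \<longleftrightarrow> w a \<le> 2 * i" if "a \<in> {1..2 * m}" for a i
  proof (cases "a \<le> m")
    case True
    then show ?thesis using struct [of a] that by auto presburger
  next
    case False
    then have "dual a \<in> {1..m}" "dual (dual a) = a" using that by auto
    then show ?thesis using struct [of "dual a"] by auto presburger
  qed
  have cnt_sum: "cnt k (2 * i) + cnt (2 * m - k) (2 * i) = 2 * i" if k: "k \<le> 2 * m" and i: "i \<le> m" for k i
  proof -
    have "{a \<in> {1..k}. w (dual a) \<le> 2 * i} = {a \<in> {1..k}. w a \<le> 2 * i}" using le_iff k by auto
    then show ?thesis using card_split [OF k, of "2 * i"] card_w_le [OF i] by (simp add: cnt_def)
  qed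
  have dim_eq: "vec.dim (V k \<inter> E (2 * i)) = cnt k (2 * i)" if "k \<le> 2 * m" "i \<le> m" for k i
    using dual_dim [OF that] rank [of k "2 * i"] rank [of "2 * m - k" "2 * i"] cnt_sum [OF that] that by linarith
  \<comment> \<open>Equality in the dimension bound is what allows vectors of \<open>V k\<close> to
    be split at an even level.\<close>
  have lower: "z \<in> V k" if k: "k \<le> 2 * m" and i: "i \<le> m" and b: "q + z \<in> V k"
      and z: "z \<in> E (2 * i)" and q: "\<And>a. pos a \<le> 2 * i \<Longrightarrow> q $ a = 0" for k i q z
  proof (rule lower_part_in_isotropic_flag [OF VZ _ om, where P = "{a. pos a \<le> 2 * i}" and q = q and k = k])
    show "card {a. pos a \<le> 2 * i} \<le> vec.dim (V k \<inter> {x. \<forall>a. a \<notin> {a. pos a \<le> 2 * i} \<longrightarrow> x $ a = 0}) +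
        vec.dim (V (?n - k) \<inter> {x. \<forall>a. a \<notin> {a. pos a \<le> 2 * i} \<longrightarrow> x $ a = 0})"
      unfolding EP [symmetric] card_pos [OF i] CARD_m(2) using dim_eq [OF k i] dim_eq [of "2 * m - k" i] cnt_sum [OF k i] i by simp
  qed (use k b z q pos_partner_le EP CARD_m(2) in auto)
  have line: "axis c 1 \<in> V k" if "z *s axis c 1 \<in> V k" "z \<noteq> 0" for c k and z :: complex
    using vec.subspace_scale [OF flag_subspace [OF VZ] that(1), of "inverse z"] that(2) by simp
  have pos_inj: "pos a = pos c \<longleftrightarrow> a = c" for a c
    using bij_pos by (auto simp: bij_betw_def dest: injD)
  have cnt_Suc: "cnt k (Suc l) = cnt k l + (if \<exists>a\<in>{1..k}. w a = Suc l then 1 else 0)" for k l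
  proof (cases "\<exists>a\<in>{1..k}. w a = Suc l")
    case True
    then obtain a where a: "a \<in> {1..k}" "w a = Suc l" by blast
    have "{a \<in> {1..k}. w a \<le> Suc l} = insert a {a \<in> {1..k}. w a \<le> l}"
      using a w_inj by (auto simp: le_Suc_eq) metis
    then show ?thesis using True a by (simp add: cnt_def)
  next
    case False
    then have "{a \<in> {1..k}. w a \<le> Suc l} = {a \<in> {1..k}. w a \<le> l}" by (auto simp: le_Suc_eq)
    then show ?thesis using False by (simp add: cnt_def)
  qed
  \<comment> \<open>Level \<open>2 * i\<close> lies just below \<open>pos c\<close>: the letter at
    \<open>?k\<close> adds a dimension there, and a new vector has its leading coordinate at
    \<open>c\<close>.\<close>
  have odd_case: "axis c 1 \<in> V (?ord c)" if c: "odd (pos c)" for c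
  proof -
    let ?k = "?ord c"
    have k: "?k \<in> {1..2 * m}" using bij_betwE [OF ord] CARD_m(2) by auto
    have "pos c \<in> {1..2 * m}" using bij_betwE [OF bij_pos] CARD_m(2) by auto
    with c obtain i where i: "pos c = Suc (2 * i)" "i \<le> m" by (auto elim!: oddE)
    have "cnt ?k (Suc (2 * i)) = cnt ?k (2 * i) + 1"
      using cnt_Suc [of ?k "2 * i"] k w_order [OF w, of c] i by auto
    then have "V ?k \<inter> E (Suc (2 * i)) \<noteq> V ?k \<inter> E (2 * i)"
      using rank [of ?k "Suc (2 * i)"] dim_eq [of ?k i] k i by fastforce
    then obtain b where b: "b \<in> V ?k" "b \<in> E (Suc (2 * i))" "b \<notin> E (2 * i)"
    proof -
      have "E (2 * i) \<subseteq> E (Suc (2 * i))" by (auto simp: E_def coord_flag_iff)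
      then show thesis using that \<open>V ?k \<inter> E (Suc (2 * i)) \<noteq> V ?k \<inter> E (2 * i)\<close> by blast
    qed
    define z where "z = b - b $ c *s axis c 1"
    have "z \<in> E (2 * i)"
      unfolding E_def coord_flag_iff
    proof (intro allI impI)
      fix a assume "2 * i < pos a"
      then have "a = c \<or> Suc (2 * i) < pos a" using i(1) pos_inj by (metis Suc_lessI)
      then show "z $ a = 0" using b(2) i(1) by (auto simp: z_def axis_def E_def coord_flag_iff)
    qed
    have "z \<in> V ?k"
    proof (rule lower [of ?k i "b $ c *s axis c 1", OF _ i(2) _ \<open>z \<in> E (2 * i)\<close>])
      show "?k \<le> 2 * m" using k by simp
      show "b $ c *s axis c 1 + z \<in> V ?k" using b(1) by (simp add: z_def)
      show "(b $ c *s axis c 1) $ a = 0" if "pos a \<le> 2 * i" for a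
        using that i(1) by (auto simp: axis_def)
    qed
    then have "b $ c *s axis c 1 \<in> V ?k"
      using vec.subspace_diff [OF flag_subspace [OF VZ] b(1), of z] by (simp add: z_def)
    moreover have "b $ c \<noteq> 0" using b(3) \<open>z \<in> E (2 * i)\<close> by (auto simp: z_def)
    ultimately show ?thesis using line by blast
  qed
  \<comment> \<open>Now an odd level lies just below \<open>pos c\<close>, where no splitting is
    available. The axis \<open>c'\<close> of the odd letter of the block is already in
    \<open>V ?k\<close>, since \<open>dual ?k\<close> comes before \<open>?k\<close>, and bridges
    the gap down to level \<open>2 * i\<close>.\<close>
  have even_case: "axis c 1 \<in> V (?ord c)" if c: "even (pos c)" for c
  proof -
    let ?k = "?ord c"
    have k: "?k \<in> {1..2 * m}" using bij_betwE [OF ord] CARD_m(2) by auto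
    have "pos c \<in> {1..2 * m}" using bij_betwE [OF bij_pos] CARD_m(2) by auto
    with c obtain i where i: "pos c = Suc (Suc (2 * i))" "Suc i \<le> m"
    proof -
      obtain j where j: "pos c = 2 * j" using c by (elim evenE)
      then obtain i where "j = Suc i" using \<open>pos c \<in> {1..2 * m}\<close> by (cases j) auto
      then show thesis using that [of i] j \<open>pos c \<in> {1..2 * m}\<close> by simp
    qed
    have wk: "w ?k = Suc (Suc (2 * i))" using w_order [OF w, of c] i by simp
    have km: "m < ?k" using struct(1) [of ?k] k wk by (cases "?k \<le> m") auto
    then have dk: "dual ?k \<in> {1..m}" "dual (dual ?k) = ?k" using k by auto
    then have wdk: "w (dual ?k) = Suc (2 * i)" using struct(2) [of "dual ?k"] wk by simp
    obtain c' where c': "pos c' = Suc (2 * i)" "?ord c' = dual ?k"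
    proof -
      have "dual ?k \<in> {1..?n}" using dk CARD_m(2) by auto
      then obtain c' where "dual ?k = ?ord c'" using ord unfolding bij_betw_def by (metis imageE)
      then show thesis using that [of c'] w_order [OF w, of c'] wdk by simp
    qed
    have ax': "axis c' 1 \<in> V ?k"
      using odd_case [of c'] flag_mono [OF VZ, of "?ord c'" ?k] c' dk km by auto
    \<comment> \<open>Both letters of the block occur by position \<open>?k\<close>, so at least two
      dimensions are added to level \<open>2 * i\<close>, and \<open>axis c' 1\<close> accounts for
      only one.\<close>
    have ne: "\<not> V ?k \<inter> E (Suc (Suc (2 * i))) \<subseteq> E (Suc (2 * i))"
    proof
      assume sub: "V ?k \<inter> E (Suc (Suc (2 * i))) \<subseteq> E (Suc (2 * i))"
      have "V ?k \<inter> E (Suc (Suc (2 * i))) \<subseteq> vec.span (insert (axis c' 1) (V ?k \<inter> E (2 * i)))"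
      proof
        fix b assume b: "b \<in> V ?k \<inter> E (Suc (Suc (2 * i)))"
        have "b \<in> E (Suc (2 * i))" using b sub by blast
        have "b - b $ c' *s axis c' 1 \<in> E (2 * i)"
          unfolding E_def coord_flag_iff
        proof (intro allI impI)
          fix a assume "2 * i < pos a"
          then have "a = c' \<or> Suc (2 * i) < pos a" using c'(1) pos_inj by (metis Suc_lessI)
          then show "(b - b $ c' *s axis c' 1) $ a = 0"
            using \<open>b \<in> E (Suc (2 * i))\<close> c'(1) by (auto simp: axis_def E_def coord_flag_iff)
        qed
        moreover have "b - b $ c' *s axis c' 1 \<in> V ?k"
          using b ax' by (intro vec.subspace_diff vec.subspace_scale flag_subspace [OF VZ]) auto
        ultimately show "b \<in> vec.span (insert (axis c' 1) (V ?k \<inter> E (2 * i)))"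
          unfolding vec.span_insert by (auto intro: vec.span_base)
      qed
      then have "vec.dim (V ?k \<inter> E (Suc (Suc (2 * i)))) \<le> vec.dim (vec.span (insert (axis c' 1) (V ?k \<inter> E (2 * i))))"
        by (rule vec.dim_subset)
      also have "\<dots> \<le> vec.dim (V ?k \<inter> E (2 * i)) + 1" by (simp add: vec.dim_insert)
      also have "\<dots> = cnt ?k (2 * i) + 1" using dim_eq [of ?k i] k i by simp
      also have "\<dots> < cnt ?k (Suc (Suc (2 * i)))"
      proof -
        have "\<exists>a\<in>{1..?k}. w a = Suc (2 * i)" using wdk dk km by (intro bexI [of _ "dual ?k"]) auto
        moreover have "\<exists>a\<in>{1..?k}. w a = Suc (Suc (2 * i))" using wk k by (intro bexI [of _ ?k]) auto
        ultimately show ?thesis by (simp add: cnt_Suc)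
      qed
      also have "\<dots> \<le> vec.dim (V ?k \<inter> E (Suc (Suc (2 * i))))" using rank k by simp
      finally show False by simp
    qed
    then obtain b where b: "b \<in> V ?k" "b \<in> E (Suc (Suc (2 * i)))" "b \<notin> E (Suc (2 * i))" by blast
    define z where "z = b - b $ c *s axis c 1 - b $ c' *s axis c' 1"
    have "z \<in> E (2 * i)"
      unfolding E_def coord_flag_iff
    proof (intro allI impI)
      fix a assume a: "2 * i < pos a"
      have "a = c \<or> a = c' \<or> Suc (Suc (2 * i)) < pos a" using a c'(1) i(1) pos_inj by (metis Suc_lessI)
      moreover have "c \<noteq> c'" using c'(1) i(1) by auto
      ultimately show "z $ a = 0" using b(2) i(1) c'(1) by (auto simp: z_def axis_def E_def coord_flag_iff)
    qed
    have "b - b $ c' *s axis c' 1 \<in> V ?k"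
      using b ax' by (intro vec.subspace_diff vec.subspace_scale flag_subspace [OF VZ]) auto
    then have bz: "b $ c *s axis c 1 + z \<in> V ?k" by (simp add: z_def)
    have "z \<in> V ?k"
    proof (rule lower [of ?k i "b $ c *s axis c 1", OF _ _ bz \<open>z \<in> E (2 * i)\<close>])
      show "?k \<le> 2 * m" "i \<le> m" using k i(2) by simp_all
      show "(b $ c *s axis c 1) $ a = 0" if "pos a \<le> 2 * i" for a
        using that i(1) by (auto simp: axis_def)
    qed
    then have "b $ c *s axis c 1 \<in> V ?k"
      using vec.subspace_diff [OF flag_subspace [OF VZ] bz, of z] by simp
    moreover have "b $ c \<noteq> 0"
    proof
      assume "b $ c = 0"
      have "b \<in> E (Suc (2 * i))"
        unfolding E_def coord_flag_iff
      proof (intro allI impI)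
        fix a assume "Suc (2 * i) < pos a"
        then have "a = c \<or> Suc (Suc (2 * i)) < pos a" using i(1) pos_inj by (metis Suc_lessI)
        then show "b $ a = 0" using b(2) \<open>b $ c = 0\<close> by (auto simp: E_def coord_flag_iff)
      qed
      then show False using b(3) by simp
    qed
    ultimately show ?thesis using line by blast
  qed
  have "coord_flag ?ord = V"
  proof (rule flag_eqI [OF coord_flag_in_manifold [OF ord] VZ], rule subsetI)
    fix k x assume x: "x \<in> coord_flag ?ord k"
    have "x = (\<Sum>a\<in>UNIV. x $ a *s axis a 1)" by (simp add: basis_expansion)
    also have "\<dots> \<in> V k"
    proof (rule vec.subspace_sum [OF flag_subspace [OF VZ]])
      fix a
      show "x $ a *s axis a 1 \<in> V k"
      proof (cases "?ord a \<le> k")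
        case True
        then have "axis a 1 \<in> V k" using odd_case even_case flag_mono [OF VZ] by blast
        then show ?thesis by (rule vec.subspace_scale [OF flag_subspace [OF VZ]])
      next
        case False
        then have "x $ a = 0" using x by (simp add: coord_flag_iff)
        then show ?thesis using vec.subspace_0 [OF flag_subspace [OF VZ]] by simp
      qed
    qed
    finally show "x \<in> V k" .
  qed
  then show ?thesis using struct coordinate_flag_eq [OF w] by simp
qed

theorem theorem25:
  fixes m :: nat and \<iota> :: "nat \<Rightarrow> 'm::finite"
    and D C\<^sub>0 :: "('m + 'm) flag set" and w :: "nat \<Rightarrow> nat"
  assumes "bij_betw \<iota> {1..m} UNIV"
    and "is_open_orbit D"
    and "is_base_cycle D C\<^sub>0"
    and "w permutes {1..2 * m}"
    and "cdim (schubert \<iota> w) + cdim C\<^sub>0 = cdim (flag_manifold :: ('m + 'm) flag set)"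
    and "schubert \<iota> w \<inter> C\<^sub>0 \<noteq> {}"
  shows "\<exists>s. corresponding_perm m w s \<and>
           schubert \<iota> w \<inter> C\<^sub>0 = {flag_of_basis (intersection_basis \<iota> m s)}"
proof -
  interpret iwasawa_frame m \<iota> by unfold_locales (rule assms(1))
  note w = assms(4)
  obtain V\<^sub>0 where C: "C\<^sub>0 = flag_orbit K\<^sub>0 V\<^sub>0" and sub: "complex_submanifold C\<^sub>0"
    using assms(3) by (auto simp: is_base_cycle_def)
  \<comment> \<open>Complementary dimension turns the lower bound for \<open>cdim C\<^sub>0\<close>
    into an upper bound for the Schubert variety.\<close>
  have few: "cdim (schubert \<iota> w) \<le> m * (m - 1)"
    using cdim_le_of_complementary [OF C sub] assms(5) CARD_m(1) by simp
  have unique: "(\<forall>a\<in>{1..m}. odd (w a) \<and> w (2 * m + 1 - a) = w a + 1) \<and> V = coordinate_flag \<iota> w"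
    if "V \<in> schubert \<iota> w \<inter> C\<^sub>0" for V
    using that by (intro isotropic_flag_in_schubert_variety [OF assms(1) w _ _ few] base_cycle_isotropic [OF C sub]) auto
  obtain V where V: "V \<in> schubert \<iota> w \<inter> C\<^sub>0" using assms(6) by blast
  have struct: "odd (w a)" "w (2 * m + 1 - a) = w a + 1" if "a \<in> {1..m}" for a
    using unique [OF V] that by blast+
  have single: "schubert \<iota> w \<inter> C\<^sub>0 = {coordinate_flag \<iota> w}"
    using unique V by blast
  \<comment> \<open>Outside \<open>{1..m}\<close> it is the identity, as \<open>permutes\<close>
    demands; inside, \<open>w a\<close> is odd, so halving loses no information.\<close>
  define s where "s a = (if a \<in> {1..m} then (w a + 1) div 2 else a)" for a
  have "s permutes {1..m}"
  proof (rule bij_imp_permutes)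
    have "inj_on s {1..m}"
    proof (rule inj_onI)
      fix a b assume ab: "a \<in> {1..m}" "b \<in> {1..m}" "s a = s b"
      then have "w a = w b" using struct(1) [OF ab(1)] struct(1) [OF ab(2)] by (auto simp: s_def elim!: oddE)
      then show "a = b" using permutes_inj [OF w] by (auto dest: injD)
    qed
    moreover have "s ` {1..m} \<subseteq> {1..m}"
    proof clarify
      fix a assume a: "a \<in> {1..m}"
      then have "w a \<in> {1..2 * m}" using permutes_in_image [OF w, of a] by auto
      then show "s a \<in> {1..m}" using a struct(1) [OF a] by (auto simp: s_def elim!: oddE)
    qed
    ultimately show "bij_betw s {1..m} {1..m}"
      by (simp add: bij_betw_def endo_inj_surj)
  qed (auto simp: s_def)
  then have corr: "corresponding_perm m w s"
    using struct by (simp add: corresponding_perm_def s_def)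
  have "intersection_basis \<iota> m s k = iwasawa_basis \<iota> (w k)" if k: "k \<in> {1..2 * m}" for k
  proof (cases "k \<le> m")
    case True
    then show ?thesis using k struct(1) [of k] by (simp add: intersection_basis_def iwasawa_basis_def s_def)
  next
    case False
    then have "2 * m + 1 - k \<in> {1..m}" "2 * m + 1 - (2 * m + 1 - k) = k" using k by auto
    then show ?thesis using False struct [of "2 * m + 1 - k"]
      by (auto simp: intersection_basis_def iwasawa_basis_def s_def)
  qed
  then have "intersection_basis \<iota> m s ` {1..min k CARD('m + 'm)} = (\<lambda>k. iwasawa_basis \<iota> (w k)) ` {1..min k CARD('m + 'm)}" for k
    using CARD_m(2) by (intro image_cong) auto
  then have "flag_of_basis (intersection_basis \<iota> m s) = coordinate_flag \<iota> w"
    unfolding coordinate_flag_def flag_of_basis_def by presburger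
  with corr single show ?thesis by auto
qed

end
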